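(* Let $Z=m_{11}P_{11}+m_{12}P_{12}+m_{21}P_{21}$ be a set of fat points in $\mathbb{P}^1\times\mathbb{P}^1$ with $m_{11},m_{12},m_{21}\ge 0$ integers and $m_{12}\ge m_{21}$. Put $B:=m_{12}-m_{11}$ and let $D_1(Z),\dots,D_4(Z)\subseteq\mathbb{N}^2$ be the sets defined in the context. If $m_{11}>m_{21}$, then for all $(a,b)\in\mathbb{N}^2$: $$\beta_{0,(a,b)}(Z)=\begin{cases}1 & \text{if }(a,b)\in D_1(Z),\\ \varphi_{m_{21}+B,\,B}(b) & \text{if }(a,b)\in D_2(Z),\\ 1+\varphi_{m_{21}+B,\,B}(b) & \text{if }(a,b)\in D_3(Z),\\ 1 & \text{if }(a,b)\in D_4(Z),\\ 0 & \text{otherwise,}\end{cases}$$ $$\beta_{1,(a,b)}(Z)=\begin{cases}1 & \text{if }(a,b-1)\in D_1(Z),\\ \beta_{0,(a,b-1)}(Z)+\beta_{0,(a-1,b)}(Z)-1 & \text{if }(a,b-1)\in D_2(Z)\cup D_3(Z),\\ 1 & \text{if }(a-1,b)\in D_4(Z),\\ 0 & \text{otherwise,}\end{cases}$$ $$\beta_{2,(a,b)}(Z)=\begin{cases}\beta_{0,(a-1,b-1)}(Z)-1 & \text{if }(a-1,b-1)\in D_2(Z)\cup D_3(Z),\\ 0 & \text{otherwise.}\end{cases}$$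
   Context: $k$ is an infinite field of characteristic $0$, and $R=k[x_0,x_1,x_2,x_3]$ is the coordinate ring of $\mathbb{P}^1\times\mathbb{P}^1$, bigraded by $\deg x_0=\deg x_1=(1,0)$, $\deg x_2=\deg x_3=(0,1)$. $\mathbb{N}=\{0,1,2,\dots\}$ and $(n)_+:=\max\{n,0\}$. Fat points: let $H_1,H_2$ be two non-proportional nonzero forms of degree $(1,0)$ and $V_1,V_2$ two non-proportional nonzero forms of degree $(0,1)$. $P_{ij}$ is the point with bihomogeneous ideal $I_{P_{ij}}=(H_i,V_j)$. For $Z=m_{11}P_{11}+m_{12}P_{12}+m_{21}P_{21}$ put $I_Z=I_{P_{11}}^{m_{11}}\cap I_{P_{12}}^{m_{12}}\cap I_{P_{21}}^{m_{21}}$ (with $I^0=R$). Betti numbers: $\beta_{u,(i,j)}(Z)$, $u=0,1,2$, are defined by the minimal bigraded free resolution of the ideal $$0\to\bigoplus R(-i,-j)^{\beta_{2,(i,j)}(Z)}\to\bigoplus R(-i,-j)^{\beta_{1,(i,j)}(Z)}\to\bigoplus R(-i,-j)^{\beta_{0,(i,j)}(Z)}\to I_Z\to 0,$$ so $\beta_{0,(i,j)}(Z)$ is the number of minimal generators of $I_Z$ of degree $(i,j)$. $\beta_{u,(i,j)}(Z)=0$ if $i<0$ or $j<0$. Numerical functions: for $t\in\mathbb{Z}$ define $\varphi_t:\mathbb{Z}\to\mathbb{Z}$ by: $\varphi_t=0$ for $t\le 0$; $\varphi_1(0)=1$ and $\varphi_1(n)=0$ for $n\ne0$; and for $t>1$,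 $\varphi_t(n)=\varphi_{t-1}(n)$ if $0\le n<t-1$, $\varphi_t(n)=\varphi_{t-1}(n)+1$ if $t-1\le n<2t-1$, and $\varphi_t(n)=0$ otherwise. For integers $t\ge d$ put $\varphi_{t,d}(n)=\varphi_t(n+d)-\varphi_d(n+d)$. The sets $D_i(Z)$, with $B=m_{12}-m_{11}$: $D_1(Z)=\{(a,b)\in\mathbb{N}^2 : 0\le b<(-B)_+-(-B-m_{21})_+,\ a+2b=m_{11}+m_{21}\}$; $D_2(Z)=\{(a,b)\in\mathbb{N}^2 : (-B)_+-(-B-m_{21})_+\le b<m_{21},\ a+b=\max\{m_{11},m_{12}+m_{21}\}\}$; $D_3(Z)=\{(a,b)\in\mathbb{N}^2 : m_{21}\le b\le m_{21}+|B+m_{21}|,\ a+b=\max\{m_{11},m_{12}+m_{21}\}\}$; $D_4(Z)=\{(a,b)\in\mathbb{N}^2 : b>m_{21}+|B+m_{21}|,\ 2a+b=m_{11}+m_{12}\}$. *)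

theory Defs
  imports
    "HOL-Library.Poly_Mapping"
    "HOL-Library.Numeral_Type"
    "HOL-Library.Product_Plus"
    "Jordan_Normal_Form.Matrix_Kernel"
begin

text \<open>A monomial is an exponent vector indexed by the four-element type \<open>4 = {0, 1, 2, 3}\<close>;
  a polynomial is a finitely supported function from monomials to coefficients, with the
  convolution product of \<open>Poly_Mapping\<close>.\<close>

type_synonym 'k R4 = "(4 \<Rightarrow>\<^sub>0 nat) \<Rightarrow>\<^sub>0 'k"

definition Var :: "4 \<Rightarrow> 'k::field R4"
  where "Var i = Poly_Mapping.single (Poly_Mapping.single i 1) 1"

definition Const :: "'k::field \<Rightarrow> 'k R4"
  where "Const c = Poly_Mapping.single 0 c"

definition bidegree :: "(4 \<Rightarrow>\<^sub>0 nat) \<Rightarrow> int \<times> int"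
  where "bidegree m =
    (int (Poly_Mapping.lookup m 0 + Poly_Mapping.lookup m 1),
     int (Poly_Mapping.lookup m 2 + Poly_Mapping.lookup m 3))"

text \<open>Membership in the graded piece \<open>R\<^bsub>d\<^esub>\<close>. It contains \<open>0\<close> for every \<open>d\<close>, and only \<open>0\<close> if a
  component of \<open>d\<close> is negative.\<close>

definition bihomogeneous :: "int \<times> int \<Rightarrow> 'k::field R4 \<Rightarrow> bool"
  where "bihomogeneous d p \<longleftrightarrow> (\<forall>m \<in> Poly_Mapping.keys p. bidegree m = d)"

definition ideal_span :: "'a::comm_ring_1 set \<Rightarrow> 'a set"
  where "ideal_span S = Modules.module.span (*) S"

definition ideal_times :: "'a::comm_ring_1 set \<Rightarrow> 'a set \<Rightarrow> 'a set"
  where "ideal_times I J = ideal_span {a * b |a b. a \<in> I \<and> b \<in> J}"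

primrec ideal_power :: "'a::comm_ring_1 set \<Rightarrow> nat \<Rightarrow> 'a set"
  where
    "ideal_power I 0 = UNIV"
  | "ideal_power I (Suc n) = ideal_times I (ideal_power I n)"

definition max_homogeneous_ideal :: "'k::field R4 set"
  where "max_homogeneous_ideal = ideal_span (range Var)"

text \<open>A list \<open>d\<close> of bidegrees stands for the bigraded free module \<open>\<Oplus>\<^sub>j R(- d ! j)\<close>, whose
  \<open>j\<close>-th basis element has degree \<open>d ! j\<close>. A matrix acting on column vectors is a homomorphism
  of bidegree \<open>(0,0)\<close> from the module of \<open>d\<close> to the module of \<open>e\<close> iff its \<open>(i,j)\<close> entry is
  bihomogeneous of degree \<open>d ! j - e ! i\<close>.\<close>

definition bigraded_map :: "(int \<times> int) list \<Rightarrow> (int \<times> int) list \<Rightarrow> 'k::field R4 mat \<Rightarrow> bool"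
  where "bigraded_map d e A \<longleftrightarrow>
    A \<in> carrier_mat (length e) (length d) \<and>
    (\<forall>i < length e. \<forall>j < length d. bihomogeneous (d ! j - e ! i) (A $$ (i, j)))"

definition mat_range :: "'a::comm_ring_1 mat \<Rightarrow> 'a vec set"
  where "mat_range A = (\<lambda>v. A *\<^sub>v v) ` carrier_vec (dim_col A)"

text \<open>The complex
    \<open>0 \<rightarrow> F\<^sub>2 \<rightarrow> F\<^sub>1 \<rightarrow> F\<^sub>0 \<rightarrow> I \<rightarrow> 0\<close>,
  where \<open>F\<^sub>u\<close> is the module of the degree list \<open>d u\<close>, the matrix \<open>A 0\<close> is the composition
  \<open>F\<^sub>0 \<rightarrow> I \<subseteq> R\<close> (a single row, consisting of the chosen generators of \<open>I\<close>), and \<open>A (u + 1)\<close> is the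
  map \<open>F\<^bsub>u+1\<^esub> \<rightarrow> F\<^bsub>u\<^esub>\<close>. As \<open>F\<^bsub>u\<^esub> = 0\<close> for \<open>u > 2\<close>, exactness at \<open>F\<^sub>2\<close> is
  injectivity of \<open>F\<^sub>2 \<rightarrow> F\<^sub>1\<close>. Minimality means that the image of \<open>F\<^bsub>u+1\<^esub>\<close> lies in
  \<open>(x\<^sub>0, x\<^sub>1, x\<^sub>2, x\<^sub>3) F\<^bsub>u\<^esub>\<close>.\<close>

definition minimal_bigraded_resolution ::
    "'k::field R4 set \<Rightarrow> (nat \<Rightarrow> (int \<times> int) list) \<Rightarrow> (nat \<Rightarrow> 'k R4 mat) \<Rightarrow> bool"
  where "minimal_bigraded_resolution I d A \<longleftrightarrow>
    (\<forall>u > 2. d u = []) \<and>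
    bigraded_map (d 0) [(0, 0)] (A 0) \<and>
    (\<forall>u. bigraded_map (d (Suc u)) (d u) (A (Suc u))) \<and>
    mat_range (A 0) = {v \<in> carrier_vec 1. v $ 0 \<in> I} \<and>
    (\<forall>u. mat_kernel (A u) = mat_range (A (Suc u))) \<and>
    (\<forall>u. elements_mat (A (Suc u)) \<subseteq> max_homogeneous_ideal)"

text \<open>The number of summands \<open>R(-i,-j)\<close> of \<open>F\<^sub>u\<close>. The use of \<open>THE\<close> reflects that this number
  is the same for all minimal bigraded free resolutions of \<open>I\<close>.\<close>

definition betti :: "'k::field R4 set \<Rightarrow> nat \<Rightarrow> int \<times> int \<Rightarrow> nat"
  where "betti I u ij =
    (THE n. \<exists>d A. minimal_bigraded_resolution I d A \<and> n = count_list (d u) ij)"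

definition nonproportional_forms :: "int \<times> int \<Rightarrow> 'k::field R4 \<Rightarrow> 'k R4 \<Rightarrow> bool"
  where "nonproportional_forms d F G \<longleftrightarrow>
    bihomogeneous d F \<and> bihomogeneous d G \<and> F \<noteq> 0 \<and> G \<noteq> 0 \<and> (\<nexists>c. F = Const c * G)"

definition point_ideal :: "'k::field R4 \<Rightarrow> 'k R4 \<Rightarrow> 'k R4 set"
  where "point_ideal H V = ideal_span {H, V}"

definition fat_points_ideal ::
    "'k::field R4 \<Rightarrow> 'k R4 \<Rightarrow> 'k R4 \<Rightarrow> 'k R4 \<Rightarrow> nat \<Rightarrow> nat \<Rightarrow> nat \<Rightarrow> 'k R4 set"
  where "fat_points_ideal H1 H2 V1 V2 m11 m12 m21 =
    ideal_power (point_ideal H1 V1) m11 \<inter>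
    ideal_power (point_ideal H1 V2) m12 \<inter>
    ideal_power (point_ideal H2 V1) m21"

function phi :: "int \<Rightarrow> int \<Rightarrow> int"
  where "phi t n =
    (if t \<le> 0 then 0
     else if t = 1 then (if n = 0 then 1 else 0)
     else if 0 \<le> n \<and> n < t - 1 then phi (t - 1) n
     else if t - 1 \<le> n \<and> n < 2 * t - 1 then phi (t - 1) n + 1
     else 0)"
  by auto
termination by (relation "measure (\<lambda>(t, n). nat t)") auto

declare phi.simps [simp del]

definition phi2 :: "int \<Rightarrow> int \<Rightarrow> int \<Rightarrow> int"
  where "phi2 t d n = phi t (n + d) - phi d (n + d)"

definition pos_part :: "int \<Rightarrow> int"
  where "pos_part n = max n 0"

text \<open>The sets \<open>D\<^sub>i(Z)\<close>, as subsets of \<open>\<nat>\<^sup>2\<close> inside \<open>\<int>\<^sup>2\<close>.\<close>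

definition D1 :: "nat \<Rightarrow> nat \<Rightarrow> nat \<Rightarrow> (int \<times> int) set"
  where "D1 m11 m12 m21 =
    (let B = int m12 - int m11 in
      {(a, b). 0 \<le> a \<and> 0 \<le> b \<and> b < pos_part (- B) - pos_part (- B - int m21) \<and>
               a + 2 * b = int m11 + int m21})"

definition D2 :: "nat \<Rightarrow> nat \<Rightarrow> nat \<Rightarrow> (int \<times> int) set"
  where "D2 m11 m12 m21 =
    (let B = int m12 - int m11 in
      {(a, b). 0 \<le> a \<and> 0 \<le> b \<and> pos_part (- B) - pos_part (- B - int m21) \<le> b \<and> b < int m21 \<and>
               a + b = max (int m11) (int m12 + int m21)})"

definition D3 :: "nat \<Rightarrow> nat \<Rightarrow> nat \<Rightarrow> (int \<times> int) set"
  where "D3 m11 m12 m21 =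
    (let B = int m12 - int m11 in
      {(a, b). 0 \<le> a \<and> 0 \<le> b \<and> int m21 \<le> b \<and> b \<le> int m21 + \<bar>B + int m21\<bar> \<and>
               a + b = max (int m11) (int m12 + int m21)})"

definition D4 :: "nat \<Rightarrow> nat \<Rightarrow> nat \<Rightarrow> (int \<times> int) set"
  where "D4 m11 m12 m21 =
    (let B = int m12 - int m11 in
      {(a, b). 0 \<le> a \<and> 0 \<le> b \<and> b > int m21 + \<bar>B + int m21\<bar> \<and>
               2 * a + b = int m11 + int m12})"

end

theory Submission
  imports Defs
begin

text \<open>After a linear change of coordinates \<open>H\<^sub>1, H\<^sub>2, V\<^sub>1, V\<^sub>2\<close> are the variables \<open>x\<^sub>0, \<dots>, x\<^sub>3\<close>, and
  \<open>I\<^sub>Z\<close> is the monomial ideal whose exponents \<open>t\<close> satisfy \<open>t\<^sub>0 + t\<^sub>2 \<ge> m\<^sub>1\<^sub>1\<close>, \<open>t\<^sub>0 + t\<^sub>3 \<ge> m\<^sub>1\<^sub>2\<close> and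
  \<open>t\<^sub>1 + t\<^sub>2 \<ge> m\<^sub>2\<^sub>1\<close>. Its minimal generators are determined by their exponents \<open>(a, c)\<close> of \<open>x\<^sub>0\<close> and
  \<open>x\<^sub>2\<close>, and they can be ordered so that for each of them the colon ideal of the preceding ones is
  generated by a subset of \<open>{x\<^sub>0, x\<^sub>2}\<close>. So each generator is attached by a mapping cone over a Koszul
  complex, and a comparison of degrees shows that the cones remain minimal: a generator contributes
  one syzygy for each variable in its colon ideal, and one second syzygy if both variables occur.
  Betti numbers are well-defined because the comparison maps of two minimal resolutions are mutually
  inverse modulo the irrelevant ideal; in characteristic \<open>0\<close> it suffices to take traces in each
  degree.\<close>


section \<open>Monomials and bihomogeneous components\<close>

text \<open>In a minimal generator the exponents of \<open>x\<^sub>1\<close> and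
  \<open>x\<^sub>3\<close> are the truncated differences \<open>m21 - c\<close> and
  \<open>m12 - a\<close>, so its bidegree \<open>(i, j)\<close> is piecewise linear in
  \<open>(a, c)\<close>, and the pieces produce the sets \<open>D1\<close> to \<open>D4\<close>.
  Generators with \<open>a > m12\<close>, \<open>c < m21\<close> satisfy \<open>a + c = m11\<close>
  and have \<open>i + 2 * j = m11 + m21\<close>: this is \<open>D1\<close>. Those with
  \<open>a < m12\<close>, \<open>c > m21\<close> give \<open>D4\<close> in the same way, again one
  per degree. All others have degrees on a single antidiagonal, covered by \<open>D2\<close> and
  \<open>D3\<close>. If \<open>m11 \<le> m12 + m21\<close> they fill a truncated box in which the
  degree depends on \<open>c - a\<close> only, and the function phi counts the points of the box on
  such a diagonal. Otherwise they form a segment of \<open>a + c = m11\<close> with one generator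
  per degree. On every nonempty diagonal of the box exactly one point, the top one, lacks a variable
  in its colon ideal; this is the source of the -1 in the formula for the second syzygies. The
  obstacle to minimality is a unit in a comparison map of a cone. Generators may share a degree, but
  a step (1,0) or (0,1) from a generator whose colon ideal contains the corresponding variable never
  ends in the degree of another generator.\<close>

abbreviation cf :: "('a \<Rightarrow>\<^sub>0 'b::zero) \<Rightarrow> 'a \<Rightarrow> 'b"
  where "cf \<equiv> Poly_Mapping.lookup"

abbreviation mons :: "('a \<Rightarrow>\<^sub>0 'b::zero) \<Rightarrow> 'a set"
  where "mons \<equiv> Poly_Mapping.keys"

abbreviation xpow :: "(4 \<Rightarrow>\<^sub>0 nat) \<Rightarrow> 'k::field R4"
  where "xpow m \<equiv> Poly_Mapping.single m 1"

lemma module_times: "Modules.module ((*) :: 'a::comm_ring_1 \<Rightarrow> 'a \<Rightarrow> 'a)"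
  by unfold_locales (auto simp: algebra_simps)

lemma ideal_span_base: "a \<in> S \<Longrightarrow> a \<in> ideal_span S"
  unfolding ideal_span_def by (rule Modules.module.span_base[OF module_times])

lemma ideal_span_zero: "0 \<in> ideal_span S"
  unfolding ideal_span_def by (rule Modules.module.span_zero[OF module_times])

lemma ideal_span_add: "a \<in> ideal_span S \<Longrightarrow> b \<in> ideal_span S \<Longrightarrow> a + b \<in> ideal_span S"
  unfolding ideal_span_def by (rule Modules.module.span_add[OF module_times])

lemma ideal_span_mult: "a \<in> ideal_span S \<Longrightarrow> r * a \<in> ideal_span S"
  unfolding ideal_span_def by (rule Modules.module.span_scale[OF module_times])

lemma ideal_span_sum: "(\<And>x. x \<in> X \<Longrightarrow> f x \<in> ideal_span S) \<Longrightarrow> sum f X \<in> ideal_span S"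
  unfolding ideal_span_def by (rule Modules.module.span_sum[OF module_times])

lemma ideal_span_induct [consumes 1, case_names zero add]:
  assumes "a \<in> ideal_span S" "P 0" "\<And>r s a. s \<in> S \<Longrightarrow> P a \<Longrightarrow> P (r * s + a)"
  shows "P a"
  using assms(1) unfolding ideal_span_def
  by (rule Modules.module.span_induct_alt[OF module_times]) (use assms in auto)

text \<open>Evaluation at the origin is multiplicative, because the exponent \<open>0\<close> splits
  only as \<open>0 + 0\<close>. Minimality of maps is tested through this homomorphism.\<close>

lemma cf_mult_zero: "cf (p * q) 0 = cf p 0 * cf q 0"
  for p q :: "'k::field R4"
proof -
  have *: "0 = l + k \<longleftrightarrow> k = 0 \<and> l = 0" for l k :: "4 \<Rightarrow>\<^sub>0 nat"
    by (auto simp: poly_mapping_eq_iff lookup_add fun_eq_iff)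
  have "(\<Sum>k. cf q k when 0 = l + k) = (cf q 0 when l = 0)" for l
    by (cases "l = 0") (auto simp: *)
  then show ?thesis
    by (simp add: lookup_mult mult_when)
qed

definition restrict_mons :: "'a set \<Rightarrow> ('a \<Rightarrow>\<^sub>0 'b::zero) \<Rightarrow> 'a \<Rightarrow>\<^sub>0 'b"
  where "restrict_mons S = Poly_Mapping.mapp (\<lambda>m c. c when m \<in> S)"

lemma cf_restrict_mons [simp]:
  "cf (restrict_mons S p) m = (if m \<in> S then cf p m else 0)"
  by (auto simp: restrict_mons_def lookup_mapp when_def in_keys_iff)

lemma mons_restrict_mons [simp]: "mons (restrict_mons S p) = mons p \<inter> S"
  by (auto simp: in_keys_iff split: if_splits)

lemma restrict_mons_add: "restrict_mons S (p + q) = restrict_mons S p + restrict_mons S q"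
  by (rule poly_mapping_eqI) (auto simp: lookup_add)

lemma restrict_mons_zero [simp]: "restrict_mons S 0 = 0"
  by (rule poly_mapping_eqI) auto

lemma restrict_mons_sum: "restrict_mons S (sum f X) = (\<Sum>x\<in>X. restrict_mons S (f x))"
  by (induction X rule: infinite_finite_induct) (auto simp: restrict_mons_add)

lemma restrict_mons_split: "p = restrict_mons S p + restrict_mons (- S) p"
  by (rule poly_mapping_eqI) (auto simp: lookup_add)

lemma restrict_mons_id: "mons p \<subseteq> S \<Longrightarrow> restrict_mons S p = p"
  by (rule poly_mapping_eqI) (auto simp: in_keys_iff)

lemma restrict_mons_eq_zero: "mons p \<inter> S = {} \<Longrightarrow> restrict_mons S p = 0"
  by (rule poly_mapping_eqI) (auto simp: in_keys_iff)

lemma poly_eq_sum_monomials: "p = (\<Sum>m\<in>mons p. Poly_Mapping.single m (cf p m))"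
  by (rule poly_mapping_eqI)
    (auto simp: lookup_sum lookup_single when_def in_keys_iff sum.delta')

lemma bidegree_zero [simp]: "bidegree 0 = 0"
  by (simp add: bidegree_def zero_prod_def)

lemma bidegree_add: "bidegree (m + n) = bidegree m + bidegree n"
  by (simp add: bidegree_def lookup_add)

lemma bihomogeneous_zero [simp]: "bihomogeneous d 0"
  by (simp add: bihomogeneous_def)

lemma bihomogeneous_single: "bidegree m = d \<Longrightarrow> bihomogeneous d (Poly_Mapping.single m c)"
  by (simp add: bihomogeneous_def)

lemma bihomogeneous_one: "bihomogeneous 0 1"
  by (simp add: bihomogeneous_def)

lemma bihomogeneous_add:
  "bihomogeneous d p \<Longrightarrow> bihomogeneous d q \<Longrightarrow> bihomogeneous d (p + q)"
  using keys_add[of p q] by (auto simp: bihomogeneous_def)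

lemma bihomogeneous_uminus: "bihomogeneous d p \<Longrightarrow> bihomogeneous d (- p)"
  by (auto simp: bihomogeneous_def)

lemma bihomogeneous_sum:
  "(\<And>x. x \<in> X \<Longrightarrow> bihomogeneous d (f x)) \<Longrightarrow> bihomogeneous d (sum f X)"
  by (induction X rule: infinite_finite_induct) (auto intro: bihomogeneous_add)

lemma bihomogeneous_mult:
  assumes "bihomogeneous d p" "bihomogeneous e q"
  shows "bihomogeneous (d + e) (p * q)"
  using assms keys_mult[of p q] unfolding bihomogeneous_def
  by (force simp: bidegree_add)

lemma bihomogeneous_constant_term:
  "bihomogeneous d p \<Longrightarrow> d \<noteq> 0 \<Longrightarrow> cf p 0 = 0"
  unfolding bihomogeneous_def by (metis bidegree_zero in_keys_iff)

definition hom_component :: "int \<times> int \<Rightarrow> 'k::field R4 \<Rightarrow> 'k R4"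
  where "hom_component d = restrict_mons {m. bidegree m = d}"

lemma bihomogeneous_hom_component: "bihomogeneous d (hom_component d p)"
  by (simp add: bihomogeneous_def hom_component_def)

lemma hom_component_id: "bihomogeneous d p \<Longrightarrow> hom_component d p = p"
  unfolding hom_component_def bihomogeneous_def by (intro restrict_mons_id) auto

lemma hom_component_sum: "hom_component d (sum f X) = (\<Sum>x\<in>X. hom_component d (f x))"
  by (simp add: hom_component_def restrict_mons_sum)

text \<open>A homogeneous factor shifts the grading by \<open>s\<close>, so what lies outside degree
  \<open>t\<close> in \<open>y\<close> ends up outside degree \<open>s + t\<close>.\<close>

lemma hom_component_mult:
  assumes "bihomogeneous s x"
  shows "hom_component (s + t) (x * y) = x * hom_component t y"
proof -
  let ?y = "restrict_mons (- {m. bidegree m = t}) y"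
  have "y = hom_component t y + ?y"
    unfolding hom_component_def by (rule restrict_mons_split)
  then have "x * y = x * hom_component t y + x * ?y"
    by (metis distrib_left)
  moreover have "hom_component (s + t) (x * hom_component t y) = x * hom_component t y"
    by (intro hom_component_id bihomogeneous_mult bihomogeneous_hom_component assms)
  moreover have "hom_component (s + t) (x * ?y) = 0"
    unfolding hom_component_def
    using keys_mult[of x ?y] assms
    by (intro restrict_mons_eq_zero) (fastforce simp: bihomogeneous_def bidegree_add)
  ultimately show ?thesis
    by (simp add: hom_component_def restrict_mons_add)
qed

text \<open>Reduces minimality to constant terms: every monomial other than 1 is divisible by some
  variable.\<close>

lemma max_homogeneous_ideal_eq: "max_homogeneous_ideal = {p :: 'k::field R4. cf p 0 = 0}"
proof (intro equalityI subsetI)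
  fix p :: "'k R4" assume "p \<in> max_homogeneous_ideal"
  then have "p \<in> ideal_span (range Var)"
    by (simp add: max_homogeneous_ideal_def)
  then have "cf p 0 = 0"
  proof (induction rule: ideal_span_induct)
    case (add r s a)
    then obtain i where "s = Var i" by auto
    moreover have "Poly_Mapping.single i (1::nat) \<noteq> 0"
      by (metis lookup_single_eq lookup_zero zero_neq_one)
    ultimately have "cf s 0 = 0"
      by (simp add: Var_def lookup_single)
    then show ?case using add by (simp add: lookup_add cf_mult_zero)
  qed simp
  then show "p \<in> {p. cf p 0 = 0}" by simp
next
  fix p :: "'k R4" assume p: "p \<in> {p. cf p 0 = 0}"
  have "Poly_Mapping.single m (cf p m) \<in> max_homogeneous_ideal" if m: "m \<in> mons p" for m
  proof -
    have "m \<noteq> 0" using p m by (auto simp: in_keys_iff)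
    then obtain i where i: "cf m i > 0"
      by (metis gr0I lookup_zero poly_mapping_eqI)
    define n where "n = m - Poly_Mapping.single i 1"
    have "m = n + Poly_Mapping.single i 1"
      unfolding n_def using i
      by (intro poly_mapping_eqI) (auto simp: lookup_add lookup_minus lookup_single when_def)
    then have "Poly_Mapping.single m (cf p m) = Poly_Mapping.single n (cf p m) * Var i"
      by (simp add: Var_def mult_single)
    then show ?thesis
      unfolding max_homogeneous_ideal_def by (simp add: ideal_span_mult ideal_span_base)
  qed
  then have "(\<Sum>m\<in>mons p. Poly_Mapping.single m (cf p m)) \<in> max_homogeneous_ideal"
    unfolding max_homogeneous_ideal_def by (intro ideal_span_sum) auto
  then show "p \<in> max_homogeneous_ideal"
    using poly_eq_sum_monomials[of p] by simp
qed


section \<open>Uniqueness of minimal resolutions\<close>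

lemma mat_rangeI: "v \<in> carrier_vec (dim_col A) \<Longrightarrow> A *\<^sub>v v \<in> mat_range A"
  by (simp add: mat_range_def)

lemma bigraded_map_carrier:
  "bigraded_map d e A \<Longrightarrow> A \<in> carrier_mat (length e) (length d)"
  by (simp add: bigraded_map_def)

lemma bigraded_map_entry:
  "bigraded_map d e A \<Longrightarrow> i < length e \<Longrightarrow> j < length d \<Longrightarrow>
    bihomogeneous (d ! j - e ! i) (A $$ (i, j))"
  by (simp add: bigraded_map_def)

section \<open>Homogeneous lifting through matrices\<close>

lemma matrix_lift:
  fixes A B :: "'a::comm_ring_1 mat"
  assumes A: "A \<in> carrier_mat n m" and B: "B \<in> carrier_mat n l"
    and cols: "\<And>j. j < l \<Longrightarrow> col B j \<in> mat_range A"
  obtains P where "P \<in> carrier_mat m l" "A * P = B"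
proof -
  from cols have "\<forall>j<l. \<exists>v\<in>carrier_vec m. A *\<^sub>v v = col B j"
    using A by (fastforce simp: mat_range_def)
  then obtain v where v: "\<And>j. j < l \<Longrightarrow> v j \<in> carrier_vec m \<and> A *\<^sub>v v j = col B j"
    by metis
  let ?P = "mat m l (\<lambda>(i, j). v j $ i)"
  have P: "?P \<in> carrier_mat m l" by simp
  have "col ?P j = v j" if "j < l" for j
    using v[OF that] that by (intro eq_vecI) auto
  then have "col (A * ?P) j = col B j" if "j < l" for j
    using v[OF that] A that by (simp add: col_mult2[OF A P])
  then have "A * ?P = B"
    using A B by (intro mat_col_eqI) auto
  then show ?thesis using P that by blast
qed

text \<open>An arbitrary lift can be made homogeneous: replacing each entry by its component of the
  prescribed degree keeps the product, since the entries of \<open>A\<close> and \<open>B\<close>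
  are homogeneous already.\<close>

lemma bigraded_lift:
  fixes A :: "'k::field R4 mat"
  assumes A: "bigraded_map d e A" and B: "bigraded_map c e B"
    and cols: "\<And>j. j < length c \<Longrightarrow> col B j \<in> mat_range A"
  obtains P where "bigraded_map c d P" "A * P = B"
proof -
  note cA = bigraded_map_carrier[OF A] and cB = bigraded_map_carrier[OF B]
  obtain P where P: "P \<in> carrier_mat (length d) (length c)" "A * P = B"
    using matrix_lift[OF cA cB cols] by blast
  let ?P = "mat (length d) (length c) (\<lambda>(i, j). hom_component (c ! j - d ! i) (P $$ (i, j)))"
  have bg: "bigraded_map c d ?P"
    by (auto simp: bigraded_map_def bihomogeneous_hom_component)
  have "(A * ?P) $$ (i, j) = B $$ (i, j)" if i: "i < length e" and j: "j < length c" for i j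
  proof -
    have "(A * ?P) $$ (i, j) =
        (\<Sum>k<length d. A $$ (i, k) * hom_component (c ! j - d ! k) (P $$ (k, j)))"
      using cA i j by (auto simp: scalar_prod_def atLeast0LessThan)
    also have "\<dots> = (\<Sum>k<length d. hom_component (c ! j - e ! i) (A $$ (i, k) * P $$ (k, j)))"
    proof (intro sum.cong refl)
      fix k assume k: "k \<in> {..<length d}"
      have "(d ! k - e ! i) + (c ! j - d ! k) = c ! j - e ! i" by simp
      then show "A $$ (i, k) * hom_component (c ! j - d ! k) (P $$ (k, j)) =
          hom_component (c ! j - e ! i) (A $$ (i, k) * P $$ (k, j))"
        using hom_component_mult[OF bigraded_map_entry[OF A i], of k "c ! j - d ! k"] k by simp
    qed
    also have "\<dots> = hom_component (c ! j - e ! i) ((A * P) $$ (i, j))"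
      using cA P(1) i j by (auto simp: hom_component_sum scalar_prod_def atLeast0LessThan)
    also have "\<dots> = B $$ (i, j)"
      unfolding P(2) by (intro hom_component_id bigraded_map_entry[OF B] i j)
    finally show ?thesis .
  qed
  then have "A * ?P = B"
    using cA cB by (intro eq_matI) auto
  with bg show ?thesis using that by blast
qed

lemma bigraded_map_mult:
  assumes A: "bigraded_map d e A" and B: "bigraded_map c d B"
  shows "bigraded_map c e (A * B)"
  unfolding bigraded_map_def
proof (intro conjI allI impI)
  note cA = bigraded_map_carrier[OF A] and cB = bigraded_map_carrier[OF B]
  show "A * B \<in> carrier_mat (length e) (length c)" using cA cB by simp
  fix i j assume i: "i < length e" and j: "j < length c"
  have "(A * B) $$ (i, j) = (\<Sum>k<length d. A $$ (i, k) * B $$ (k, j))"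
    using cA cB i j by (auto simp: scalar_prod_def atLeast0LessThan)
  moreover have "bihomogeneous (c ! j - e ! i) (A $$ (i, k) * B $$ (k, j))" if "k < length d" for k
    using bihomogeneous_mult[OF bigraded_map_entry[OF A i that] bigraded_map_entry[OF B that j]]
    by simp
  ultimately show "bihomogeneous (c ! j - e ! i) ((A * B) $$ (i, j))"
    by (auto intro!: bihomogeneous_sum)
qed

section \<open>Reduction modulo the irrelevant ideal and chain homotopies\<close>

definition zero_constant_terms :: "'k::field R4 mat \<Rightarrow> bool"
  where "zero_constant_terms A \<longleftrightarrow> (\<forall>i < dim_row A. \<forall>j < dim_col A. cf (A $$ (i, j)) 0 = 0)"

lemma elements_mat_max_homogeneous_ideal_iff:
  "elements_mat A \<subseteq> max_homogeneous_ideal \<longleftrightarrow> zero_constant_terms A"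
  unfolding max_homogeneous_ideal_eq zero_constant_terms_def by blast

lemma constant_term_mult_mat:
  fixes A B :: "'k::field R4 mat"
  assumes "A \<in> carrier_mat n m" "B \<in> carrier_mat m l" "i < n" "j < l"
  shows "cf ((A * B) $$ (i, j)) 0 = (\<Sum>k<m. cf (A $$ (i, k)) 0 * cf (B $$ (k, j)) 0)"
  using assms by (simp add: scalar_prod_def lookup_sum cf_mult_zero atLeast0LessThan)

lemma zero_constant_terms_mult_left:
  assumes "zero_constant_terms A" "A \<in> carrier_mat n m" "B \<in> carrier_mat m l"
  shows "zero_constant_terms (A * B)"
  using assms by (auto simp: zero_constant_terms_def constant_term_mult_mat simp del: index_mult_mat(1))

lemma zero_constant_terms_mult_right:
  assumes "zero_constant_terms B" "A \<in> carrier_mat n m" "B \<in> carrier_mat m l"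
  shows "zero_constant_terms (A * B)"
  using assms by (auto simp: zero_constant_terms_def constant_term_mult_mat simp del: index_mult_mat(1))

lemma mat_eq_0I:
  fixes A :: "'a::comm_ring_1 mat"
  assumes "A \<in> carrier_mat n m" "\<And>j. j < m \<Longrightarrow> col A j = 0\<^sub>v n"
  shows "A = 0\<^sub>m n m"
  using assms by (intro mat_col_eqI) auto

lemma col_in_mat_range:
  fixes B :: "'a::comm_ring_1 mat"
  assumes "j < dim_col B"
  shows "col B j \<in> mat_range B"
proof -
  have "col B j = col (B * 1\<^sub>m (dim_col B)) j"
    by (simp add: right_mult_one_mat[OF carrier_matI])
  also have "\<dots> = B *\<^sub>v unit_vec (dim_col B) j"
    using assms by (subst col_mult2[OF carrier_matI one_carrier_mat]) auto
  finally show ?thesis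
    by (simp add: mat_rangeI)
qed

lemma mult_mat_zero_vec [simp]:
  fixes A :: "'a::comm_ring_1 mat"
  shows "dim_col A = m \<Longrightarrow> A *\<^sub>v 0\<^sub>v m = 0\<^sub>v (dim_row A)"
  by (intro eq_vecI) auto

lemma mult_mat_zero_of_kernel:
  fixes A B :: "'a::comm_ring_1 mat"
  assumes "A \<in> carrier_mat n m" "B \<in> carrier_mat m l"
    and "\<And>v. v \<in> mat_range B \<Longrightarrow> A *\<^sub>v v = 0\<^sub>v n"
  shows "A * B = 0\<^sub>m n l"
proof (rule mat_eq_0I)
  fix j assume j: "j < l"
  have "col B j \<in> mat_range B"
    using assms(2) j by (intro col_in_mat_range) auto
  then show "col (A * B) j = 0\<^sub>v n"
    using assms(3) j by (simp add: col_mult2[OF assms(1,2)])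
qed (use assms in simp)

text \<open>The term \<open>C\<close> is the part \<open>h\<^bsub>u-1\<^esub> A\<^bsub>u\<^esub>\<close> of a chain homotopy between \<open>M\<close> and the
  identity; recording only that it kills \<open>ker A\<close> lets the induction forget the lower degrees.\<close>

definition near_identity :: "'k::field R4 mat \<Rightarrow> 'k R4 mat \<Rightarrow> 'k R4 mat \<Rightarrow> bool"
  where "near_identity A A' M \<longleftrightarrow>
    (\<exists>h C. h \<in> carrier_mat (dim_col A') (dim_col A) \<and> C \<in> carrier_mat (dim_col A) (dim_col A) \<and>
       M = 1\<^sub>m (dim_col A) + A' * h + C \<and> zero_constant_terms C \<and>
       (\<forall>v \<in> mat_kernel A. C *\<^sub>v v = 0\<^sub>v (dim_col A)))"

text \<open>\<open>M\<close> and the identity agree after \<open>A\<close>, so their difference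
  lifts through the next differential. Nothing comes from below, hence \<open>C\<close> is zero
  here.\<close>

lemma near_identity_base:
  assumes A: "A \<in> carrier_mat n m" and A': "A' \<in> carrier_mat m l" and M: "M \<in> carrier_mat m m"
    and AM: "A * M = A" and ex: "mat_kernel A = mat_range A'"
  shows "near_identity A A' M"
proof -
  have D: "M - 1\<^sub>m m \<in> carrier_mat m m" by (intro minus_carrier_mat one_carrier_mat)
  have AD: "A * (M - 1\<^sub>m m) = 0\<^sub>m n m"
    using A M AM by (simp add: mult_minus_distrib_mat)
  have "col (M - 1\<^sub>m m) j \<in> mat_range A'" if j: "j < m" for j
  proof -
    have "A *\<^sub>v col (M - 1\<^sub>m m) j = col (A * (M - 1\<^sub>m m)) j"
      by (rule col_mult2[OF A D j, symmetric])
    also have "\<dots> = 0\<^sub>v n" using j by (simp add: AD)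
    finally show ?thesis
      unfolding ex[symmetric] using D j by (intro mat_kernelI[OF A]) auto
  qed
  then obtain h where h: "h \<in> carrier_mat l m" "A' * h = M - 1\<^sub>m m"
    using matrix_lift[OF A' D] by blast
  have "M = 1\<^sub>m m + A' * h + 0\<^sub>m m m"
    unfolding h(2) using M by (intro eq_matI) auto
  then show ?thesis
    unfolding near_identity_def using h(1) A A'
    by (intro exI[of _ h] exI[of _ "0\<^sub>m m m"])
       (auto simp: zero_constant_terms_def mat_kernel_def)
qed

text \<open>The usual homotopy step: \<open>M' - 1 - h * A'\<close> is annihilated by
  \<open>A'\<close> and therefore lifts through \<open>A''\<close>. The new correction is
  \<open>h * A'\<close>, and minimality of \<open>A'\<close> removes its constant terms.\<close>

lemma near_identity_step:
  assumes A: "A \<in> carrier_mat n m" and A': "A' \<in> carrier_mat m l" and A'': "A'' \<in> carrier_mat l k"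
    and M: "M \<in> carrier_mat m m" and M': "M' \<in> carrier_mat l l"
    and ex: "mat_kernel A = mat_range A'" "mat_kernel A' = mat_range A''"
    and min: "zero_constant_terms A'"
    and comm: "A' * M' = M * A'" and near: "near_identity A A' M"
  shows "near_identity A' A'' M'"
proof -
  obtain h C where h: "h \<in> carrier_mat l m" and C: "C \<in> carrier_mat m m"
    and MhC: "M = 1\<^sub>m m + A' * h + C" and C0: "\<And>v. v \<in> mat_kernel A \<Longrightarrow> C *\<^sub>v v = 0\<^sub>v m"
    using near A A' by (auto simp: near_identity_def)
  \<comment> \<open>The columns of \<open>A'\<close> lie in the kernel of \<open>A\<close>, which
    \<open>C\<close> kills.\<close>
  have CA': "C * A' = 0\<^sub>m m l"
    using C A' C0 unfolding ex by (rule mult_mat_zero_of_kernel)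
  let ?E = "M' - 1\<^sub>m l - h * A'"
  have E: "?E \<in> carrier_mat l l" using h A' M' by auto
  have "A' * ?E = A' * M' - A' * 1\<^sub>m l - A' * (h * A')"
    using h A' M' by (subst mult_minus_distrib_mat[of _ m l _ l], auto)+
  also have "A' * M' = A' + A' * h * A'"
    unfolding comm MhC using A' h C CA'
    by (subst add_mult_distrib_mat[of _ m m], auto)+
  also have "A' * (h * A') = A' * h * A'"
    using A' h by simp
  also have "A' + A' * h * A' - A' * 1\<^sub>m l - A' * h * A' = 0\<^sub>m m l"
    using A' h by (intro eq_matI) auto
  finally have AE: "A' * ?E = 0\<^sub>m m l" .
  have "col ?E j \<in> mat_range A''" if j: "j < l" for j
  proof -
    have "A' *\<^sub>v col ?E j = col (A' * ?E) j"
      by (rule col_mult2[OF A' E j, symmetric])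
    also have "\<dots> = 0\<^sub>v m" using j by (simp add: AE)
    finally show ?thesis
      unfolding ex(2)[symmetric] using E j by (intro mat_kernelI[OF A']) auto
  qed
  then obtain h' where h': "h' \<in> carrier_mat k l" "A'' * h' = ?E"
    using matrix_lift[OF A'' E] by blast
  have "M' = 1\<^sub>m l + A'' * h' + h * A'"
    unfolding h'(2) using M' h A' by (intro eq_matI) auto
  moreover have "zero_constant_terms (h * A')"
    using min h A' by (rule zero_constant_terms_mult_right)
  moreover have "(h * A') *\<^sub>v v = 0\<^sub>v l" if "v \<in> mat_kernel A'" for v
    using mat_kernelD[OF A' that] h A' by (auto simp: assoc_mult_mat_vec[OF h A'])
  ultimately show ?thesis
    unfolding near_identity_def using h h' A' A''
    by (intro exI[of _ h'] exI[of _ "h * A'"]) auto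
qed

text \<open>At the origin both \<open>A' * h\<close> and \<open>C\<close> vanish, so
  \<open>M\<close> reduces to the identity matrix over the field.\<close>

lemma near_identity_constant_term:
  assumes "near_identity A A' M" "A \<in> carrier_mat n m" "A' \<in> carrier_mat m l"
    and "zero_constant_terms A'" "i < m" "j < m"
  shows "cf (M $$ (i, j)) 0 = (if i = j then 1 else 0)"
proof -
  obtain h C where h: "h \<in> carrier_mat l m" and C: "C \<in> carrier_mat m m" "zero_constant_terms C"
    and M: "M = 1\<^sub>m m + A' * h + C"
    using assms(1,2,3) by (auto simp: near_identity_def)
  have "zero_constant_terms (A' * h)"
    using assms h by (intro zero_constant_terms_mult_left)
  then have "cf ((A' * h) $$ (i, j)) 0 = 0" "cf (C $$ (i, j)) 0 = 0"
    using C h assms by (auto simp: zero_constant_terms_def simp del: index_mult_mat(1))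
  then show ?thesis
    using C h assms by (simp add: M lookup_add del: index_mult_mat(1))
qed

lemma count_list_eq_sum:
  "of_nat (count_list xs x) = (\<Sum>i<length xs. if xs ! i = x then 1 else 0 :: 'a::semiring_1)"
proof -
  have "count_list xs x = card {i. i < length xs \<and> xs ! i = x}"
    by (simp add: count_list_eq_length_filter length_filter_conv_card eq_commute)
  then show ?thesis
    by (simp add: sum.If_cases Int_def lessThan_def)
qed

lemma count_list_eq_of_inverse_mod_max:
  fixes P Q :: "'k::field_char_0 R4 mat"
  assumes P: "bigraded_map d d' P" and Q: "bigraded_map d' d Q"
    and QP: "\<And>j. j < length d \<Longrightarrow> cf ((Q * P) $$ (j, j)) 0 = 1"
    and PQ: "\<And>j. j < length d' \<Longrightarrow> cf ((P * Q) $$ (j, j)) 0 = 1"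
  shows "count_list d x = count_list d' x"
proof -
  note cP = bigraded_map_carrier[OF P] and cQ = bigraded_map_carrier[OF Q]
  let ?q = "\<lambda>j i. cf (Q $$ (j, i)) 0" and ?p = "\<lambda>i j. cf (P $$ (i, j)) 0"
  \<comment> \<open>A homogeneous entry has a constant term only in degree zero, so the reduced
    matrices are block diagonal by degree. After swapping the sums this allows
    \<open>d ! j = x\<close> to be traded for \<open>d' ! i = x\<close>.\<close>
  have p0: "?p i j = 0" if "i < length d'" "j < length d" "d ! j \<noteq> d' ! i" for i j
    using bihomogeneous_constant_term[OF bigraded_map_entry[OF P that(1,2)]] that(3) by simp
  have "of_nat (count_list d x) = (\<Sum>j<length d. if d ! j = x then (1::'k) else 0)"
    by (rule count_list_eq_sum)
  also have "\<dots> = (\<Sum>j<length d. if d ! j = x then cf ((Q * P) $$ (j, j)) 0 else 0)"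
    using QP by (intro sum.cong) auto
  also have "\<dots> = (\<Sum>j<length d. \<Sum>i<length d'. if d ! j = x then ?q j i * ?p i j else 0)"
    using constant_term_mult_mat[OF cQ cP] by (intro sum.cong) auto
  also have "\<dots> = (\<Sum>i<length d'. \<Sum>j<length d. if d ! j = x then ?q j i * ?p i j else 0)"
    by (rule sum.swap)
  also have "\<dots> = (\<Sum>i<length d'. \<Sum>j<length d. if d' ! i = x then ?p i j * ?q j i else 0)"
    using p0 by (intro sum.cong refl) (auto simp: mult.commute)
  also have "\<dots> = (\<Sum>i<length d'. if d' ! i = x then cf ((P * Q) $$ (i, i)) 0 else 0)"
    using constant_term_mult_mat[OF cP cQ] by (intro sum.cong) auto
  also have "\<dots> = (\<Sum>i<length d'. if d' ! i = x then 1 else 0)"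
    using PQ by (intro sum.cong) auto
  also have "\<dots> = of_nat (count_list d' x)"
    by (rule count_list_eq_sum[symmetric])
  finally show ?thesis by simp
qed

lemma minimal_bigraded_resolutionD:
  assumes "minimal_bigraded_resolution I d A"
  shows "u > 2 \<Longrightarrow> d u = []"
    and "bigraded_map (d 0) [(0, 0)] (A 0)"
    and "bigraded_map (d (Suc u)) (d u) (A (Suc u))"
    and "mat_range (A 0) = {v \<in> carrier_vec 1. v $ 0 \<in> I}"
    and "mat_kernel (A u) = mat_range (A (Suc u))"
    and "zero_constant_terms (A (Suc u))"
    and "A 0 \<in> carrier_mat 1 (length (d 0))"
    and "A (Suc u) \<in> carrier_mat (length (d u)) (length (d (Suc u)))"
    and "\<exists>n. A u \<in> carrier_mat n (length (d u))"
proof -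
  note [simp] = assms[unfolded minimal_bigraded_resolution_def elements_mat_max_homogeneous_ideal_iff]
  show "u > 2 \<Longrightarrow> d u = []" "bigraded_map (d 0) [(0, 0)] (A 0)"
    "mat_range (A 0) = {v \<in> carrier_vec 1. v $ 0 \<in> I}"
    "mat_kernel (A u) = mat_range (A (Suc u))" "zero_constant_terms (A (Suc u))"
    by simp_all
  show *: "bigraded_map (d (Suc u)) (d u) (A (Suc u))" for u by simp
  show c0: "A 0 \<in> carrier_mat 1 (length (d 0))"
    using bigraded_map_carrier[of "d 0" "[(0, 0)]" "A 0"] by simp
  show c1: "A (Suc u) \<in> carrier_mat (length (d u)) (length (d (Suc u)))" for u
    using bigraded_map_carrier[OF *] .
  show "\<exists>n. A u \<in> carrier_mat n (length (d u))"
    using c0 c1 by (cases u) blast+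
qed

lemma mult_mat_in_kernel:
  assumes "A \<in> carrier_mat n m" "A1 \<in> carrier_mat m l" "A' \<in> carrier_mat n' m'" "A1' \<in> carrier_mat m' l'"
    and "P \<in> carrier_mat m' m" "P1 \<in> carrier_mat l' l" "A1' * P1 = P * A1"
    and v: "v \<in> mat_kernel A1"
  shows "P1 *\<^sub>v v \<in> mat_kernel A1'"
proof (rule mat_kernelI)
  have vc: "v \<in> carrier_vec l" "A1 *\<^sub>v v = 0\<^sub>v m" using mat_kernelD[OF assms(2) v] .
  have "A1' *\<^sub>v (P1 *\<^sub>v v) = (A1' * P1) *\<^sub>v v"
    by (rule assoc_mult_mat_vec[OF assms(4,6) vc(1), symmetric])
  also have "\<dots> = P *\<^sub>v (A1 *\<^sub>v v)"
    unfolding assms(7) by (rule assoc_mult_mat_vec[OF assms(5,2) vc(1)])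
  also have "\<dots> = 0\<^sub>v m'"
    unfolding vc(2) using assms(5) by auto
  finally show "A1' *\<^sub>v (P1 *\<^sub>v v) = 0\<^sub>v m'" .
qed (use assms mat_kernelD[OF assms(2) v] in auto)

text \<open>Preservation of kernels is the invariant that lets the next pair of maps be lifted by
  exactness. Both directions run in one induction because the homotopies concern the
  composites.\<close>

lemma comparison_maps:
  fixes A A' :: "nat \<Rightarrow> 'k::field R4 mat"
  assumes res: "minimal_bigraded_resolution I d A" and res': "minimal_bigraded_resolution I d' A'"
  shows "\<exists>P Q. bigraded_map (d u) (d' u) P \<and> bigraded_map (d' u) (d u) Q \<and>
    (\<forall>v \<in> mat_kernel (A u). P *\<^sub>v v \<in> mat_kernel (A' u)) \<and>
    (\<forall>v \<in> mat_kernel (A' u). Q *\<^sub>v v \<in> mat_kernel (A u)) \<and>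
    near_identity (A u) (A (Suc u)) (Q * P) \<and> near_identity (A' u) (A' (Suc u)) (P * Q)"
proof (induction u)
  note D = minimal_bigraded_resolutionD[OF res] and D' = minimal_bigraded_resolutionD[OF res']
  {
    case 0
    have rng: "mat_range (A 0) = mat_range (A' 0)" using D(4) D'(4) by simp
    have "col (A 0) j \<in> mat_range (A' 0)" if "j < length (d 0)" for j
      using rng D(7) that by (metis carrier_matD(2) col_in_mat_range)
    then obtain P where P: "bigraded_map (d 0) (d' 0) P" "A' 0 * P = A 0"
      using bigraded_lift[OF D'(2) D(2)] by blast
    have "col (A' 0) j \<in> mat_range (A 0)" if "j < length (d' 0)" for j
      using rng D'(7) that by (metis carrier_matD(2) col_in_mat_range)
    then obtain Q where Q: "bigraded_map (d' 0) (d 0) Q" "A 0 * Q = A' 0"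
      using bigraded_lift[OF D(2) D'(2)] by blast
    note cP = bigraded_map_carrier[OF P(1)] and cQ = bigraded_map_carrier[OF Q(1)]
    have "P *\<^sub>v v \<in> mat_kernel (A' 0)" if "v \<in> mat_kernel (A 0)" for v
      using mat_kernelD[OF D(7) that] cP P(2) D'(7)
      by (intro mat_kernelI[OF D'(7)]) (auto simp: assoc_mult_mat_vec[OF D'(7) cP, symmetric])
    moreover have "Q *\<^sub>v v \<in> mat_kernel (A 0)" if "v \<in> mat_kernel (A' 0)" for v
      using mat_kernelD[OF D'(7) that] cQ Q(2) D(7)
      by (intro mat_kernelI[OF D(7)]) (auto simp: assoc_mult_mat_vec[OF D(7) cQ, symmetric])
    moreover have "near_identity (A 0) (A (Suc 0)) (Q * P)"
      using cP cQ D(5) P(2) Q(2)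
      by (intro near_identity_base[OF D(7) D(8)]) (auto simp: assoc_mult_mat[OF D(7) cQ cP, symmetric])
    moreover have "near_identity (A' 0) (A' (Suc 0)) (P * Q)"
      using cP cQ D'(5) P(2) Q(2)
      by (intro near_identity_base[OF D'(7) D'(8)]) (auto simp: assoc_mult_mat[OF D'(7) cP cQ, symmetric])
    ultimately show ?case using P Q by blast
  next
    case (Suc u)
    then obtain P Q where P: "bigraded_map (d u) (d' u) P" and Q: "bigraded_map (d' u) (d u) Q"
      and kP: "\<And>v. v \<in> mat_kernel (A u) \<Longrightarrow> P *\<^sub>v v \<in> mat_kernel (A' u)"
      and kQ: "\<And>v. v \<in> mat_kernel (A' u) \<Longrightarrow> Q *\<^sub>v v \<in> mat_kernel (A u)"
      and nQP: "near_identity (A u) (A (Suc u)) (Q * P)"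
      and nPQ: "near_identity (A' u) (A' (Suc u)) (P * Q)" by blast
    obtain n n' where cA: "A u \<in> carrier_mat n (length (d u))"
      and cA': "A' u \<in> carrier_mat n' (length (d' u))"
      using D(9) D'(9) by blast
    note cP = bigraded_map_carrier[OF P] and cQ = bigraded_map_carrier[OF Q]
    have "col (P * A (Suc u)) j \<in> mat_range (A' (Suc u))" if j: "j < length (d (Suc u))" for j
    proof -
      have "col (A (Suc u)) j \<in> mat_kernel (A u)"
        unfolding D(5) using D(8) j by (metis carrier_matD(2) col_in_mat_range)
      then show ?thesis
        using kP by (simp add: col_mult2[OF cP D(8) j] D'(5)[symmetric])
    qed
    then obtain P1 where P1: "bigraded_map (d (Suc u)) (d' (Suc u)) P1" "A' (Suc u) * P1 = P * A (Suc u)"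
      using bigraded_lift[OF D'(3) bigraded_map_mult[OF P D(3)]] by blast
    have "col (Q * A' (Suc u)) j \<in> mat_range (A (Suc u))" if j: "j < length (d' (Suc u))" for j
    proof -
      have "col (A' (Suc u)) j \<in> mat_kernel (A' u)"
        unfolding D'(5) using D'(8) j by (metis carrier_matD(2) col_in_mat_range)
      then show ?thesis
        using kQ by (simp add: col_mult2[OF cQ D'(8) j] D(5)[symmetric])
    qed
    then obtain Q1 where Q1: "bigraded_map (d' (Suc u)) (d (Suc u)) Q1" "A (Suc u) * Q1 = Q * A' (Suc u)"
      using bigraded_lift[OF D(3) bigraded_map_mult[OF Q D'(3)]] by blast
    note cP1 = bigraded_map_carrier[OF P1(1)] and cQ1 = bigraded_map_carrier[OF Q1(1)]
    have "A (Suc u) * (Q1 * P1) = A (Suc u) * Q1 * P1"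
      by (rule assoc_mult_mat[OF D(8) cQ1 cP1, symmetric])
    also have "\<dots> = Q * (A' (Suc u) * P1)"
      unfolding Q1(2) by (rule assoc_mult_mat[OF cQ D'(8) cP1])
    also have "\<dots> = Q * P * A (Suc u)"
      unfolding P1(2) by (rule assoc_mult_mat[OF cQ cP D(8), symmetric])
    finally have comm: "A (Suc u) * (Q1 * P1) = Q * P * A (Suc u)" .
    have "A' (Suc u) * (P1 * Q1) = A' (Suc u) * P1 * Q1"
      by (rule assoc_mult_mat[OF D'(8) cP1 cQ1, symmetric])
    also have "\<dots> = P * (A (Suc u) * Q1)"
      unfolding P1(2) by (rule assoc_mult_mat[OF cP D(8) cQ1])
    also have "\<dots> = P * Q * A' (Suc u)"
      unfolding Q1(2) by (rule assoc_mult_mat[OF cP cQ D'(8), symmetric])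
    finally have comm': "A' (Suc u) * (P1 * Q1) = P * Q * A' (Suc u)" .
    have "near_identity (A (Suc u)) (A (Suc (Suc u))) (Q1 * P1)"
      using cP cQ cP1 cQ1
      by (intro near_identity_step[OF cA D(8) D(8) _ _ D(5) D(5) D(6) comm nQP]) auto
    moreover have "near_identity (A' (Suc u)) (A' (Suc (Suc u))) (P1 * Q1)"
      using cP cQ cP1 cQ1
      by (intro near_identity_step[OF cA' D'(8) D'(8) _ _ D'(5) D'(5) D'(6) comm' nPQ]) auto
    moreover have "P1 *\<^sub>v v \<in> mat_kernel (A' (Suc u))" if "v \<in> mat_kernel (A (Suc u))" for v
      using mult_mat_in_kernel[OF cA D(8) cA' D'(8) cP cP1 P1(2) that] .
    moreover have "Q1 *\<^sub>v v \<in> mat_kernel (A (Suc u))" if "v \<in> mat_kernel (A' (Suc u))" for v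
      using mult_mat_in_kernel[OF cA' D'(8) cA D(8) cQ cQ1 Q1(2) that] .
    ultimately show ?case using P1(1) Q1(1) by blast
  }
qed

theorem minimal_resolution_unique:
  fixes A A' :: "nat \<Rightarrow> 'k::field_char_0 R4 mat"
  assumes res: "minimal_bigraded_resolution I d A" and res': "minimal_bigraded_resolution I d' A'"
  shows "count_list (d u) x = count_list (d' u) x"
proof -
  note D = minimal_bigraded_resolutionD[OF res] and D' = minimal_bigraded_resolutionD[OF res']
  obtain P Q where P: "bigraded_map (d u) (d' u) P" and Q: "bigraded_map (d' u) (d u) Q"
    and near: "near_identity (A u) (A (Suc u)) (Q * P)" "near_identity (A' u) (A' (Suc u)) (P * Q)"
    using comparison_maps[OF res res', of u] by blast
  obtain n n' where cA: "A u \<in> carrier_mat n (length (d u))"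
    and cA': "A' u \<in> carrier_mat n' (length (d' u))"
    using D(9) D'(9) by blast
  show ?thesis
    using near_identity_constant_term[OF near(1) cA D(8) D(6)]
      near_identity_constant_term[OF near(2) cA' D'(8) D'(6)]
    by (intro count_list_eq_of_inverse_mod_max[OF P Q]) auto
qed

text \<open>One explicit minimal resolution provides the existence, and the preceding theorem the
  uniqueness, that the \<open>THE\<close> in \<open>betti\<close> asks for.\<close>

theorem betti_eq_count_list:
  fixes A :: "nat \<Rightarrow> 'k::field_char_0 R4 mat"
  assumes "minimal_bigraded_resolution I d A"
  shows "betti I u x = count_list (d u) x"
  unfolding betti_def
  using assms minimal_resolution_unique by (intro the_equality) blast+


section \<open>Mapping cones\<close>

text \<open>For \<open>(v, w)\<close> in the kernel, \<open>colon\<close> writes \<open>w\<close> as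
  \<open>L' w'\<close>, and the anticommuting square makes \<open>v - \<psi>' w'\<close> a cycle of
  \<open>A\<close>. The hypothesis \<open>colon\<close> may also use the equation involving
  \<open>v\<close>, which covers the bottom of the complex, where \<open>L\<close> is the zero
  map.\<close>

lemma cone_exact:
  fixes A A' L L' \<psi> \<psi>' :: "'a::comm_ring_1 mat"
  assumes A: "A \<in> carrier_mat n m" and A': "A' \<in> carrier_mat m l"
    and L: "L \<in> carrier_mat n' m'" and L': "L' \<in> carrier_mat m' l'"
    and \<psi>: "\<psi> \<in> carrier_mat n m'" and \<psi>': "\<psi>' \<in> carrier_mat m l'"
    and ex: "mat_kernel A = mat_range A'" and LL: "L * L' = 0\<^sub>m n' l'"
    and sq: "A * \<psi>' = - (\<psi> * L')"
    and colon: "\<And>v w. v \<in> carrier_vec m \<Longrightarrow> w \<in> carrier_vec m' \<Longrightarrow>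
      A *\<^sub>v v + \<psi> *\<^sub>v w = 0\<^sub>v n \<Longrightarrow> L *\<^sub>v w = 0\<^sub>v n' \<Longrightarrow> w \<in> mat_range L'"
  shows "mat_kernel (four_block_mat A \<psi> (0\<^sub>m n' m) L) =
    mat_range (four_block_mat A' \<psi>' (0\<^sub>m m' l) L')" (is "mat_kernel ?C = mat_range ?C'")
proof (intro equalityI subsetI)
  have C: "?C \<in> carrier_mat (n + n') (m + m')" and C': "?C' \<in> carrier_mat (m + m') (l + l')"
    using A L A' L' by auto
  have mC: "?C *\<^sub>v (v @\<^sub>v w) = (A *\<^sub>v v + \<psi> *\<^sub>v w) @\<^sub>v (L *\<^sub>v w)"
    if "v \<in> carrier_vec m" "w \<in> carrier_vec m'" for v w
    using that A L \<psi> by (subst four_block_mat_mult_vec[of _ n m _ m' _ n']) auto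
  have mC': "?C' *\<^sub>v (v @\<^sub>v w) = (A' *\<^sub>v v + \<psi>' *\<^sub>v w) @\<^sub>v (L' *\<^sub>v w)"
    if "v \<in> carrier_vec l" "w \<in> carrier_vec l'" for v w
    using that A' L' \<psi>' by (subst four_block_mat_mult_vec[of _ m l _ l' _ m']) auto
  have sq_vec: "A *\<^sub>v (\<psi>' *\<^sub>v w) = - (\<psi> *\<^sub>v (L' *\<^sub>v w))" if "w \<in> carrier_vec l'" for w
  proof -
    have "A *\<^sub>v (\<psi>' *\<^sub>v w) = (- (\<psi> * L')) *\<^sub>v w"
      using that A \<psi>' by (simp add: sq[symmetric])
    also have "\<dots> = - ((\<psi> * L') *\<^sub>v w)"
      using that \<psi> L' by (intro eq_vecI) auto
    finally show ?thesis using that \<psi> L' by simp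
  qed
  have zero_app: "0\<^sub>v (i + j) = 0\<^sub>v i @\<^sub>v (0\<^sub>v j :: 'a vec)" for i j by auto
  {
    fix x assume x: "x \<in> mat_kernel ?C"
    define v w where "v = vec_first x m" and "w = vec_last x m'"
    have v: "v \<in> carrier_vec m" and w: "w \<in> carrier_vec m'" and xvw: "x = v @\<^sub>v w"
      using mat_kernelD(1)[OF C x] by (auto simp: v_def w_def)
    have "(A *\<^sub>v v + \<psi> *\<^sub>v w) @\<^sub>v (L *\<^sub>v w) = 0\<^sub>v n @\<^sub>v 0\<^sub>v n'"
      using mat_kernelD(2)[OF C x] mC[OF v w] by (simp add: xvw zero_app)
    then have 1: "A *\<^sub>v v + \<psi> *\<^sub>v w = 0\<^sub>v n" and 2: "L *\<^sub>v w = 0\<^sub>v n'"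
      using A \<psi> v w by (subst (asm) append_vec_eq[of _ n]; auto)+
    obtain w' where w': "w' \<in> carrier_vec l'" "w = L' *\<^sub>v w'"
      using colon[OF v w 1 2] L' by (auto simp: mat_range_def)
    define z where "z = v - \<psi>' *\<^sub>v w'"
    have z: "z \<in> carrier_vec m" using v w' \<psi>' by (auto simp: z_def)
    have "A *\<^sub>v z = A *\<^sub>v v - A *\<^sub>v (\<psi>' *\<^sub>v w')"
      unfolding z_def using A v w' \<psi>' by (intro mult_minus_distrib_mat_vec) auto
    also have "\<dots> = A *\<^sub>v v + \<psi> *\<^sub>v w"
      using A \<psi> v w w' by (auto simp: sq_vec intro!: eq_vecI)
    finally have "z \<in> mat_kernel A"
      using 1 z A by (intro mat_kernelI) auto
    then obtain v' where v': "v' \<in> carrier_vec l" "z = A' *\<^sub>v v'"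
      unfolding ex using A' by (auto simp: mat_range_def)
    have "v = A' *\<^sub>v v' + \<psi>' *\<^sub>v w'"
      unfolding v'(2)[symmetric] z_def using v w' \<psi>' by (intro eq_vecI) auto
    then have "x = ?C' *\<^sub>v (v' @\<^sub>v w')"
      by (simp add: xvw mC' v' w')
    moreover have "v' @\<^sub>v w' \<in> carrier_vec (dim_col ?C')"
      using v' w' A' L' by auto
    ultimately show "x \<in> mat_range ?C'"
      by (simp only: mat_rangeI)
  next
    fix x assume "x \<in> mat_range ?C'"
    then obtain y where y: "y \<in> carrier_vec (l + l')" "x = ?C' *\<^sub>v y"
      using C' by (auto simp: mat_range_def)
    define v w where "v = vec_first y l" and "w = vec_last y l'"
    have v: "v \<in> carrier_vec l" and w: "w \<in> carrier_vec l'" and yvw: "y = v @\<^sub>v w"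
      using y by (auto simp: v_def w_def)
    have x: "x = (A' *\<^sub>v v + \<psi>' *\<^sub>v w) @\<^sub>v (L' *\<^sub>v w)"
      using mC'[OF v w] by (simp add: y yvw)
    have "A' *\<^sub>v v \<in> mat_kernel A"
      unfolding ex using v A' by (intro mat_rangeI) auto
    then have Av: "A *\<^sub>v (A' *\<^sub>v v) = 0\<^sub>v n"
      by (rule mat_kernelD(2)[OF A])
    have "L *\<^sub>v (L' *\<^sub>v w) = (L * L') *\<^sub>v w"
      using L L' w by simp
    also have "\<dots> = 0\<^sub>v n'"
      unfolding LL using w by (intro eq_vecI) auto
    finally have Lw: "L *\<^sub>v (L' *\<^sub>v w) = 0\<^sub>v n'" .
    have "A *\<^sub>v (A' *\<^sub>v v + \<psi>' *\<^sub>v w) + \<psi> *\<^sub>v (L' *\<^sub>v w) =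
        A *\<^sub>v (A' *\<^sub>v v) + A *\<^sub>v (\<psi>' *\<^sub>v w) + \<psi> *\<^sub>v (L' *\<^sub>v w)"
      using A A' v w \<psi>' by (subst mult_add_distrib_mat_vec[of _ n m]) auto
    also have "\<dots> = 0\<^sub>v n"
      unfolding Av sq_vec[OF w] using \<psi> L' w by (intro eq_vecI) auto
    finally have 0: "A *\<^sub>v (A' *\<^sub>v v + \<psi>' *\<^sub>v w) + \<psi> *\<^sub>v (L' *\<^sub>v w) = 0\<^sub>v n" .
    show "x \<in> mat_kernel ?C"
    proof (rule mat_kernelI[OF C])
      show "x \<in> carrier_vec (m + m')"
        unfolding x using A' \<psi>' L' v w by (intro append_carrier_vec) auto
      have "A' *\<^sub>v v + \<psi>' *\<^sub>v w \<in> carrier_vec m" "L' *\<^sub>v w \<in> carrier_vec m'"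
        using A' \<psi>' L' v w by auto
      then show "?C *\<^sub>v x = 0\<^sub>v (n + n')"
        by (simp add: x mC 0 Lw zero_app)
    qed
  }
qed

lemma bigraded_map_four_block:
  assumes A: "bigraded_map d e A" and B: "bigraded_map d' e B" and D: "bigraded_map d' e' D"
  shows "bigraded_map (d @ d') (e @ e')
    (four_block_mat A B (0\<^sub>m (length e') (length d)) D)"
  using bigraded_map_carrier[OF A] bigraded_map_carrier[OF D]
  unfolding bigraded_map_def
  by (auto simp: nth_append bigraded_map_entry[OF A] bigraded_map_entry[OF B] bigraded_map_entry[OF D])

lemma bigraded_map_uminus: "bigraded_map d e A \<Longrightarrow> bigraded_map d e (- A)"
  by (auto simp: bigraded_map_def bihomogeneous_uminus)

lemma bigraded_map_shift:
  "bigraded_map d e A \<Longrightarrow> bigraded_map (map ((+) c) d) (map ((+) c) e) A"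
  by (auto simp: bigraded_map_def)

lemma zero_constant_terms_four_block:
  assumes "zero_constant_terms A" "zero_constant_terms B" "zero_constant_terms D"
    and "A \<in> carrier_mat n m" "B \<in> carrier_mat n m'" "D \<in> carrier_mat n' m'"
  shows "zero_constant_terms (four_block_mat A B (0\<^sub>m n' m) D)"
  using assms by (auto simp: zero_constant_terms_def)

text \<open>Multiplication by \<open>g\<close> embeds \<open>R/J\<close>, shifted by
  \<open>\<gamma>\<close>, into \<open>R/I\<close> with cokernel \<open>R/(I + (g))\<close>, and the
  cone of a lift of this map to the resolutions resolves the cokernel. \<open>disj\<close> keeps
  units out of the lift, the inclusion of \<open>J\<close> in the irrelevant ideal keeps them out of
  the row of generators of \<open>J\<close>, and \<open>short\<close> bounds the length.\<close>

theorem mapping_cone: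
  fixes I J :: "'k::field R4 set" and g :: "'k R4"
  assumes res: "minimal_bigraded_resolution I d A"
    and resJ: "minimal_bigraded_resolution J \<delta> K"
    and colon: "\<And>r. r \<in> J \<longleftrightarrow> r * g \<in> I"
    and g: "bihomogeneous \<gamma> g"
    and J: "J \<subseteq> max_homogeneous_ideal"
    and short: "\<delta> 2 = []"
    and disj: "\<And>u x y. x \<in> set (d u) \<Longrightarrow> y \<in> set (\<delta> u) \<Longrightarrow> x \<noteq> \<gamma> + y"
  shows "\<exists>A'. minimal_bigraded_resolution {p + r * g |p r. p \<in> I}
    (\<lambda>u. d u @ (case u of 0 \<Rightarrow> [\<gamma>] | Suc v \<Rightarrow> map ((+) \<gamma>) (\<delta> v))) A'"
proof -
  note D = minimal_bigraded_resolutionD[OF res] and DJ = minimal_bigraded_resolutionD[OF resJ]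
  \<comment> \<open>The pair \<open>\<eta>\<close>, \<open>L\<close> resolves the shifted
    \<open>R/J\<close> rather than \<open>J\<close>: a generator of degree \<open>\<gamma>\<close>
    is put in front and \<open>K\<close> moves up one place. The targets are \<open>e\<close>, with
    \<open>R\<close> itself below \<open>d 0\<close>, and \<open>\<epsilon>\<close>, with the zero
    module below \<open>\<eta> 0\<close>.\<close>
  define \<eta> where "\<eta> u = (case u of 0 \<Rightarrow> [\<gamma>] | Suc v \<Rightarrow> map ((+) \<gamma>) (\<delta> v))" for u
  define e where "e u = (case u of 0 \<Rightarrow> [(0, 0)] | Suc v \<Rightarrow> d v)" for u
  define \<epsilon> where "\<epsilon> u = (case u of 0 \<Rightarrow> [] | Suc v \<Rightarrow> \<eta> v)" for u
  define L where "L u = (case u of 0 \<Rightarrow> 0\<^sub>m 0 1 | Suc v \<Rightarrow> K v)" for u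
  have bgA: "bigraded_map (d u) (e u) (A u)" for u
    using D(2,3) by (auto simp: e_def split: nat.split)
  have bgL: "bigraded_map (\<eta> u) (\<epsilon> u) (L u)" for u
  proof (cases u)
    case 0
    then show ?thesis by (simp add: L_def \<eta>_def \<epsilon>_def bigraded_map_def)
  next
    case (Suc v)
    have "bigraded_map (map ((+) \<gamma>) (\<delta> v)) (\<eta> v) (K v)"
    proof (cases v)
      case 0
      then show ?thesis using bigraded_map_shift[OF DJ(2), of \<gamma>]
        by (simp add: \<eta>_def zero_prod_def[symmetric, where 'a=int and 'b=int])
    next
      case (Suc v')
      then show ?thesis using bigraded_map_shift[OF DJ(3)] by (simp add: \<eta>_def)
    qed
    then show ?thesis by (simp add: Suc L_def \<eta>_def \<epsilon>_def)
  qed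
  note cA = bigraded_map_carrier[OF bgA] and cL = bigraded_map_carrier[OF bgL]
  have [simp]: "e (Suc u) = d u" "\<epsilon> (Suc u) = \<eta> u" "L (Suc u) = K u" for u
    by (simp_all add: e_def \<epsilon>_def L_def)
  have LL: "L u * L (Suc u) = 0\<^sub>m (length (\<epsilon> u)) (length (\<eta> (Suc u)))" for u
  proof (cases u)
    case 0
    then show ?thesis using cL[of u] cL[of "Suc u"] by (intro eq_matI) (auto simp: \<epsilon>_def)
  next
    case (Suc v)
    have "L u *\<^sub>v w = 0\<^sub>v (length (\<epsilon> u))" if "w \<in> mat_range (L (Suc u))" for w
      using that mat_kernelD(2)[OF cL[of u]] DJ(5)[of v] by (simp add: Suc)
    then show ?thesis
      using cL[of u] cL[of "Suc u"] by (intro mult_mat_zero_of_kernel[of _ _ "length (\<eta> u)"]) auto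
  qed
  have rng0: "x \<in> mat_range (A 0) \<longleftrightarrow> x \<in> carrier_vec 1 \<and> x $ 0 \<in> I" for x
    using D(4) by auto
  have rngK: "x \<in> mat_range (K 0) \<longleftrightarrow> x \<in> carrier_vec 1 \<and> x $ 0 \<in> J" for x
    using DJ(4) by auto
  \<comment> \<open>The range condition is the invariant that permits the next lift through
    \<open>A u\<close>; the last conjunct pins the bottom map to multiplication by
    \<open>g\<close>.\<close>
  let ?good = "\<lambda>u \<psi>. bigraded_map (\<eta> u) (e u) \<psi> \<and>
    (\<forall>w \<in> mat_range (L (Suc u)). \<psi> *\<^sub>v w \<in> mat_range (A u)) \<and> (u = 0 \<longrightarrow> \<psi> = mat 1 1 (\<lambda>_. g))"
  have "\<exists>\<psi>. \<forall>u. ?good u (\<psi> u) \<and> A u * \<psi> (Suc u) = - (\<psi> u * L (Suc u))"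
  proof (rule dependent_nat_choice)
    have "bigraded_map (\<eta> 0) (e 0) (mat 1 1 (\<lambda>_. g))"
      using g by (simp add: bigraded_map_def \<eta>_def e_def zero_prod_def[symmetric, where 'a=int and 'b=int])
    moreover have "mat 1 1 (\<lambda>_. g) *\<^sub>v w \<in> mat_range (A 0)" if "w \<in> mat_range (K 0)" for w
    proof -
      have w: "w \<in> carrier_vec 1" "w $ 0 * g \<in> I" using that colon by (auto simp: rngK)
      then have "mat 1 1 (\<lambda>_. g) *\<^sub>v w = vec 1 (\<lambda>_. w $ 0 * g)"
        by (intro eq_vecI) (auto simp: scalar_prod_def mult.commute)
      then show ?thesis using w by (simp add: rng0)
    qed
    ultimately show "\<exists>\<psi>. ?good 0 \<psi>" by auto
  next
    fix \<psi> u assume good: "?good u \<psi>"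
    then have bg: "bigraded_map (\<eta> u) (e u) \<psi>"
      and rng: "\<And>w. w \<in> mat_range (L (Suc u)) \<Longrightarrow> \<psi> *\<^sub>v w \<in> mat_range (A u)" by auto
    note c\<psi> = bigraded_map_carrier[OF bg]
    have bg': "bigraded_map (\<eta> (Suc u)) (e u) (- (\<psi> * L (Suc u)))"
      using bigraded_map_mult[OF bg] bgL[of "Suc u"] by (auto intro: bigraded_map_uminus)
    have "col (- (\<psi> * L (Suc u))) j \<in> mat_range (A u)" if j: "j < length (\<eta> (Suc u))" for j
    proof -
      have cLu: "L (Suc u) \<in> carrier_mat (length (\<eta> u)) (length (\<eta> (Suc u)))"
        using cL[of "Suc u"] by simp
      have "\<psi> *\<^sub>v col (L (Suc u)) j \<in> mat_range (A u)"
        using cLu j by (intro rng col_in_mat_range) auto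
      then obtain x where x: "x \<in> carrier_vec (length (d u))" "\<psi> *\<^sub>v col (L (Suc u)) j = A u *\<^sub>v x"
        using cA[of u] by (auto simp: mat_range_def)
      have "col (- (\<psi> * L (Suc u))) j = - (\<psi> *\<^sub>v col (L (Suc u)) j)"
        using cLu c\<psi> j by (intro eq_vecI) auto
      also have "\<dots> = A u *\<^sub>v (- x)"
        unfolding x(2) using x(1) cA[of u] by (intro eq_vecI) auto
      finally show ?thesis
        using x(1) cA[of u] by (auto intro: mat_rangeI)
    qed
    then obtain \<psi>' where \<psi>': "bigraded_map (\<eta> (Suc u)) (d u) \<psi>'" "A u * \<psi>' = - (\<psi> * L (Suc u))"
      using bigraded_lift[OF bgA bg'] by blast
    note c\<psi>' = bigraded_map_carrier[OF \<psi>'(1)]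
    have "\<psi>' *\<^sub>v w \<in> mat_range (A (Suc u))" if "w \<in> mat_range (L (Suc (Suc u)))" for w
    proof -
      have w: "w \<in> mat_kernel (L (Suc u))" using that DJ(5) by simp
      have cLu: "L (Suc u) \<in> carrier_mat (length (\<eta> u)) (length (\<eta> (Suc u)))"
        using cL[of "Suc u"] by simp
      note wD = mat_kernelD[OF cLu w]
      have "A u *\<^sub>v (\<psi>' *\<^sub>v w) = (- (\<psi> * L (Suc u))) *\<^sub>v w"
        unfolding \<psi>'(2)[symmetric] using cA[of u] c\<psi>' wD by simp
      also have "\<dots> = - (\<psi> *\<^sub>v (L (Suc u) *\<^sub>v w))"
        unfolding assoc_mult_mat_vec[OF c\<psi> cLu wD(1), symmetric]
        using c\<psi> cLu wD by (intro eq_vecI) auto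
      also have "\<dots> = 0\<^sub>v (length (e u))"
        unfolding wD(2) using c\<psi> by auto
      finally show ?thesis
        unfolding D(5)[symmetric] using c\<psi>' wD by (intro mat_kernelI[OF cA]) auto
    qed
    then show "\<exists>\<psi>'. ?good (Suc u) \<psi>' \<and> A u * \<psi>' = - (\<psi> * L (Suc u))"
      using \<psi>' by auto
  qed
  then obtain \<psi> where good: "\<And>u. ?good u (\<psi> u)"
    and sq: "\<And>u. A u * \<psi> (Suc u) = - (\<psi> u * L (Suc u))" by blast
  have bg\<psi>: "bigraded_map (\<eta> u) (e u) (\<psi> u)" for u using good by blast
  note c\<psi> = bigraded_map_carrier[OF bg\<psi>]
  have \<psi>0: "\<psi> 0 = mat 1 1 (\<lambda>_. g)" using good by blast
  define A' where "A' u = four_block_mat (A u) (\<psi> u) (0\<^sub>m (length (\<epsilon> u)) (length (d u))) (L u)" for u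
  have bgA': "bigraded_map (d u @ \<eta> u) (e u @ \<epsilon> u) (A' u)" for u
    unfolding A'_def by (intro bigraded_map_four_block bgA bg\<psi> bgL)
  \<comment> \<open>At the bottom \<open>L 0\<close> has no rows, so \<open>w\<close> enters
    \<open>J\<close> because its product with \<open>g\<close> lies in \<open>I\<close>; higher up
    the claim is exactness of the resolution of \<open>J\<close>.\<close>
  have in_rangeL: "w \<in> mat_range (L (Suc u))"
    if v: "v \<in> carrier_vec (length (d u))" and w: "w \<in> carrier_vec (length (\<eta> u))"
      and 1: "A u *\<^sub>v v + \<psi> u *\<^sub>v w = 0\<^sub>v (length (e u))" and 2: "L u *\<^sub>v w = 0\<^sub>v (length (\<epsilon> u))"
    for u v w
  proof (cases u)
    case 0
    have w1: "w \<in> carrier_vec 1" using w by (simp add: 0 \<eta>_def)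
    have "(A u *\<^sub>v v + \<psi> u *\<^sub>v w) $ 0 = 0"
      unfolding 1 by (simp add: 0 e_def)
    then have "(A 0 *\<^sub>v v) $ 0 + g * w $ 0 = 0"
      using w1 D(7) by (simp add: 0 \<psi>0 scalar_prod_def)
    then have "w $ 0 * g = (A 0 *\<^sub>v (- v)) $ 0"
      using v D(7) by (simp add: 0 mult.commute add_eq_0_iff)
    also have "\<dots> \<in> I"
      using v D(7) mat_rangeI[of "- v" "A 0"] unfolding rng0 by (auto simp: 0)
    finally show ?thesis using w1 colon by (simp add: 0 rngK)
  next
    case (Suc u')
    then show ?thesis
      using DJ(5)[of u'] mat_kernelI[OF cL[of u] w 2] by simp
  qed
  have "minimal_bigraded_resolution {p + r * g |p r. p \<in> I} (\<lambda>u. d u @ \<eta> u) A'"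
    unfolding minimal_bigraded_resolution_def elements_mat_max_homogeneous_ideal_iff
  proof (intro conjI allI impI)
    fix u :: nat assume u: "u > 2"
    have "\<delta> v = []" if "v \<ge> 2" for v
      using that short DJ(1)[of v] by (cases "v = 2") auto
    then show "d u @ \<eta> u = []"
      using D(1)[OF u] u by (auto simp: \<eta>_def split: nat.split)
  next
    show "bigraded_map (d 0 @ \<eta> 0) [(0, 0)] (A' 0)"
      using bgA'[of 0] by (simp add: e_def \<epsilon>_def)
    show "bigraded_map (d (Suc u) @ \<eta> (Suc u)) (d u @ \<eta> u) (A' (Suc u))" for u
      using bgA'[of "Suc u"] by simp
  next
    fix u
    show "mat_kernel (A' u) = mat_range (A' (Suc u))"
      unfolding A'_def \<open>\<epsilon> (Suc u) = \<eta> u\<close>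
      using cA[of u] cA[of "Suc u"] cL[of u] cL[of "Suc u"] c\<psi>[of u] c\<psi>[of "Suc u"] LL[of u]
      by (intro cone_exact sq D(5) in_rangeL) simp_all
  next
    fix u
    \<comment> \<open>A constant entry of the comparison map would need equal degrees, which
      \<open>disj\<close> excludes.\<close>
    have "cf (\<psi> (Suc u) $$ (i, j)) 0 = 0" if ij: "i < length (d u)" "j < length (\<delta> u)" for i j
    proof (rule bihomogeneous_constant_term)
      show "bihomogeneous (\<eta> (Suc u) ! j - d u ! i) (\<psi> (Suc u) $$ (i, j))"
        using bigraded_map_entry[OF bg\<psi>[of "Suc u"], of i j] ij by (simp add: \<eta>_def)
      have "d u ! i \<noteq> \<gamma> + \<delta> u ! j"
        using ij by (intro disj[of _ u]) auto
      then show "\<eta> (Suc u) ! j - d u ! i \<noteq> 0"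
        using ij by (auto simp: \<eta>_def)
    qed
    then have "zero_constant_terms (\<psi> (Suc u))"
      using c\<psi>[of "Suc u"] by (auto simp: zero_constant_terms_def \<eta>_def)
    moreover have "zero_constant_terms (L (Suc u))"
    proof (cases u)
      case 0
      have "cf (K 0 $$ (0, j)) 0 = 0" if "j < length (\<delta> 0)" for j
      proof -
        have "col (K 0) j \<in> mat_range (K 0)"
          using that DJ(7) by (intro col_in_mat_range) auto
        then have "K 0 $$ (0, j) \<in> J"
          using that DJ(7) by (auto simp: rngK)
        then show ?thesis using J by (auto simp: max_homogeneous_ideal_eq)
      qed
      then show ?thesis using DJ(7) by (auto simp: zero_constant_terms_def 0)
    next
      case (Suc v)
      then show ?thesis using DJ(6)[of v] by simp
    qed
    ultimately show "zero_constant_terms (A' (Suc u))"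
      unfolding A'_def
      using cA[of "Suc u"] cL[of "Suc u"] c\<psi>[of "Suc u"] D(6)[of u]
      by (intro zero_constant_terms_four_block) simp_all
  next
    have mA': "A' 0 *\<^sub>v (v @\<^sub>v w) = (A 0 *\<^sub>v v + \<psi> 0 *\<^sub>v w) @\<^sub>v (L 0 *\<^sub>v w)"
      if "v \<in> carrier_vec (length (d 0))" "w \<in> carrier_vec 1" for v w
      unfolding A'_def using that cA[of 0] cL[of 0] c\<psi>[of 0] 
      by (subst four_block_mat_mult_vec[of _ 1 "length (d 0)" _ 1 _ 0])
         (auto simp: e_def \<epsilon>_def \<eta>_def)
    have nth: "(A' 0 *\<^sub>v (v @\<^sub>v w)) $ 0 = (A 0 *\<^sub>v v) $ 0 + w $ 0 * g"
      if "v \<in> carrier_vec (length (d 0))" "w \<in> carrier_vec 1" for v w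
      unfolding mA'[OF that] using that D(7) by (simp add: \<psi>0 scalar_prod_def mult.commute)
    have cA'0: "A' 0 \<in> carrier_mat 1 (length (d 0) + 1)"
      using bigraded_map_carrier[OF bgA'[of 0]] by (simp add: e_def \<epsilon>_def \<eta>_def)
    show "mat_range (A' 0) = {v \<in> carrier_vec 1. v $ 0 \<in> {p + r * g |p r. p \<in> I}}"
    proof (intro equalityI subsetI)
      fix x assume "x \<in> mat_range (A' 0)"
      then obtain y where y: "y \<in> carrier_vec (length (d 0) + 1)" "x = A' 0 *\<^sub>v y"
        using cA'0 by (auto simp: mat_range_def)
      define v w where "v = vec_first y (length (d 0))" and "w = vec_last y 1"
      have v: "v \<in> carrier_vec (length (d 0))" and w: "w \<in> carrier_vec 1" and yvw: "y = v @\<^sub>v w"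
        using y by (auto simp: v_def w_def)
      have "(A 0 *\<^sub>v v) $ 0 \<in> I"
        using v D(7) mat_rangeI[of v "A 0"] unfolding rng0 by auto
      then have "x $ 0 \<in> {p + r * g |p r. p \<in> I}"
        unfolding y(2) yvw nth[OF v w] by blast
      then show "x \<in> {v \<in> carrier_vec 1. v $ 0 \<in> {p + r * g |p r. p \<in> I}}"
        using y cA'0 by auto
    next
      fix x assume "x \<in> {v \<in> carrier_vec 1. v $ 0 \<in> {p + r * g |p r. p \<in> I}}"
      then obtain p r where x: "x \<in> carrier_vec 1" "x $ 0 = p + r * g" "p \<in> I" by auto
      have "vec 1 (\<lambda>_. p) \<in> mat_range (A 0)" using x by (simp add: rng0)
      then obtain v where v: "v \<in> carrier_vec (length (d 0))" "vec 1 (\<lambda>_. p) = A 0 *\<^sub>v v"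
        using D(7) by (auto simp: mat_range_def)
      let ?w = "vec 1 (\<lambda>_. r)"
      have "x = A' 0 *\<^sub>v (v @\<^sub>v ?w)"
      proof (intro eq_vecI)
        have "(A 0 *\<^sub>v v) $ 0 = p"
          using v by (metis index_vec less_one)
        then have "(A' 0 *\<^sub>v (v @\<^sub>v ?w)) $ 0 = x $ 0"
          using nth[OF v(1), of ?w] x by simp
        then show "x $ i = (A' 0 *\<^sub>v (v @\<^sub>v ?w)) $ i" if "i < dim_vec (A' 0 *\<^sub>v (v @\<^sub>v ?w))" for i
          using that cA'0 by simp
      qed (use x cA'0 in simp)
      moreover have "v @\<^sub>v ?w \<in> carrier_vec (dim_col (A' 0))"
        using append_carrier_vec[OF v(1), of ?w 1] cA'0 by simp
      ultimately show "x \<in> mat_range (A' 0)"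
        by (simp only: mat_rangeI)
    qed
  qed
  then show ?thesis unfolding \<eta>_def by blast
qed


section \<open>Monomial ideals\<close>

definition monomial_ideal :: "(4 \<Rightarrow>\<^sub>0 nat) set \<Rightarrow> 'k::field R4 set"
  where "monomial_ideal S = {p. mons p \<subseteq> S}"

text \<open>The existential form keeps a resolution available for the next cone. The type argument
  fixes the coefficient field, which a set of exponents does not determine.\<close>

definition has_betti :: "'k::field itself \<Rightarrow> (4 \<Rightarrow>\<^sub>0 nat) set \<Rightarrow> (nat \<Rightarrow> int \<times> int \<Rightarrow> nat) \<Rightarrow> bool"
  where "has_betti K S b \<longleftrightarrow>
    (\<exists>d A. minimal_bigraded_resolution (monomial_ideal S :: 'k R4 set) d A \<and>
      (\<forall>u x. b u x = count_list (d u) x))"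

lemma has_betti_cong: "has_betti K S b \<Longrightarrow> S = S' \<Longrightarrow> (\<And>u x. b u x = b' u x) \<Longrightarrow> has_betti K S' b'"
  by (simp add: has_betti_def)

lemma count_list_map_plus: "count_list (map ((+) c) xs) x = count_list xs (x - c)"
  for c :: "'a::ab_group_add"
  by (induction xs) (auto simp: algebra_simps)

lemma mult_xpow_lookup: "cf (p * xpow m) (t + m) = cf p t"
proof -
  have "cf (p * xpow m) (t + m) = (\<Sum>l. cf p l * (\<Sum>q. (1 when m = q) when t + m = l + q))"
    by (simp add: lookup_mult lookup_single)
  also have "\<dots> = (\<Sum>l. cf p l * ((1 when t + m = l + m)))"
  proof -
    have "(\<Sum>q. (1 when m = q) when t + m = l + q) = ((1::'a) when t + m = l + m)" for l
    proof -
      have "(\<lambda>q. (1::'a) when m = q when t + m = l + q) = (\<lambda>q. (1 when t + m = l + m) when m = q)"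
        by (auto simp: when_def fun_eq_iff)
      then show ?thesis by (simp only: Sum_any_when_equal')
    qed
    then show ?thesis by simp
  qed
  also have "\<dots> = (\<Sum>l. cf p l when t = l)"
    by (rule Sum_any.cong) (auto simp: when_def)
  finally show ?thesis by simp
qed

lemma mons_mult_xpow: "mons (p * xpow m) = (\<lambda>t. t + m) ` mons p"
proof (intro equalityI subsetI)
  fix t assume "t \<in> mons (p * xpow m)"
  then show "t \<in> (\<lambda>t. t + m) ` mons p"
    using keys_mult[of p "xpow m"] by (auto split: if_splits)
qed (auto simp: in_keys_iff mult_xpow_lookup)

lemma has_betti_empty: "has_betti TYPE('k::field) {} (\<lambda>_ _. 0)"
proof -
  have "monomial_ideal {} = {0 :: 'k R4}"
    by (auto simp: monomial_ideal_def)
  moreover have "mat_range (0\<^sub>m 1 0) = {v \<in> carrier_vec 1. v $ 0 = (0 :: 'k R4)}"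
  proof (intro equalityI subsetI)
    fix v :: "'k R4 vec" assume "v \<in> {v \<in> carrier_vec 1. v $ 0 = 0}"
    then have "v = 0\<^sub>m 1 0 *\<^sub>v 0\<^sub>v 0"
      by (intro eq_vecI) auto
    then show "v \<in> mat_range (0\<^sub>m 1 0)"
      by (simp only: mat_rangeI index_zero_mat zero_carrier_vec)
  next
    fix v :: "'k R4 vec" assume "v \<in> mat_range (0\<^sub>m 1 0)"
    then obtain w where "w \<in> carrier_vec 0" "v = 0\<^sub>m 1 0 *\<^sub>v w"
      by (auto simp: mat_range_def)
    then have "v = 0\<^sub>v 1"
      by (intro eq_vecI) (auto simp: scalar_prod_def)
    then show "v \<in> {v \<in> carrier_vec 1. v $ 0 = 0}" by simp
  qed
  moreover have "mat_kernel (0\<^sub>m n 0 :: 'k R4 mat) = mat_range (0\<^sub>m 0 0)" for n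
  proof -
    have "carrier_vec 0 = {0\<^sub>v 0 :: 'k R4 vec}"
      by (auto intro: eq_vecI)
    moreover have "0\<^sub>m i 0 *\<^sub>v 0\<^sub>v 0 = (0\<^sub>v i :: 'k R4 vec)" for i
      using mult_mat_zero_vec[of "0\<^sub>m i 0 :: 'k R4 mat" 0] by simp
    ultimately show ?thesis
      by (auto simp: mat_kernel_def mat_range_def)
  qed
  ultimately have "minimal_bigraded_resolution (monomial_ideal {} :: 'k R4 set) (\<lambda>_. [])
      (\<lambda>u. 0\<^sub>m (if u = 0 then 1 else 0) 0)"
    by (auto simp: minimal_bigraded_resolution_def bigraded_map_def elements_mat_def)
  then show ?thesis
    unfolding has_betti_def by (intro exI[of _ "\<lambda>_. []"] exI conjI) auto
qed

text \<open>The colon of a monomial ideal by \<open>xpow m\<close> is monomial, with the exponents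
  that \<open>m\<close> translates into \<open>S\<close>. The assumption \<open>m \<notin> S\<close>
  makes it proper, and \<open>disj\<close> is the absence of units expressed through Betti
  numbers.\<close>

lemma has_betti_insert:
  assumes S: "has_betti TYPE('k::field) S b" and J: "has_betti TYPE('k) {t. t + m \<in> S} c"
    and m: "m \<notin> S" and short: "\<And>x. c 2 x = 0"
    and disj: "\<And>u x. c u x \<noteq> 0 \<Longrightarrow> b u (bidegree m + x) = 0"
  shows "has_betti TYPE('k) (S \<union> range (\<lambda>t. t + m))
    (\<lambda>u x. b u x + (case u of 0 \<Rightarrow> if x = bidegree m then 1 else 0 | Suc v \<Rightarrow> c v (x - bidegree m)))"
proof -
  obtain d A where res: "minimal_bigraded_resolution (monomial_ideal S :: 'k R4 set) d A"
    and d: "\<And>u x. b u x = count_list (d u) x" using S by (auto simp: has_betti_def)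
  obtain \<delta> K where resJ: "minimal_bigraded_resolution (monomial_ideal {t. t + m \<in> S} :: 'k R4 set) \<delta> K"
    and \<delta>: "\<And>u x. c u x = count_list (\<delta> u) x" using J by (auto simp: has_betti_def)
  have "\<exists>A'. minimal_bigraded_resolution {p + r * xpow m |p r. p \<in> (monomial_ideal S :: 'k R4 set)}
    (\<lambda>u. d u @ (case u of 0 \<Rightarrow> [bidegree m] | Suc v \<Rightarrow> map ((+) (bidegree m)) (\<delta> v))) A'"
  proof (rule mapping_cone[OF res resJ])
    show "r \<in> monomial_ideal {t. t + m \<in> S} \<longleftrightarrow> r * xpow m \<in> monomial_ideal S" for r :: "'k R4"
      by (auto simp: monomial_ideal_def mons_mult_xpow)
    show "bihomogeneous (bidegree m) (xpow m)"
      by (simp add: bihomogeneous_single)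
    show "(monomial_ideal {t. t + m \<in> S} :: 'k R4 set) \<subseteq> max_homogeneous_ideal"
      using m by (force simp: monomial_ideal_def max_homogeneous_ideal_eq in_keys_iff subset_iff)
    show "\<delta> 2 = []"
      using short by (metis \<delta> count_list_0_iff list.set_intros(1) neq_Nil_conv)
    show "x \<noteq> bidegree m + y" if "x \<in> set (d u)" "y \<in> set (\<delta> u)" for u x y
      using disj[of u y] that by (auto simp: d \<delta> count_list_0_iff)
  qed
  moreover have "{p + r * xpow m |p r. p \<in> (monomial_ideal S :: 'k R4 set)} =
      monomial_ideal (S \<union> range (\<lambda>t. t + m))"
  proof (intro equalityI subsetI)
    fix q :: "'k R4" assume "q \<in> {p + r * xpow m |p r. p \<in> monomial_ideal S}"
    then obtain p r where q: "q = p + r * xpow m" "mons p \<subseteq> S" by (auto simp: monomial_ideal_def)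
    have "mons q \<subseteq> mons p \<union> mons (r * xpow m)" unfolding q(1) by (rule keys_add)
    then show "q \<in> monomial_ideal (S \<union> range (\<lambda>t. t + m))"
      using q(2) by (auto simp: monomial_ideal_def mons_mult_xpow)
  next
    fix q :: "'k R4" assume q: "q \<in> monomial_ideal (S \<union> range (\<lambda>t. t + m))"
    have "range (\<lambda>t. t + m) = range (plus m)" by (auto simp: add.commute)
    define p where "p = restrict_mons S q"
    define q' where "q' = restrict_mons (- S) q"
    have q': "mons q' \<subseteq> range (\<lambda>t. t + m)"
      using q by (auto simp: q'_def monomial_ideal_def)
    \<comment> \<open>All monomials of \<open>q\<close> outside \<open>S\<close> are multiples of
      \<open>xpow m\<close>, so the division is done term by term.\<close>
    define r where "r = (\<Sum>t\<in>mons q'. Poly_Mapping.single (t - m) (cf q' t))"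
    have "r * xpow m = (\<Sum>t\<in>mons q'. Poly_Mapping.single t (cf q' t))"
      unfolding r_def sum_distrib_right mult_single
      using q' by (intro sum.cong) (auto simp: add.commute)
    then have "q' = r * xpow m"
      using poly_eq_sum_monomials[of q'] by simp
    then have "q = p + r * xpow m"
      using restrict_mons_split[of q S] by (simp add: p_def q'_def)
    moreover have "p \<in> monomial_ideal S" by (simp add: p_def monomial_ideal_def)
    ultimately show "q \<in> {p + r * xpow m |p r. p \<in> monomial_ideal S}" by blast
  qed
  ultimately obtain A' where "minimal_bigraded_resolution (monomial_ideal (S \<union> range (\<lambda>t. t + m)) :: 'k R4 set)
    (\<lambda>u. d u @ (case u of 0 \<Rightarrow> [bidegree m] | Suc v \<Rightarrow> map ((+) (bidegree m)) (\<delta> v))) A'" by auto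
  then show ?thesis
    unfolding has_betti_def
    by (intro exI conjI) (auto simp: d \<delta> count_list_map_plus split: nat.split)
qed


section \<open>The generators of the fat points ideal\<close>

lemma UNIV_4: "(UNIV :: 4 set) = {0, 1, 2, 3}"
  by (rule sym, rule card_subset_eq) simp_all

lemma all_4: "(\<forall>i :: 4. P i) \<longleftrightarrow> P 0 \<and> P 1 \<and> P 2 \<and> P 3"
proof -
  have "(\<forall>i. P i) \<longleftrightarrow> (\<forall>i \<in> UNIV. P i)" by simp
  then show ?thesis unfolding UNIV_4 by simp
qed

definition expo :: "nat \<Rightarrow> nat \<Rightarrow> nat \<Rightarrow> nat \<Rightarrow> 4 \<Rightarrow>\<^sub>0 nat"
  where "expo a b c d = Poly_Mapping.single 0 a + Poly_Mapping.single 1 b +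
    Poly_Mapping.single 2 c + Poly_Mapping.single 3 d"

lemma cf_expo [simp]:
  "cf (expo a b c d) 0 = a" "cf (expo a b c d) 1 = b"
  "cf (expo a b c d) 2 = c" "cf (expo a b c d) 3 = d"
  by (simp_all add: expo_def lookup_add lookup_single when_def)

lemma bidegree_expo [simp]: "bidegree (expo a b c d) = (int (a + b), int (c + d))"
  by (simp add: bidegree_def)

lemma range_plus_expo:
  "range (\<lambda>t. t + m) = {t :: 4 \<Rightarrow>\<^sub>0 nat. cf m 0 \<le> cf t 0 \<and> cf m 1 \<le> cf t 1 \<and> cf m 2 \<le> cf t 2 \<and> cf m 3 \<le> cf t 3}"
proof (intro equalityI subsetI)
  fix t :: "4 \<Rightarrow>\<^sub>0 nat"
  assume "t \<in> {t. cf m 0 \<le> cf t 0 \<and> cf m 1 \<le> cf t 1 \<and> cf m 2 \<le> cf t 2 \<and> cf m 3 \<le> cf t 3}"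
  then have "\<forall>i. cf m i \<le> cf t i" by (simp add: all_4)
  then have "t = (t - m) + m"
    by (intro poly_mapping_eqI) (simp add: lookup_add lookup_minus)
  then show "t \<in> range (\<lambda>t. t + m)" by blast
qed (auto simp: lookup_add)

text \<open>The ideal is generated by \<open>x\<^sub>0\<close> if \<open>X\<close> holds and by \<open>x\<^sub>2\<close> if \<open>Y\<close> holds.\<close>

lemma has_betti_variables:
  "has_betti TYPE('k::field) {t. X \<and> 1 \<le> cf t 0 \<or> Y \<and> 1 \<le> cf t 2}
    (\<lambda>u x. if u = 0 then of_bool (X \<and> x = (1, 0)) + of_bool (Y \<and> x = (0, 1))
           else if u = 1 then of_bool (X \<and> Y \<and> x = (1, 1)) else 0)"
proof -
  have one: "has_betti TYPE('k) {t. 1 \<le> cf t i} (\<lambda>u x. if u = 0 then of_bool (x = bidegree (Poly_Mapping.single i 1)) else 0)"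
    for i :: 4
  proof -
    have eq: "range (\<lambda>t. t + Poly_Mapping.single i 1) = {t :: 4 \<Rightarrow>\<^sub>0 nat. 1 \<le> cf t i}"
    proof (intro equalityI subsetI)
      fix t :: "4 \<Rightarrow>\<^sub>0 nat" assume "t \<in> {t. 1 \<le> cf t i}"
      then have "t = (t - Poly_Mapping.single i 1) + Poly_Mapping.single i 1"
        by (intro poly_mapping_eqI) (auto simp: lookup_add lookup_minus lookup_single when_def)
      then show "t \<in> range (\<lambda>t. t + Poly_Mapping.single i 1)" by blast
    qed (auto simp: lookup_add)
    have "has_betti TYPE('k) {t. t + Poly_Mapping.single i 1 \<in> {}} (\<lambda>_ _. 0)"
      using has_betti_empty by simp
    from has_betti_insert[OF has_betti_empty this] show ?thesis
    proof (rule has_betti_cong)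
      show "{} \<union> range (\<lambda>t. t + Poly_Mapping.single i 1) = {t :: 4 \<Rightarrow>\<^sub>0 nat. 1 \<le> cf t i}"
        by (simp only: eq Un_empty_left)
      fix u :: nat and x
      show "0 + (case u of 0 \<Rightarrow> if x = bidegree (Poly_Mapping.single i 1) then 1 else 0 | Suc v \<Rightarrow> 0) =
          (if u = 0 then of_bool (x = bidegree (Poly_Mapping.single i 1)) else (0::nat))"
        by (cases u) simp_all
    qed auto
  qed
  have deg: "bidegree (Poly_Mapping.single 0 1) = (1, 0)" "bidegree (Poly_Mapping.single 2 1) = (0, 1)"
    by (simp_all add: bidegree_def lookup_single)
  have one0: "has_betti TYPE('k) {t. 1 \<le> cf t 0} (\<lambda>u x. if u = 0 then of_bool (x = (1, 0)) else 0)"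
    using one[of 0] unfolding deg .
  have one2: "has_betti TYPE('k) {t. 1 \<le> cf t 2} (\<lambda>u x. if u = 0 then of_bool (x = (0, 1)) else 0)"
    using one[of 2] unfolding deg .
  consider "\<not> X" "\<not> Y" | "X" "\<not> Y" | "\<not> X" "Y" | "X" "Y" by blast
  then show ?thesis
  proof cases
    case 1
    then show ?thesis by (intro has_betti_cong[OF has_betti_empty]) simp_all
  next
    case 2
    then show ?thesis by (intro has_betti_cong[OF one0]) simp_all
  next
    case 3
    then show ?thesis by (intro has_betti_cong[OF one2]) simp_all
  next
    case 4
    let ?m = "Poly_Mapping.single 2 1 :: 4 \<Rightarrow>\<^sub>0 nat"
    \<comment> \<open>The colon of \<open>(x\<^sub>0)\<close> by \<open>x\<^sub>2\<close> is
      \<open>(x\<^sub>0)\<close> again, so this cone is the Koszul complex on the two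
      variables.\<close>
    have "{t. t + ?m \<in> {t. 1 \<le> cf t 0}} = {t. 1 \<le> cf t 0}"
      by (simp add: lookup_add lookup_single)
    with one0 have colon: "has_betti TYPE('k) {t. t + ?m \<in> {t. 1 \<le> cf t 0}}
      (\<lambda>u x. if u = 0 then of_bool (x = (1, 0)) else 0)" by simp
    have "has_betti TYPE('k) ({t. 1 \<le> cf t 0} \<union> range (\<lambda>t. t + ?m))
      (\<lambda>u x. (if u = 0 then of_bool (x = (1, 0)) else 0) +
        (case u of 0 \<Rightarrow> if x = bidegree ?m then 1 else 0 |
          Suc v \<Rightarrow> if v = 0 then of_bool (x - bidegree ?m = (1, 0)) else 0))"
    proof (rule has_betti_insert[OF one0 colon])
      show "?m \<notin> {t. 1 \<le> cf t 0}" by (simp add: lookup_single)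
      show "(if u = 0 then of_bool (bidegree ?m + x = (1, 0)) else 0) = (0 :: nat)"
        if "(if u = 0 then of_bool (x = (1, 0)) else 0) \<noteq> (0 :: nat)" for u :: nat and x
        using that unfolding deg by (cases x) (simp split: if_splits)
    qed simp
    then show ?thesis
    proof (rule has_betti_cong)
      show "{t. 1 \<le> cf t 0} \<union> range (\<lambda>t. t + ?m) = {t. X \<and> 1 \<le> cf t 0 \<or> Y \<and> 1 \<le> cf t 2}"
        unfolding range_plus_expo using 4 by (auto simp: lookup_single)
      fix u :: nat and x :: "int \<times> int"
      show "(if u = 0 then of_bool (x = (1, 0)) else 0) +
        (case u of 0 \<Rightarrow> if x = bidegree ?m then 1 else 0 |
          Suc v \<Rightarrow> if v = 0 then of_bool (x - bidegree ?m = (1, 0)) else 0) =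
        (if u = 0 then of_bool (X \<and> x = (1, 0)) + of_bool (Y \<and> x = (0, 1))
          else if u = 1 then of_bool (X \<and> Y \<and> x = (1, 1)) else (0 :: nat))"
        unfolding deg using 4 by (cases u; cases x) simp_all
    qed
  qed
qed

section \<open>The index set of the minimal generators and its order\<close>

context
  fixes m11 m12 m21 :: nat
begin

text \<open>The pair \<open>(m12, corner)\<close> is the first generator in the order and the only
  one with zero colon ideal. The value exceeds \<open>m21\<close> exactly if
  \<open>m12 + m21 < m11\<close>; then it adds no point to \<open>gens\<close> beyond the line
  \<open>a + c = m11\<close>, but makes \<open>c < corner\<close> the correct test for
  \<open>x\<^sub>2\<close> in the colon ideal.\<close>

definition corner :: nat
  where "corner = max m21 (m11 - m12)"

text \<open>The monomial \<open>gen (a, c)\<close> is the only minimal generator whose exponents of \<open>x\<^sub>0\<close> and \<open>x\<^sub>2\<close>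
  are \<open>a\<close> and \<open>c\<close>.\<close>

definition gen :: "nat \<times> nat \<Rightarrow> 4 \<Rightarrow>\<^sub>0 nat"
  where "gen z = expo (fst z) (m21 - snd z) (snd z) (m12 - fst z)"

text \<open>For \<open>a \<le> m12\<close> lowering \<open>a\<close> costs a power of
  \<open>x\<^sub>3\<close>, and for \<open>c \<le> m21\<close> lowering \<open>c\<close> costs a
  power of \<open>x\<^sub>1\<close>. So every point of the box with \<open>a + c \<ge> m11\<close>
  is minimal, and outside the box only the points of the line \<open>a + c = m11\<close>
  are.\<close>

definition gens :: "(nat \<times> nat) set"
  where "gens = {(a, c). m11 \<le> a + c \<and> (a \<le> m12 \<and> c \<le> corner \<or> a + c = m11)}"

definition upset :: "(nat \<times> nat) set \<Rightarrow> (4 \<Rightarrow>\<^sub>0 nat) set"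
  where "upset P = (\<Union>z\<in>P. range (\<lambda>t. t + gen z))"

definition degr :: "nat \<times> nat \<Rightarrow> int \<times> int"
  where "degr z = bidegree (gen z)"

definition numbers :: "(nat \<times> nat) set \<Rightarrow> nat \<Rightarrow> int \<times> int \<Rightarrow> nat"
  where "numbers P u x =
    (if u = 0 then card {z \<in> P. degr z = x}
     else if u = 1 then card {z \<in> P. fst z < m12 \<and> degr z + (1, 0) = x} +
       card {z \<in> P. snd z < corner \<and> degr z + (0, 1) = x}
     else if u = 2 then card {z \<in> P. fst z < m12 \<and> snd z < corner \<and> degr z + (1, 1) = x}
     else 0)"

text \<open>Adding the generators in this order, every colon ideal is generated by a subset of
  \<open>{x\<^sub>0, x\<^sub>2}\<close>: the generators with \<open>a \<ge> m12\<close> come first, and then the columns of constant \<open>a\<close>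
  from right to left, each of them from top to bottom.\<close>

definition rank :: "nat \<times> nat \<Rightarrow> nat"
  where "rank z = (m12 - fst z) * (m11 + corner + 1) + (m11 + corner + 1 - snd z)"

lemma finite_gens: "finite gens"
proof (rule finite_subset)
  show "gens \<subseteq> {..m11 + m12} \<times> {..m11 + corner}" by (auto simp: gens_def)
qed simp

lemma degr_eq: "degr (a, c) = (int (a + (m21 - c)), int (c + (m12 - a)))"
  by (simp add: degr_def gen_def)

text \<open>Half of the colon computation: an earlier generator lies further right or higher up, so
  a multiple of \<open>gen (a, c)\<close> that it divides must gain a factor
  \<open>x\<^sub>0\<close> or \<open>x\<^sub>2\<close>, and only one that belongs to the claimed
  colon ideal.\<close>

lemma rank_le_gens:
  assumes z: "(a, c) \<in> gens" and z': "(a', c') \<in> gens" and ne: "(a', c') \<noteq> (a, c)"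
    and rank: "rank (a', c') \<le> rank (a, c)"
  shows "a < m12 \<and> a < a' \<or> c < corner \<and> c < c'"
proof -
  \<comment> \<open>\<open>K\<close> exceeds every second coordinate in \<open>gens\<close>, so
    \<open>rank\<close> is lexicographic. The truncated \<open>m12 - a\<close> merges all points
    with \<open>a \<ge> m12\<close> into one column.\<close>
  define K where "K = m11 + corner + 1"
  have c: "c < K" "c' < K" using z z' by (auto simp: gens_def K_def)
  have le: "(m12 - a') * K + (K - c') \<le> (m12 - a) * K + (K - c)"
    using rank by (simp add: rank_def K_def)
  have col: "m12 - a' \<le> m12 - a"
  proof (rule ccontr)
    assume "\<not> m12 - a' \<le> m12 - a"
    then have "Suc (m12 - a) * K \<le> (m12 - a') * K" by (intro mult_le_mono1) simp
    then show False using le c by simp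
  qed
  have same: "c \<le> c'" if "m12 - a' = m12 - a"
    using le that c by simp
  show ?thesis
  proof (cases "a < m12")
    case True
    with col have "a \<le> a'" by arith
    moreover have "c < corner \<and> c < c'" if "a' = a"
      using that same z z' ne by (auto simp: gens_def)
    ultimately show ?thesis using True by (cases "a' = a") auto
  next
    \<comment> \<open>In the merged column the points have distinct heights: a vertical segment at
      \<open>a = m12\<close>, continued downwards by the line \<open>a + c = m11\<close>.\<close>
    case False
    with col have "m12 \<le> a'" "m12 \<le> a" by arith+
    then show ?thesis using same z z' ne by (auto simp: gens_def corner_def)
  qed
qed

text \<open>On each of the four regions the truncated subtractions in \<open>degr\<close> become
  linear, which hands later degree comparisons to linear arithmetic.\<close>

lemma gens_cases:
  assumes "(a, c) \<in> gens"
  obtains (inner) "int a + int c \<ge> m11" "a \<le> m12" "c \<le> m21" "int m11 \<le> int m12 + int m21"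
      "degr (a, c) = (int a - int c + int m21, int c - int a + int m12)"
    | (middle) "int a + int c = m11" "a \<ge> m12" "c \<ge> m21" "degr (a, c) = (int a, int c)"
    | (right) "int a + int c = m11" "a > m12" "c < m21" "degr (a, c) = (int a - int c + int m21, int c)"
    | (left) "int a + int c = m11" "a < m12" "c > m21" "degr (a, c) = (int a, int c - int a + int m12)"
proof -
  have corner: "corner = m21 \<or> m21 < corner \<and> corner = m11 - m12" by (auto simp: corner_def)
  consider "a + c = m11" "a > m12" | "a + c = m11" "c > m21" "a < m12" | "a + c = m11" "a = m12" "c \<ge> m21"
    | "m11 \<le> a + c" "a \<le> m12" "c \<le> m21"
    using assms corner unfolding gens_def by force
  then show thesis
  proof cases
    case 1
    then show ?thesis using middle right by (cases "c < m21") (auto simp: degr_eq of_nat_diff)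
  next
    case 2
    then show ?thesis using left by (auto simp: degr_eq of_nat_diff)
  next
    case 3
    then show ?thesis using middle by (auto simp: degr_eq)
  next
    case 4
    then show ?thesis using inner by (auto simp: degr_eq of_nat_diff)
  qed
qed

text \<open>Excludes units in the cones: no generator sits in the degree of an
  \<open>x\<^sub>0\<close> syzygy. The bound \<open>a < m12\<close> leaves \<open>(a, c)\<close>
  only the pieces \<open>inner\<close> and \<open>left\<close>, and each pairing with a piece for
  \<open>(a', c')\<close> is linearly inconsistent.\<close>

lemma degr_neq_right:
  assumes "(a, c) \<in> gens" "(a', c') \<in> gens" "a < m12"
  shows "degr (a', c') \<noteq> degr (a, c) + (1, 0)"
  using assms(3)
  by (cases rule: gens_cases[OF assms(1)]; cases rule: gens_cases[OF assms(2)]) auto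

lemma degr_neq_up:
  assumes "(a, c) \<in> gens" "(a', c') \<in> gens" "c < corner"
  shows "degr (a', c') \<noteq> degr (a, c) + (0, 1)"
proof -
  \<comment> \<open>Both possible values of \<open>corner\<close> are covered, and each alternative
    excludes the piece \<open>left\<close> for \<open>(a, c)\<close>.\<close>
  have "c < m21 \<or> int c + int m12 < int m11" using assms(3) by (auto simp: corner_def)
  then show ?thesis
    by (cases rule: gens_cases[OF assms(1)]; cases rule: gens_cases[OF assms(2)]) auto
qed

lemma rank_lessI:
  assumes "m12 - a' < m12 - a \<or> m12 - a' \<le> m12 - a \<and> c < c'" "(a, c) \<in> gens"
  shows "rank (a', c') < rank (a, c)"
proof -
  define K where "K = m11 + corner + 1"
  have c: "c < K" using assms(2) by (auto simp: gens_def K_def)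
  from assms(1) have "(m12 - a') * K + (K - c') < (m12 - a) * K + (K - c)"
  proof
    assume "m12 - a' < m12 - a"
    then have "Suc (m12 - a') * K \<le> (m12 - a) * K" by (intro mult_le_mono1) simp
    then show ?thesis using c by simp
  next
    assume "m12 - a' \<le> m12 - a \<and> c < c'"
    moreover from this have "(m12 - a') * K \<le> (m12 - a) * K" by (intro mult_le_mono1) simp
    ultimately show ?thesis using c by linarith
  qed
  then show ?thesis by (simp add: rank_def K_def)
qed

text \<open>A step to the right trades \<open>x\<^sub>3\<close> for \<open>x\<^sub>0\<close>. Above
  \<open>corner\<close> this would leave \<open>gens\<close>, so the step also goes down by one,
  which is free of \<open>x\<^sub>1\<close> because \<open>m21 < c\<close>.\<close>

lemma gen_neighbour_right:
  assumes z: "(a, c) \<in> gens" and a: "a < m12"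
  obtains z' where "z' \<in> gens" "rank z' < rank (a, c)"
    "Poly_Mapping.single 0 1 + gen (a, c) \<in> range (\<lambda>t. t + gen z')"
proof (cases "c \<le> corner")
  case True
  have "rank (a + 1, c) < rank (a, c)" using a z by (intro rank_lessI) auto
  moreover have "(a + 1, c) \<in> gens" using True z a by (auto simp: gens_def)
  ultimately show ?thesis
    using a by (intro that[of "(a + 1, c)"]) (auto simp: range_plus_expo gen_def lookup_add lookup_single)
next
  case False
  then have c: "a + c = m11" "m21 < c" using z by (auto simp: gens_def corner_def)
  have "rank (a + 1, c - 1) < rank (a, c)" using a z by (intro rank_lessI) auto
  moreover have "(a + 1, c - 1) \<in> gens" using c z by (auto simp: gens_def)
  ultimately show ?thesis
    using a c by (intro that[of "(a + 1, c - 1)"]) (auto simp: range_plus_expo gen_def lookup_add lookup_single)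
qed

text \<open>A step up trades \<open>x\<^sub>1\<close> for \<open>x\<^sub>2\<close>, or keeps the
  absence of \<open>x\<^sub>1\<close>. Beyond column \<open>m12\<close> it also goes left along
  \<open>a + c = m11\<close>, where \<open>x\<^sub>3\<close> remains absent.\<close>

lemma gen_neighbour_up:
  assumes z: "(a, c) \<in> gens" and c: "c < corner"
  obtains z' where "z' \<in> gens" "rank z' < rank (a, c)"
    "Poly_Mapping.single 2 1 + gen (a, c) \<in> range (\<lambda>t. t + gen z')"
proof (cases "a \<le> m12")
  case True
  have "rank (a, c + 1) < rank (a, c)" using z by (intro rank_lessI) auto
  moreover have "(a, c + 1) \<in> gens" using True z c by (auto simp: gens_def)
  ultimately show ?thesis
    using c by (intro that[of "(a, c + 1)"]) (auto simp: range_plus_expo gen_def lookup_add lookup_single)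
next
  case False
  then have a: "a + c = m11" "m12 < a" using z by (auto simp: gens_def)
  have "rank (a - 1, c + 1) < rank (a, c)" using a z by (intro rank_lessI) auto
  moreover have "(a - 1, c + 1) \<in> gens" using a z by (auto simp: gens_def)
  ultimately show ?thesis
    using a by (intro that[of "(a - 1, c + 1)"]) (auto simp: range_plus_expo gen_def lookup_add lookup_single)
qed

text \<open>One inclusion needs that \<open>P\<close> contains nothing later than
  \<open>(a, c)\<close>, the other that its two neighbours are already in \<open>P\<close>.\<close>

lemma colon_upset:
  assumes z: "(a, c) \<in> gens" and P: "P \<subseteq> gens"
    and le: "\<And>z'. z' \<in> P \<Longrightarrow> z' \<noteq> (a, c) \<and> rank z' \<le> rank (a, c)"
    and closed: "\<And>z'. z' \<in> gens \<Longrightarrow> rank z' < rank (a, c) \<Longrightarrow> z' \<in> P"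
  shows "{t. t + gen (a, c) \<in> upset P} =
    {t. a < m12 \<and> 1 \<le> cf t 0 \<or> c < corner \<and> 1 \<le> cf t 2}"
proof (intro equalityI subsetI)
  fix t assume "t \<in> {t. t + gen (a, c) \<in> upset P}"
  then obtain a' c' where z': "(a', c') \<in> P" and t: "t + gen (a, c) \<in> range (\<lambda>t. t + gen (a', c'))"
    unfolding upset_def by fast
  have "a < m12 \<and> a < a' \<or> c < corner \<and> c < c'"
    using le[OF z'] P z' by (intro rank_le_gens[OF z]) auto
  then show "t \<in> {t. a < m12 \<and> 1 \<le> cf t 0 \<or> c < corner \<and> 1 \<le> cf t 2}"
    using t unfolding range_plus_expo by (auto simp: gen_def lookup_add)
next
  fix t :: "4 \<Rightarrow>\<^sub>0 nat" assume "t \<in> {t. a < m12 \<and> 1 \<le> cf t 0 \<or> c < corner \<and> 1 \<le> cf t 2}"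
  then have "\<exists>i. \<exists>z' \<in> P. 1 \<le> cf t i \<and>
    Poly_Mapping.single i 1 + gen (a, c) \<in> range (\<lambda>t. t + gen z')" (is "\<exists>i. ?Q i")
  proof (elim CollectE disjE conjE)
    assume "a < m12" and 1: "1 \<le> cf t 0"
    then obtain z' where "z' \<in> gens" "rank z' < rank (a, c)"
      "Poly_Mapping.single 0 1 + gen (a, c) \<in> range (\<lambda>t. t + gen z')"
      using gen_neighbour_right[OF z] by metis
    with closed 1 have "?Q 0" by metis
    then show ?thesis ..
  next
    assume "c < corner" and 1: "1 \<le> cf t 2"
    then obtain z' where "z' \<in> gens" "rank z' < rank (a, c)"
      "Poly_Mapping.single 2 1 + gen (a, c) \<in> range (\<lambda>t. t + gen z')"
      using gen_neighbour_up[OF z] by metis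
    with closed 1 have "?Q 2" by metis
    then show ?thesis ..
  qed
  then obtain i z' where i: "1 \<le> cf t i" and z': "z' \<in> P"
    and r: "Poly_Mapping.single i 1 + gen (a, c) \<in> range (\<lambda>t. t + gen z')" by blast
  have "t + gen (a, c) = (t - Poly_Mapping.single i 1) + (Poly_Mapping.single i 1 + gen (a, c))"
    using i by (intro poly_mapping_eqI) (auto simp: lookup_add lookup_minus lookup_single when_def)
  also have "\<dots> \<in> range (\<lambda>t. t + gen z')"
  proof -
    obtain t' where t': "Poly_Mapping.single i 1 + gen (a, c) = t' + gen z'" using r by blast
    show ?thesis unfolding t' by (simp add: add.assoc[symmetric])
  qed
  finally show "t \<in> {t. t + gen (a, c) \<in> upset P}"
    unfolding upset_def using z' by blast
qed

lemma card_insert_filter: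
  "finite P \<Longrightarrow> z \<notin> P \<Longrightarrow> card {w \<in> insert z P. Q w} = card {w \<in> P. Q w} + of_bool (Q z)"
proof -
  assume "finite P" "z \<notin> P"
  moreover have "{w \<in> insert z P. Q w} = (if Q z then insert z {w \<in> P. Q w} else {w \<in> P. Q w})"
    by auto
  ultimately show ?thesis by simp
qed

text \<open>Induction over the initial segments of the order. Closure under smaller rank survives
  removal of a last element and guarantees that the neighbours of each new generator are
  present.\<close>

lemma has_betti_upset:
  assumes "P \<subseteq> gens" "\<And>z z'. z \<in> P \<Longrightarrow> z' \<in> gens \<Longrightarrow> rank z' < rank z \<Longrightarrow> z' \<in> P"
  shows "has_betti TYPE('k::field) (upset P) (numbers P)"
proof -
  have "finite P" using assms(1) finite_gens by (rule finite_subset)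
  then show ?thesis using assms
  proof (induction P rule: finite_ranking_induct[where f = rank])
    case empty
    show ?case
      by (rule has_betti_cong[OF has_betti_empty]) (simp_all add: upset_def numbers_def)
  next
    case (insert z P)
    obtain a c where z: "z = (a, c)" by (cases z)
    show ?case
    proof (cases "z \<in> P")
      case True
      then show ?thesis using insert by (simp add: insert_absorb)
    next
      case False
      have zG: "(a, c) \<in> gens" and P: "P \<subseteq> gens" using insert.prems(1) z by auto
      have IH: "has_betti TYPE('k) (upset P) (numbers P)"
      proof (rule insert.IH[OF P])
        fix w w' assume w: "w \<in> P" "w' \<in> gens" "rank w' < rank w"
        then have "w' \<in> insert z P" using insert.prems(2) by blast
        moreover have "w' \<noteq> z" using w insert.hyps(2)[of w] by auto
        ultimately show "w' \<in> P" by simp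
      qed
      have colon: "{t. t + gen (a, c) \<in> upset P} =
          {t. a < m12 \<and> 1 \<le> cf t 0 \<or> c < corner \<and> 1 \<le> cf t 2}"
      proof (rule colon_upset[OF zG P])
        show "z' \<noteq> (a, c) \<and> rank z' \<le> rank (a, c)" if "z' \<in> P" for z'
          using that False insert.hyps(2) z by auto
        show "z' \<in> P" if "z' \<in> gens" "rank z' < rank (a, c)" for z'
          using insert.prems(2)[of z z'] that z by auto
      qed
      let ?c = "\<lambda>u x. if u = 0 then of_bool (a < m12 \<and> x = (1, 0)) + of_bool (c < corner \<and> x = (0, 1))
           else if u = 1 then of_bool ((a < m12) \<and> (c < corner) \<and> x = (1, 1)) else (0::nat)"
      have J: "has_betti TYPE('k) {t. t + gen (a, c) \<in> upset P} ?c"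
        unfolding colon by (rule has_betti_variables)
      have right: "degr w \<noteq> degr (a, c) + (1, 0)" if "a < m12" "w \<in> P" for w
        using degr_neq_right[OF zG _ that(1), of "fst w" "snd w"] P that(2) by auto
      have up: "degr w \<noteq> degr (a, c) + (0, 1)" if "c < corner" "w \<in> P" for w
        using degr_neq_up[OF zG _ that(1), of "fst w" "snd w"] P that(2) by auto
      have "has_betti TYPE('k) (upset P \<union> range (\<lambda>t. t + gen (a, c)))
        (\<lambda>u x. numbers P u x + (case u of 0 \<Rightarrow> if x = bidegree (gen (a, c)) then 1 else 0
          | Suc v \<Rightarrow> ?c v (x - bidegree (gen (a, c)))))"
      proof (rule has_betti_insert[OF IH J])
        show "gen (a, c) \<notin> upset P"
          using colon by (metis (no_types, lifting) add_0 lookup_zero mem_Collect_eq not_one_le_zero)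
        fix u :: nat and x :: "int \<times> int" assume x: "?c u x \<noteq> 0"
        show "numbers P u (bidegree (gen (a, c)) + x) = 0"
        proof (cases "u = 0")
          case True
          then have "{w \<in> P. degr w = degr (a, c) + x} = {}"
            using x right up by (auto split: if_splits)
          then show ?thesis
            by (simp only: numbers_def degr_def[symmetric] True if_True card.empty simp_thms)
        next
          case False
          then have u: "u = 1" "a < m12" "c < corner" "x = (1, 1)" using x by (auto split: if_splits)
          \<comment> \<open>A first syzygy of an earlier \<open>w\<close> in the degree of the new
            Koszul relation would put \<open>w\<close> itself one step away from the new generator,
            in the other variable.\<close>
          have "degr (a, c) + (1, 1) = (degr (a, c) + (0, 1)) + (1, 0)"
            "degr (a, c) + (1, 1) = (degr (a, c) + (1, 0)) + (0, 1)" by (simp_all add: prod_eq_iff)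
          then have "{w \<in> P. fst w < m12 \<and> degr w + (1, 0) = degr (a, c) + x} = {}"
            "{w \<in> P. snd w < corner \<and> degr w + (0, 1) = degr (a, c) + x} = {}"
            using u right up by (auto simp del: add_Pair)
          then show ?thesis
            by (simp only: numbers_def degr_def[symmetric] u(1) card.empty one_neq_zero
                if_False if_True simp_thms add_0)
        qed
      qed simp
      then show ?thesis
      proof (rule has_betti_cong)
        show "upset P \<union> range (\<lambda>t. t + gen (a, c)) = upset (insert z P)"
          by (auto simp: upset_def z)
        fix u :: nat and x :: "int \<times> int"
        have eq: "x - degr (a, c) = y \<longleftrightarrow> degr (a, c) + y = x" for y
          by (auto simp: algebra_simps)
        show "numbers P u x + (case u of 0 \<Rightarrow> if x = bidegree (gen (a, c)) then 1 else 0
          | Suc v \<Rightarrow> ?c v (x - bidegree (gen (a, c)))) = numbers (insert z P) u x"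
        proof -
          have nP: "(a, c) \<notin> P" using False z by simp
          note ins = card_insert_filter[OF insert.hyps(1) nP]
          consider "u = 0" | "u = Suc 0" | "u = Suc (Suc 0)" | v where "u = Suc (Suc (Suc v))"
            by (metis not0_implies_Suc)
          then show ?thesis
            unfolding z degr_def[symmetric]
            by cases (simp_all add: numbers_def ins eq eq_commute[of x] del: insert_iff)
        qed
      qed
    qed
  qed
qed

text \<open>The generator dividing a given monomial is found by clipping its exponents
  \<open>(a, c)\<close> down to \<open>gens\<close> while keeping \<open>m21 - c\<close> and
  \<open>m12 - a\<close>, so that no further power of \<open>x\<^sub>1\<close> or
  \<open>x\<^sub>3\<close> is required.\<close>

lemma upset_gens:
  "upset gens = {t. m11 \<le> cf t 0 + cf t 2 \<and> m12 \<le> cf t 0 + cf t 3 \<and> m21 \<le> cf t 1 + cf t 2}"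
proof (intro equalityI subsetI)
  fix t assume "t \<in> upset gens"
  then show "t \<in> {t. m11 \<le> cf t 0 + cf t 2 \<and> m12 \<le> cf t 0 + cf t 3 \<and> m21 \<le> cf t 1 + cf t 2}"
    by (auto simp: upset_def gens_def gen_def lookup_add)
next
  fix t :: "4 \<Rightarrow>\<^sub>0 nat"
  assume t: "t \<in> {t. m11 \<le> cf t 0 + cf t 2 \<and> m12 \<le> cf t 0 + cf t 3 \<and> m21 \<le> cf t 1 + cf t 2}"
  define a c where "a = cf t 0" and "c = cf t 2"
  have ac: "m11 \<le> a + c" using t by (simp add: a_def c_def)
  have corner: "m21 \<le> corner" "m11 \<le> m12 + corner" by (auto simp: corner_def)
  have "\<exists>a' c'. (a', c') \<in> gens \<and> a' \<le> a \<and> c' \<le> c \<and> m21 - c' = m21 - c \<and> m12 - a' = m12 - a"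
  proof -
    consider "a \<le> m12" "c \<le> corner"
      | "a \<le> m12" "corner < c" "m11 \<le> a + corner" | "a \<le> m12" "corner < c" "a + corner < m11"
      | "m12 < a" "corner < c" | "m12 < a" "c \<le> corner" "m11 \<le> m12 + c"
      | "m12 < a" "c \<le> corner" "m12 + c < m11"
      by linarith
    then show ?thesis
    proof cases
      case 1
      then show ?thesis using ac by (intro exI[of _ a] exI[of _ c]) (simp add: gens_def)
    next
      case 2
      then show ?thesis using corner by (intro exI[of _ a] exI[of _ corner]) (simp add: gens_def)
    next
      case 3
      then show ?thesis using ac corner by (intro exI[of _ a] exI[of _ "m11 - a"]) (simp add: gens_def)
    next
      case 4
      then show ?thesis using corner by (intro exI[of _ m12] exI[of _ corner]) (simp add: gens_def)
    next
      case 5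
      then show ?thesis using corner by (intro exI[of _ m12] exI[of _ c]) (simp add: gens_def)
    next
      case 6
      then show ?thesis using ac by (intro exI[of _ "m11 - c"] exI[of _ c]) (simp add: gens_def)
    qed
  qed
  then obtain a' c' where "(a', c') \<in> gens" "a' \<le> a" "c' \<le> c" "m21 - c' = m21 - c" "m12 - a' = m12 - a"
    by blast
  then show "t \<in> upset gens"
    using t by (auto simp: upset_def range_plus_expo gen_def a_def c_def intro!: bexI[of _ "(a', c')"])
qed

lemma has_betti_gens:
  "has_betti TYPE('k::field)
    {t. m11 \<le> cf t 0 + cf t 2 \<and> m12 \<le> cf t 0 + cf t 3 \<and> m21 \<le> cf t 1 + cf t 2} (numbers gens)"
  using has_betti_upset[of gens] by (simp add: upset_gens)

end


section \<open>Linear changes of coordinates\<close>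

lemma Const_add: "Const (c + d) = Const c + Const d"
  by (simp add: Const_def single_add)

lemma Const_mult: "Const (c * d) = Const c * Const d"
  by (simp add: Const_def mult_single)

lemma Const_zero [simp]: "Const 0 = 0"
  by (simp add: Const_def)

lemma Const_one [simp]: "Const 1 = 1"
  by (simp add: Const_def)

lemma bihomogeneous_Const: "bihomogeneous 0 (Const c)"
  by (simp add: Const_def bihomogeneous_single)

definition monomial_subst :: "(4 \<Rightarrow> 'k::field R4) \<Rightarrow> (4 \<Rightarrow>\<^sub>0 nat) \<Rightarrow> 'k R4"
  where "monomial_subst L m = (\<Prod>i\<in>UNIV. L i ^ cf m i)"

definition subst :: "(4 \<Rightarrow> 'k::field R4) \<Rightarrow> 'k R4 \<Rightarrow> 'k R4"
  where "subst L p = (\<Sum>m\<in>mons p. Const (cf p m) * monomial_subst L m)"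

lemma monomial_subst_add: "monomial_subst L (m + n) = monomial_subst L m * monomial_subst L n"
  by (simp add: monomial_subst_def lookup_add power_add prod.distrib)

lemma monomial_subst_zero [simp]: "monomial_subst L 0 = 1"
  by (simp add: monomial_subst_def)

lemma subst_superset:
  "finite M \<Longrightarrow> mons p \<subseteq> M \<Longrightarrow> subst L p = (\<Sum>m\<in>M. Const (cf p m) * monomial_subst L m)"
  unfolding subst_def by (rule sum.mono_neutral_left) (auto simp: in_keys_iff)

lemma subst_single: "subst L (Poly_Mapping.single m c) = Const c * monomial_subst L m"
  by (subst subst_superset[of "{m}"]) auto

lemma subst_add: "subst L (p + q) = subst L p + subst L q"
proof -
  let ?M = "mons p \<union> mons q"
  have M: "finite ?M" "mons p \<subseteq> ?M" "mons q \<subseteq> ?M" "mons (p + q) \<subseteq> ?M"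
    using keys_add[of p q] by auto
  show ?thesis
    unfolding subst_superset[OF M(1,2)] subst_superset[OF M(1,3)] subst_superset[OF M(1,4)]
    by (simp add: lookup_add Const_add distrib_right sum.distrib)
qed

lemma subst_zero [simp]: "subst L 0 = 0"
  by (simp add: subst_def)

lemma subst_sum: "subst L (sum f X) = (\<Sum>x\<in>X. subst L (f x))"
  by (induction X rule: infinite_finite_induct) (auto simp: subst_add)

lemma subst_mult: "subst L (p * q) = subst L p * subst L q"
proof -
  have "p * q = (\<Sum>m\<in>mons p. Poly_Mapping.single m (cf p m)) * (\<Sum>n\<in>mons q. Poly_Mapping.single n (cf q n))"
    by (simp only: poly_eq_sum_monomials[symmetric])
  also have "\<dots> = (\<Sum>m\<in>mons p. \<Sum>n\<in>mons q. Poly_Mapping.single (m + n) (cf p m * cf q n))"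
    by (simp add: sum_product mult_single)
  also have "subst L \<dots> = (\<Sum>m\<in>mons p. \<Sum>n\<in>mons q.
      (Const (cf p m) * monomial_subst L m) * (Const (cf q n) * monomial_subst L n))"
    by (simp add: subst_sum subst_single Const_mult monomial_subst_add mult_ac)
  also have "\<dots> = subst L p * subst L q"
    by (simp add: subst_def sum_product)
  finally show ?thesis .
qed

lemma subst_Const [simp]: "subst L (Const c) = Const c"
  by (simp add: Const_def subst_single)

lemma subst_one [simp]: "subst L 1 = 1"
  using subst_Const[of L 1] by simp

lemma subst_Var [simp]: "subst L (Var i) = L i"
proof -
  have "monomial_subst L (Poly_Mapping.single i 1) = (\<Prod>j\<in>UNIV. if j = i then L j else 1)"
    unfolding monomial_subst_def by (rule prod.cong) (auto simp: lookup_single when_def)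
  then show ?thesis by (simp add: Var_def subst_single)
qed

lemma subst_power: "subst L (p ^ n) = subst L p ^ n"
  by (induction n) (auto simp: subst_mult)

lemma subst_prod: "subst L (prod f X) = (\<Prod>x\<in>X. subst L (f x))"
  by (induction X rule: infinite_finite_induct) (auto simp: subst_mult)

lemma subst_subst: "subst L (subst M p) = subst (\<lambda>i. subst L (M i)) p"
proof -
  have "subst L (monomial_subst M m) = monomial_subst (\<lambda>i. subst L (M i)) m" for m
    by (simp add: monomial_subst_def subst_prod subst_power)
  then show ?thesis
    by (simp add: subst_def[of M] subst_def[of "\<lambda>i. subst L (M i)"] subst_sum subst_mult)
qed

lemma subst_Var_id: "subst Var p = p" for p :: "'k::field R4"
proof -
  have pow: "Var i ^ k = (xpow (Poly_Mapping.single i k) :: 'k R4)" for i k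
  proof (induction k)
    case (Suc k)
    then show ?case by (simp add: Var_def mult_single flip: single_add)
  qed simp
  have prod: "(\<Prod>i\<in>X. xpow (f i)) = (xpow (\<Sum>i\<in>X. f i) :: 'k R4)" for X :: "4 set" and f
    by (induction X rule: infinite_finite_induct) (auto simp: mult_single)
  have "(\<Sum>i\<in>UNIV. Poly_Mapping.single i (cf m i)) = m" for m :: "4 \<Rightarrow>\<^sub>0 nat"
    by (rule poly_mapping_eqI) (simp add: lookup_sum lookup_single when_def)
  then have "monomial_subst Var m = (xpow m :: 'k R4)" for m
    by (simp add: monomial_subst_def pow prod)
  then show ?thesis
    using poly_eq_sum_monomials[of p] by (simp add: subst_def Const_def mult_single)
qed

lemma bihomogeneous_power: "bihomogeneous d p \<Longrightarrow> bihomogeneous (int n * fst d, int n * snd d) (p ^ n)"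
proof (induction n)
  case 0
  then show ?case using bihomogeneous_one by (simp add: zero_prod_def)
next
  case (Suc n)
  then have "bihomogeneous (d + (int n * fst d, int n * snd d)) (p * p ^ n)"
    by (intro bihomogeneous_mult) auto
  then show ?case by (simp add: algebra_simps plus_prod_def)
qed

text \<open>A substitution is determined by the images of the variables, so checking both composites
  there makes \<open>subst L\<close> bijective. As it is also graded, it carries resolutions to
  resolutions with the same degree lists.\<close>

locale graded_automorphism =
  fixes L M :: "4 \<Rightarrow> 'k::field R4"
  assumes right_inverse: "\<And>i. subst L (M i) = Var i" and left_inverse: "\<And>i. subst M (L i) = Var i"
    and degree: "\<And>i. bihomogeneous (bidegree (Poly_Mapping.single i 1)) (L i)"
begin

lemma inverse: "subst L (subst M p) = p" "subst M (subst L p) = p"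
  using right_inverse left_inverse by (simp_all add: subst_subst subst_Var_id)

lemma inj: "inj (subst L)"
  by (rule inj_on_inverseI[of _ "subst M"]) (rule inverse)

lemma surj: "surj (subst L)"
  by (rule surjI) (rule inverse)

lemma subst_eq_iff: "subst L p = subst L q \<longleftrightarrow> p = q"
  using inj by (auto dest: injD)

lemma bihomogeneous_monomial_subst: "bihomogeneous (bidegree m) (monomial_subst L m)"
proof -
  have hom: "bihomogeneous (\<Sum>i\<in>X. bidegree (Poly_Mapping.single i (cf m i))) (\<Prod>i\<in>X. L i ^ cf m i)"
    for X
  proof (induction X rule: infinite_finite_induct)
    case (insert i X)
    have "bidegree (Poly_Mapping.single i k) =
        (int k * fst (bidegree (Poly_Mapping.single i 1)), int k * snd (bidegree (Poly_Mapping.single i 1)))" for k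
      by (simp add: bidegree_def lookup_single when_def)
    then have "bihomogeneous (bidegree (Poly_Mapping.single i (cf m i))) (L i ^ cf m i)"
      using bihomogeneous_power[OF degree] by metis
    then show ?case using insert by (auto intro: bihomogeneous_mult)
  qed (auto intro: bihomogeneous_one)
  have sum: "(\<Sum>i\<in>X. bidegree (f i)) = bidegree (\<Sum>i\<in>X. f i)" for X :: "4 set" and f
    by (induction X rule: infinite_finite_induct) (auto simp: bidegree_add)
  have "(\<Sum>i\<in>UNIV. Poly_Mapping.single i (cf m i)) = m"
    by (rule poly_mapping_eqI) (simp add: lookup_sum lookup_single when_def)
  with hom[of UNIV] show ?thesis by (simp only: sum monomial_subst_def)
qed

lemma bihomogeneous_subst:
  assumes "bihomogeneous d p"
  shows "bihomogeneous d (subst L p)"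
  unfolding subst_def
proof (rule bihomogeneous_sum)
  fix m assume "m \<in> mons p"
  then have "bidegree m = d" using assms by (simp add: bihomogeneous_def)
  then show "bihomogeneous d (Const (cf p m) * monomial_subst L m)"
    using bihomogeneous_mult[OF bihomogeneous_Const[of "cf p m"] bihomogeneous_monomial_subst[of m]] by simp
qed

text \<open>A monomial other than 1 has nonzero bidegree, and so has its image; hence no new
  constant terms arise and minimality is preserved.\<close>

lemma constant_term_subst: "cf (subst L p) 0 = cf p 0"
proof -
  have deg0: "m = 0" if "bidegree m = 0" for m :: "4 \<Rightarrow>\<^sub>0 nat"
  proof -
    have "cf m i = 0" for i
    proof -
      have "i \<in> {0, 1, 2, 3}"
        using card_subset_eq[of UNIV "{0, 1, 2, 3 :: 4}"] by auto
      then show ?thesis using that by (auto simp: bidegree_def zero_prod_def)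
    qed
    then show ?thesis by (intro poly_mapping_eqI) simp
  qed
  have "cf (monomial_subst L m) 0 = (1 when m = 0)" for m
  proof (cases "m = 0")
    case False
    then show ?thesis
      using bihomogeneous_constant_term[OF bihomogeneous_monomial_subst] deg0 by auto
  qed simp
  then have "cf (subst L p) 0 = (\<Sum>m\<in>mons p. cf p m * (1 when m = 0))"
    by (simp add: subst_def lookup_sum cf_mult_zero Const_def)
  also have "\<dots> = (\<Sum>m\<in>mons p. if m = 0 then cf p 0 else 0)"
    by (rule sum.cong) (auto simp: when_def)
  also have "\<dots> = cf p 0" by (simp add: sum.delta' in_keys_iff)
  finally show ?thesis .
qed

sublocale comm_ring_hom "subst L"
  by unfold_locales (simp_all add: subst_add subst_mult)

lemma map_vec_inverse: "v \<in> carrier_vec n \<Longrightarrow> map_vec (subst L) (map_vec (subst M) v) = v"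
  by (intro eq_vecI) (auto simp: inverse)

lemma mat_range_map: "mat_range (map_mat (subst L) A) = map_vec (subst L) ` mat_range A"
proof (intro equalityI subsetI)
  fix x assume "x \<in> mat_range (map_mat (subst L) A)"
  then obtain v where v: "v \<in> carrier_vec (dim_col A)" "x = map_mat (subst L) A *\<^sub>v v"
    by (auto simp: mat_range_def)
  let ?w = "map_vec (subst M) v"
  have "x = map_vec (subst L) (A *\<^sub>v ?w)"
    using v mult_mat_vec_hom[of A "dim_row A" "dim_col A" ?w] by (simp add: map_vec_inverse)
  then show "x \<in> map_vec (subst L) ` mat_range A"
    using v by (auto intro!: imageI mat_rangeI)
next
  fix x assume "x \<in> map_vec (subst L) ` mat_range A"
  then obtain v where v: "v \<in> carrier_vec (dim_col A)" "x = map_vec (subst L) (A *\<^sub>v v)"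
    by (auto simp: mat_range_def)
  then have "x = map_mat (subst L) A *\<^sub>v map_vec (subst L) v"
    using mult_mat_vec_hom[of A "dim_row A" "dim_col A" v] by simp
  then show "x \<in> mat_range (map_mat (subst L) A)"
    using v by (auto simp: mat_range_def)
qed

lemma map_vec_eq_zero_iff: "v \<in> carrier_vec n \<Longrightarrow> map_vec (subst L) v = 0\<^sub>v n \<longleftrightarrow> v = 0\<^sub>v n"
  using subst_eq_iff[of _ 0] by (auto simp: vec_eq_iff)

lemma mat_kernel_map: "mat_kernel (map_mat (subst L) A) = map_vec (subst L) ` mat_kernel A"
proof (intro equalityI subsetI)
  fix x assume "x \<in> mat_kernel (map_mat (subst L) A)"
  then have x: "x \<in> carrier_vec (dim_col A)" "map_mat (subst L) A *\<^sub>v x = 0\<^sub>v (dim_row A)"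
    by (auto simp: mat_kernel_def)
  let ?w = "map_vec (subst M) x"
  have "map_vec (subst L) (A *\<^sub>v ?w) = 0\<^sub>v (dim_row A)"
    using x mult_mat_vec_hom[of A "dim_row A" "dim_col A" ?w] by (simp add: map_vec_inverse)
  then have "A *\<^sub>v ?w = 0\<^sub>v (dim_row A)"
    using x by (subst (asm) map_vec_eq_zero_iff) (auto intro: mult_mat_vec_carrier[of _ _ "dim_col A"])
  then have "?w \<in> mat_kernel A" using x by (auto simp: mat_kernel_def)
  then show "x \<in> map_vec (subst L) ` mat_kernel A"
    by (intro image_eqI[of _ "map_vec (subst L)" ?w]) (simp_all only: map_vec_inverse[OF x(1)])
next
  fix x assume "x \<in> map_vec (subst L) ` mat_kernel A"
  then obtain v where v: "v \<in> carrier_vec (dim_col A)" "A *\<^sub>v v = 0\<^sub>v (dim_row A)" "x = map_vec (subst L) v"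
    by (auto simp: mat_kernel_def)
  then have "map_mat (subst L) A *\<^sub>v x = map_vec (subst L) (0\<^sub>v (dim_row A))"
    using mult_mat_vec_hom[of A "dim_row A" "dim_col A" v] by simp
  also have "\<dots> = 0\<^sub>v (dim_row A)" by (subst map_vec_eq_zero_iff) auto
  finally show "x \<in> mat_kernel (map_mat (subst L) A)"
    using v by (auto simp: mat_kernel_def)
qed

lemma minimal_bigraded_resolution_subst:
  assumes "minimal_bigraded_resolution I d A"
  shows "minimal_bigraded_resolution (subst L ` I) d (\<lambda>u. map_mat (subst L) (A u))"
proof -
  note D = minimal_bigraded_resolutionD[OF assms]
  have bg: "bigraded_map d e (map_mat (subst L) A)" if "bigraded_map d e A" for d e A
    using that by (auto simp: bigraded_map_def bihomogeneous_subst)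
  have "map_vec (subst L) ` {v \<in> carrier_vec 1. v $ 0 \<in> I} = {v \<in> carrier_vec 1. v $ 0 \<in> subst L ` I}"
  proof (intro equalityI subsetI)
    fix v assume "v \<in> {v \<in> carrier_vec 1. v $ 0 \<in> subst L ` I}"
    then have v: "v \<in> carrier_vec 1" "subst M (v $ 0) \<in> I" by (auto simp: inverse)
    then have "map_vec (subst M) v \<in> {v \<in> carrier_vec 1. v $ 0 \<in> I}" by auto
    then show "v \<in> map_vec (subst L) ` {v \<in> carrier_vec 1. v $ 0 \<in> I}"
      by (intro image_eqI[of _ "map_vec (subst L)" "map_vec (subst M) v"]) (simp_all only: map_vec_inverse[OF v(1)])
  qed auto
  then show ?thesis
    unfolding minimal_bigraded_resolution_def elements_mat_max_homogeneous_ideal_iff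
    using D(1,6) by (auto intro!: bg D(2,3) simp: mat_range_map mat_kernel_map D(4,5)
      zero_constant_terms_def constant_term_subst)
qed

lemma subst_ideal_span: "subst L ` ideal_span S = ideal_span (subst L ` S)"
proof (intro equalityI subsetI)
  fix x assume "x \<in> subst L ` ideal_span S"
  then obtain a where a: "a \<in> ideal_span S" "x = subst L a" by auto
  from a(1) have "subst L a \<in> ideal_span (subst L ` S)"
  proof (induction rule: ideal_span_induct)
    case (add r s a)
    then show ?case
      by (simp add: subst_add subst_mult ideal_span_add ideal_span_mult ideal_span_base)
  qed (simp add: ideal_span_zero)
  then show "x \<in> ideal_span (subst L ` S)" using a by simp
next
  fix x assume "x \<in> ideal_span (subst L ` S)"
  then have "subst M x \<in> ideal_span S"
  proof (induction rule: ideal_span_induct)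
    case (add r s a)
    then obtain s' where "s' \<in> S" "s = subst L s'" by auto
    with add show ?case
      by (simp add: subst_add subst_mult inverse ideal_span_add ideal_span_mult ideal_span_base)
  qed (simp add: ideal_span_zero)
  then show "x \<in> subst L ` ideal_span S"
    by (intro image_eqI[of _ "subst L" "subst M x"]) (simp_all add: inverse)
qed

lemma subst_ideal_times: "subst L ` ideal_times I J = ideal_times (subst L ` I) (subst L ` J)"
proof -
  have "subst L ` {a * b |a b. a \<in> I \<and> b \<in> J} = {a * b |a b. a \<in> subst L ` I \<and> b \<in> subst L ` J}"
  proof (intro equalityI subsetI)
    fix x assume "x \<in> {a * b |a b. a \<in> subst L ` I \<and> b \<in> subst L ` J}"
    then obtain a b where "a \<in> I" "b \<in> J" "x = subst L (a * b)" by (auto simp: subst_mult)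
    then show "x \<in> subst L ` {a * b |a b. a \<in> I \<and> b \<in> J}" by blast
  next
    fix x assume "x \<in> subst L ` {a * b |a b. a \<in> I \<and> b \<in> J}"
    then obtain a b where "a \<in> I" "b \<in> J" "x = subst L a * subst L b" by (auto simp: subst_mult)
    then show "x \<in> {a * b |a b. a \<in> subst L ` I \<and> b \<in> subst L ` J}" by blast
  qed
  then show ?thesis by (simp add: ideal_times_def subst_ideal_span)
qed

lemma subst_ideal_power: "subst L ` ideal_power I n = ideal_power (subst L ` I) n"
  using surj by (induction n) (auto simp: subst_ideal_times)

lemma subst_point_ideal: "subst L ` point_ideal p q = point_ideal (subst L p) (subst L q)"
  by (simp add: point_ideal_def subst_ideal_span)

lemma subst_fat_points_ideal:
  "subst L ` fat_points_ideal (Var 0) (Var 1) (Var 2) (Var 3) m11 m12 m21 =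
    fat_points_ideal (L 0) (L 1) (L 2) (L 3) m11 m12 m21"
  by (simp add: fat_points_ideal_def image_Int[OF inj] subst_ideal_power subst_point_ideal)

end

section \<open>Point ideals in coordinates and the choice of coordinates\<close>

lemma monomial_ideal_mult:
  assumes "q \<in> monomial_ideal S" "\<And>s t. s \<in> S \<Longrightarrow> t + s \<in> S"
  shows "p * q \<in> monomial_ideal S"
  using keys_mult[of p q] assms by (force simp: monomial_ideal_def)

lemma monomial_ideal_add:
  "p \<in> monomial_ideal S \<Longrightarrow> q \<in> monomial_ideal S \<Longrightarrow> p + q \<in> monomial_ideal S"
  using keys_add[of p q] by (auto simp: monomial_ideal_def)

lemma ideal_span_subset_monomial_ideal:
  assumes "X \<subseteq> monomial_ideal S" "\<And>s t. s \<in> S \<Longrightarrow> t + s \<in> S"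
  shows "ideal_span X \<subseteq> monomial_ideal S"
proof
  fix x assume "x \<in> ideal_span X"
  then show "x \<in> monomial_ideal S"
  proof (induction rule: ideal_span_induct)
    case zero
    show ?case by (simp add: monomial_ideal_def)
  next
    case (add r s a)
    then show ?case using assms by (intro monomial_ideal_add monomial_ideal_mult) auto
  qed
qed

text \<open>Induction by splitting one of the two variables off each monomial; the other inclusion
  is additivity of exponents.\<close>

lemma ideal_power_point_ideal_Var:
  assumes "i \<noteq> j"
  shows "ideal_power (point_ideal (Var i) (Var j) :: 'k::field R4 set) n =
    monomial_ideal {t. n \<le> cf t i + cf t j}"
proof (induction n)
  case 0
  show ?case by (simp add: monomial_ideal_def)
next
  case (Suc n)
  let ?P = "point_ideal (Var i) (Var j) :: 'k R4 set"
  have "?P \<subseteq> monomial_ideal {t. 1 \<le> cf t i + cf t j}"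
    unfolding point_ideal_def
    by (rule ideal_span_subset_monomial_ideal)
       (auto simp: monomial_ideal_def Var_def lookup_add lookup_single)
  moreover have "a * b \<in> monomial_ideal {t. Suc n \<le> cf t i + cf t j}"
    if "a \<in> monomial_ideal {t. 1 \<le> cf t i + cf t j}" "b \<in> monomial_ideal {t. n \<le> cf t i + cf t j}"
    for a b :: "'k R4"
    using that keys_mult[of a b] by (fastforce simp: monomial_ideal_def lookup_add subset_iff)
  ultimately have "ideal_times ?P (monomial_ideal {t. n \<le> cf t i + cf t j}) \<subseteq>
      monomial_ideal {t. Suc n \<le> cf t i + cf t j}"
    unfolding ideal_times_def
    by (intro ideal_span_subset_monomial_ideal) (auto simp: lookup_add)
  moreover have "monomial_ideal {t. Suc n \<le> cf t i + cf t j} \<subseteq>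
      ideal_times ?P (monomial_ideal {t. n \<le> cf t i + cf t j})"
  proof
    fix p :: "'k R4" assume p: "p \<in> monomial_ideal {t. Suc n \<le> cf t i + cf t j}"
    have "Poly_Mapping.single t (cf p t) \<in> ideal_times ?P (monomial_ideal {t. n \<le> cf t i + cf t j})"
      if "t \<in> mons p" for t
    proof -
      have "Suc n \<le> cf t i + cf t j" using that p by (auto simp: monomial_ideal_def)
      then have "1 \<le> cf t i \<or> 1 \<le> cf t j" by linarith
      then obtain l where l: "l \<in> {i, j}" "1 \<le> cf t l" by blast
      define s where "s = t - Poly_Mapping.single l 1"
      have ts: "t = Poly_Mapping.single l 1 + s"
        unfolding s_def using l
        by (intro poly_mapping_eqI) (auto simp: lookup_add lookup_minus lookup_single when_def)
      then have "Poly_Mapping.single t (cf p t) = Var l * Poly_Mapping.single s (cf p t)"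
        by (simp add: Var_def mult_single)
      moreover have "Var l \<in> ?P"
        using l unfolding point_ideal_def by (auto intro!: ideal_span_base)
      moreover have "Suc n \<le> cf (Poly_Mapping.single l 1 + s) i + cf (Poly_Mapping.single l 1 + s) j"
        using \<open>Suc n \<le> cf t i + cf t j\<close> unfolding ts .
      then have "n \<le> cf s i + cf s j"
        using l assms by (auto simp: lookup_add lookup_single when_def split: if_splits)
      then have "Poly_Mapping.single s (cf p t) \<in> monomial_ideal {t. n \<le> cf t i + cf t j}"
        by (simp add: monomial_ideal_def)
      ultimately show ?thesis
        unfolding ideal_times_def by (intro ideal_span_base) blast
    qed
    then have "(\<Sum>t\<in>mons p. Poly_Mapping.single t (cf p t)) \<in>
        ideal_times ?P (monomial_ideal {t. n \<le> cf t i + cf t j})"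
      unfolding ideal_times_def by (intro ideal_span_sum)
    then show "p \<in> ideal_times ?P (monomial_ideal {t. n \<le> cf t i + cf t j})"
      by (simp only: poly_eq_sum_monomials[symmetric])
  qed
  ultimately show ?case using Suc by simp
qed

lemma fat_points_ideal_Var:
  "fat_points_ideal (Var 0) (Var 1) (Var 2) (Var 3) m11 m12 m21 =
    monomial_ideal {t. m11 \<le> cf t 0 + cf t 2 \<and> m12 \<le> cf t 0 + cf t 3 \<and> m21 \<le> cf t 1 + cf t 2}"
  unfolding fat_points_ideal_def by (subst ideal_power_point_ideal_Var, simp)+ (auto simp: monomial_ideal_def)

text \<open>Forms of this degree involve two variables only, so nonproportionality means that a 2 by
  2 determinant is nonzero, and the inverse is the adjugate divided by it. The last two equations
  state the inverse in the opposite order of composition.\<close>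

lemma linear_forms_inverse:
  fixes F G :: "'k::field R4"
  assumes np: "nonproportional_forms d F G"
    and mons: "\<And>m. bidegree m = d \<Longrightarrow> m = Poly_Mapping.single i 1 \<or> m = Poly_Mapping.single j 1"
    and ij: "i \<noteq> j"
  obtains a b c e a' b' c' e' where
    "F = Const a * Var i + Const b * Var j" "G = Const c * Var i + Const e * Var j"
    "Const a' * F + Const b' * G = Var i" "Const c' * F + Const e' * G = Var j"
    "Const a * (Const a' * Var i + Const b' * Var j) + Const b * (Const c' * Var i + Const e' * Var j) = Var i"
    "Const c * (Const a' * Var i + Const b' * Var j) + Const e * (Const c' * Var i + Const e' * Var j) = Var j"
proof -
  let ?i = "Poly_Mapping.single i (1::nat)" and ?j = "Poly_Mapping.single j (1::nat)"
  have neq: "?i \<noteq> ?j" using ij by (metis lookup_single_eq lookup_single_not_eq zero_neq_one)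
  have expand: "p = Const (cf p ?i) * Var i + Const (cf p ?j) * Var j" if "bihomogeneous d p" for p :: "'k R4"
  proof -
    have sub: "mons p \<subseteq> {?i, ?j}" using that mons by (auto simp: bihomogeneous_def)
    have "p = (\<Sum>m\<in>mons p. Poly_Mapping.single m (cf p m))" by (rule poly_eq_sum_monomials)
    also have "\<dots> = (\<Sum>m\<in>{?i, ?j}. Poly_Mapping.single m (cf p m))"
      using sub by (intro sum.mono_neutral_left) (auto simp: in_keys_iff)
    finally show ?thesis using neq by (simp add: Const_def Var_def mult_single)
  qed
  define a b c e where abce: "a = cf F ?i" "b = cf F ?j" "c = cf G ?i" "e = cf G ?j"
  have F: "F = Const a * Var i + Const b * Var j" and G: "G = Const c * Var i + Const e * Var j"
    using np expand unfolding nonproportional_forms_def abce by blast+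
  define D where "D = a * e - b * c"
  have "D \<noteq> 0"
  proof
    assume D0: "D = 0"
    show False
    proof (cases "c = 0")
      case False
      have "b = a / c * e" using D0 False by (simp add: D_def field_simps)
      then have "F = Const (a / c) * G"
        using False by (simp add: F G distrib_left mult.assoc[symmetric] flip: Const_mult)
      then show False using np by (auto simp: nonproportional_forms_def)
    next
      case True
      then have "e \<noteq> 0" using np G by (auto simp: nonproportional_forms_def)
      then have "a = 0" using D0 True by (simp add: D_def)
      then have "F = Const (b / e) * G"
        using True \<open>e \<noteq> 0\<close> by (simp add: F G mult.assoc[symmetric] flip: Const_mult)
      then show False using np by (auto simp: nonproportional_forms_def)
    qed
  qed
  have comb: "Const r * (Const s * x + Const t * y) + Const r' * (Const s' * x + Const t' * y) =
      Const (r * s + r' * s') * x + Const (r * t + r' * t') * y" for r s t r' s' t' and x y :: "'k R4"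
    by (simp add: Const_add Const_mult algebra_simps)
  show thesis
  proof (rule that[OF F G, of "e / D" "- b / D" "- c / D" "a / D"])
    show "Const (e / D) * F + Const (- b / D) * G = Var i"
      "Const (- c / D) * F + Const (a / D) * G = Var j"
      unfolding F G comb using \<open>D \<noteq> 0\<close>
      by (simp_all add: D_def divide_simps) (simp_all add: algebra_simps)
    show "Const a * (Const (e / D) * Var i + Const (- b / D) * Var j) +
        Const b * (Const (- c / D) * Var i + Const (a / D) * Var j) = Var i"
      "Const c * (Const (e / D) * Var i + Const (- b / D) * Var j) +
        Const e * (Const (- c / D) * Var i + Const (a / D) * Var j) = Var j"
      unfolding comb using \<open>D \<noteq> 0\<close>
      by (simp_all add: D_def divide_simps) (simp_all add: algebra_simps)
  qed
qed

lemma bidegree_eq_one: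
  "bidegree m = (1, 0) \<Longrightarrow> m = Poly_Mapping.single 0 1 \<or> m = Poly_Mapping.single 1 1"
  "bidegree m = (0, 1) \<Longrightarrow> m = Poly_Mapping.single 2 1 \<or> m = Poly_Mapping.single 3 1"
proof -
  have eq: "m = n \<longleftrightarrow> cf m 0 = cf n 0 \<and> cf m 1 = cf n 1 \<and> cf m 2 = cf n 2 \<and> cf m 3 = cf n 3"
    for m n :: "4 \<Rightarrow>\<^sub>0 nat"
    by (simp add: poly_mapping_eq_iff fun_eq_iff all_4)
  show "bidegree m = (1, 0) \<Longrightarrow> m = Poly_Mapping.single 0 1 \<or> m = Poly_Mapping.single 1 1"
    unfolding eq by (simp add: bidegree_def lookup_single) linarith
  show "bidegree m = (0, 1) \<Longrightarrow> m = Poly_Mapping.single 2 1 \<or> m = Poly_Mapping.single 3 1"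
    unfolding eq by (simp add: bidegree_def lookup_single) linarith
qed

theorem betti_fat_points_ideal:
  fixes H1 H2 V1 V2 :: "'k::field_char_0 R4"
  assumes H: "nonproportional_forms (1, 0) H1 H2" and V: "nonproportional_forms (0, 1) V1 V2"
  shows "betti (fat_points_ideal H1 H2 V1 V2 m11 m12 m21) u x =
    numbers m11 m12 m21 (gens m11 m12 m21) u x"
proof -
  obtain a b c e a' b' c' e' where
    H': "H1 = Const a * Var 0 + Const b * Var 1" "H2 = Const c * Var 0 + Const e * Var 1"
    "Const a' * H1 + Const b' * H2 = Var 0" "Const c' * H1 + Const e' * H2 = Var 1"
    "Const a * (Const a' * Var 0 + Const b' * Var 1) + Const b * (Const c' * Var 0 + Const e' * Var 1) = Var 0"
    "Const c * (Const a' * Var 0 + Const b' * Var 1) + Const e * (Const c' * Var 0 + Const e' * Var 1) = Var 1"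
    by (rule linear_forms_inverse[OF H bidegree_eq_one(1)]) auto
  obtain p q r s p' q' r' s' where
    V': "V1 = Const p * Var 2 + Const q * Var 3" "V2 = Const r * Var 2 + Const s * Var 3"
    "Const p' * V1 + Const q' * V2 = Var 2" "Const r' * V1 + Const s' * V2 = Var 3"
    "Const p * (Const p' * Var 2 + Const q' * Var 3) + Const q * (Const r' * Var 2 + Const s' * Var 3) = Var 2"
    "Const r * (Const p' * Var 2 + Const q' * Var 3) + Const s * (Const r' * Var 2 + Const s' * Var 3) = Var 3"
    by (rule linear_forms_inverse[OF V bidegree_eq_one(2)]) auto
  define L where "L = (\<lambda>i :: 4. if i = 0 then H1 else if i = 1 then H2 else if i = 2 then V1 else V2)"
  define M where "M = (\<lambda>i :: 4.
    if i = 0 then Const a' * Var 0 + Const b' * Var 1 else if i = 1 then Const c' * Var 0 + Const e' * Var 1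
    else if i = 2 then Const p' * Var 2 + Const q' * Var 3 else Const r' * Var 2 + Const s' * (Var 3 :: 'k R4))"
  have L: "L 0 = H1" "L 1 = H2" "L 2 = V1" "L 3 = V2" by (simp_all add: L_def)
  have M: "M 0 = Const a' * Var 0 + Const b' * Var 1" "M 1 = Const c' * Var 0 + Const e' * Var 1"
    "M 2 = Const p' * Var 2 + Const q' * Var 3" "M 3 = Const r' * Var 2 + Const s' * Var 3"
    by (simp_all add: M_def)
  interpret graded_automorphism L M
  proof
    have "\<forall>i. subst L (M i) = Var i"
      unfolding all_4 M by (simp add: subst_add subst_mult L H'(3,4) V'(3,4))
    then show "subst L (M i) = Var i" for i by blast
    have "subst M H1 = Var 0" "subst M H2 = Var 1"
      unfolding H'(1,2) by (simp_all add: subst_add subst_mult M H'(5,6))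
    moreover have "subst M V1 = Var 2" "subst M V2 = Var 3"
      unfolding V'(1,2) by (simp_all add: subst_add subst_mult M V'(5,6))
    ultimately have "\<forall>i. subst M (L i) = Var i"
      unfolding all_4 L by simp
    then show "subst M (L i) = Var i" for i by blast
    have "\<forall>i. bihomogeneous (bidegree (Poly_Mapping.single i 1)) (L i)"
      unfolding all_4 L using H V
      by (simp add: nonproportional_forms_def bidegree_def lookup_single)
    then show "bihomogeneous (bidegree (Poly_Mapping.single i 1)) (L i)" for i by blast
  qed
  obtain d A where res: "minimal_bigraded_resolution
      (fat_points_ideal (Var 0) (Var 1) (Var 2) (Var 3) m11 m12 m21 :: 'k R4 set) d A"
    and d: "\<And>u x. numbers m11 m12 m21 (gens m11 m12 m21) u x = count_list (d u) x"
    using has_betti_gens[where 'k = 'k, of m11 m12 m21] by (auto simp: has_betti_def fat_points_ideal_Var)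
  from minimal_bigraded_resolution_subst[OF res] show ?thesis
    unfolding subst_fat_points_ideal L by (simp add: betti_eq_count_list d)
qed


section \<open>Counting generators by degree\<close>

text \<open>The values climb as 1, 1, 2, 2, ... up to the argument \<open>t - 1\<close> and descend
  symmetrically.\<close>

lemma phi_eq:
  "phi t n = (if 0 \<le> n \<and> n \<le> 2 * t - 2 then min n (2 * t - 2 - n) div 2 + 1 else 0)"
proof (induction t n rule: phi.induct)
  case (1 t n)
  consider "t \<le> 0" | "t = 1" | "t > 1" "0 \<le> n" "n < t - 1"
    | "t > 1" "t - 1 \<le> n" "n < 2 * t - 1" | "t > 1" "n < 0 \<or> 2 * t - 1 \<le> n" by linarith
  then show ?case
  proof cases
    case 3
    then show ?thesis using "1.IH"(1) by (subst phi.simps) (auto simp: min_def)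
  next
    case 4
    then show ?thesis using "1.IH"(2) by (subst phi.simps) (auto simp: min_def)
  qed (subst phi.simps; auto)+
qed

text \<open>Counts the \<open>c\<close> with \<open>(a, c)\<close> in the box and
  \<open>c - a = j - m12\<close>. The lower bounds express \<open>c \<ge> 0\<close>,
  \<open>a \<ge> 0\<close> and \<open>a + c \<ge> m11\<close>, the last as a half rounded up; the
  upper ones express \<open>c \<le> m21\<close> and \<open>a \<le> m12\<close>. The cap
  \<open>h\<close> later encodes strict inequalities.\<close>

definition inner_count :: "int \<Rightarrow> int \<Rightarrow> int \<Rightarrow> int \<Rightarrow> int \<Rightarrow> int"
  where "inner_count m11 m12 m21 h j =
    max 0 (min (min m21 j) h - max (max 0 (j - m12)) ((j - (m12 - m11) + 1) div 2) + 1)"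

lemma card_inner:
  "int (card {(a, c). m11 \<le> a + c \<and> a \<le> m12 \<and> c \<le> m21 \<and> int c \<le> h \<and>
      i = int a - int c + int m21 \<and> j = int c - int a + int m12}) =
    (if i + j = int m12 + int m21 then inner_count m11 m12 m21 h j else 0)" (is "int (card ?S) = _")
proof (cases "i + j = int m12 + int m21")
  case True
  define lo hi where lo_def: "lo = max (max 0 (j - int m12)) ((j - (int m12 - int m11) + 1) div 2)"
    and hi_def: "hi = min (min (int m21) j) h"
  have lo: "lo \<le> k \<longleftrightarrow> 0 \<le> k \<and> j - int m12 \<le> k \<and> j - (int m12 - int m11) \<le> 2 * k" for k
  proof -
    have "(n + 1) div 2 \<le> k \<longleftrightarrow> n \<le> 2 * k" for n :: int by linarith
    then show ?thesis unfolding lo_def max.bounded_iff by blast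
  qed
  have hi: "k \<le> hi \<longleftrightarrow> k \<le> int m21 \<and> k \<le> j \<and> k \<le> h" for k
    unfolding hi_def min.bounded_iff by simp
  have "?S = (\<lambda>k. (nat (k + int m12 - j), nat k)) ` {lo..hi}"
  proof (intro equalityI subsetI)
    fix z assume "z \<in> ?S"
    then obtain a c where z: "z = (a, c)" "m11 \<le> a + c" "a \<le> m12" "c \<le> m21" "int c \<le> h"
      "j = int c - int a + int m12" by auto
    then have "z = (nat (int c + int m12 - j), nat (int c))" by simp
    moreover have "int c \<in> {lo..hi}" unfolding atLeastAtMost_iff lo hi using z by simp
    ultimately show "z \<in> (\<lambda>k. (nat (k + int m12 - j), nat k)) ` {lo..hi}" by (rule image_eqI)
  next
    fix z assume "z \<in> (\<lambda>k. (nat (k + int m12 - j), nat k)) ` {lo..hi}"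
    then obtain k where z: "z = (nat (k + int m12 - j), nat k)" and "k \<in> {lo..hi}" by blast
    then have k: "0 \<le> k" "j - m12 \<le> k" "j - (int m12 - int m11) \<le> 2 * k" "k \<le> int m21" "k \<le> j" "k \<le> h"
      unfolding atLeastAtMost_iff lo hi by blast+
    define a c where "a = nat (k + int m12 - j)" and "c = nat k"
    then have ac: "k = int c" "k + int m12 - j = int a" using k(1,2) by simp_all
    have "z = (a, c)" by (simp add: z a_def c_def)
    moreover have "m11 \<le> a + c" "a \<le> m12" "c \<le> m21" "int c \<le> h"
      "i = int a - int c + int m21" "j = int c - int a + int m12"
      using k(3-6) ac True by linarith+
    ultimately show "z \<in> ?S" by simp
  qed
  moreover have "inj_on (\<lambda>k. (nat (k + int m12 - j), nat k)) {lo..hi}"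
  proof (rule inj_onI)
    fix k k' assume "k \<in> {lo..hi}" "k' \<in> {lo..hi}"
      "(nat (k + int m12 - j), nat k) = (nat (k' + int m12 - j), nat k')"
    then show "k = k'" unfolding atLeastAtMost_iff lo by (simp add: eq_nat_nat_iff)
  qed
  ultimately have "card ?S = nat (hi - lo + 1)"
    by (simp add: card_image)
  then show ?thesis
    using True by (simp add: inner_count_def lo_def hi_def)
next
  case False
  then have "?S = {}" by auto
  then have "card ?S = 0" by (simp only: card.empty)
  with False show ?thesis by (simp only: if_False of_nat_0)
qed

text \<open>\<open>phi (m21 + B)\<close> counts the points of the diagonal without the bound
  \<open>c \<ge> 0\<close>, and \<open>phi B\<close> those with \<open>c < 0\<close>.\<close>

lemma inner_count_D2:
  assumes "m11 > m21" "m12 \<ge> m21" "m21 \<ge> 0" "m11 \<le> m12 + m21" "B = m12 - m11"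
    and "max 0 (- B) \<le> b" "b < m21"
  shows "inner_count m11 m12 m21 b b = phi2 (m21 + B) B b"
  using assms unfolding phi2_def phi_eq inner_count_def
  by (auto simp: min_def max_def)

text \<open>From \<open>b = m21\<close> on, the top point is \<open>c = m21\<close> instead of
  \<open>c = b\<close>, and the descending half of \<open>phi\<close> falls one short of the number
  of points; hence the summand 1.\<close>

lemma inner_count_D3:
  assumes "m11 > m21" "m12 \<ge> m21" "m21 \<ge> 0" "m11 \<le> m12 + m21" "B = m12 - m11"
    and "m21 \<le> b" "b \<le> B + 2 * m21"
  shows "inner_count m11 m12 m21 b b = 1 + phi2 (m21 + B) B b"
  using assms unfolding phi2_def phi_eq inner_count_def
  by (auto simp: min_def max_def)

lemma inner_count_eq_0:
  assumes "m11 > m21" "m12 \<ge> m21" "m21 \<ge> 0" "m11 \<le> m12 + m21"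
    and "\<not> (max 0 (m11 - m12) \<le> j \<and> j \<le> m12 - m11 + 2 * m21)"
  shows "inner_count m11 m12 m21 h j = 0"
proof -
  define r where "r = (j - (m12 - m11) + 1) div 2"
  then have r: "j - (m12 - m11) \<le> 2 * r" by linarith
  have "j < 0 \<or> j + 1 \<le> r \<or> m21 + 1 \<le> r" using assms(5) r by linarith
  then show ?thesis unfolding inner_count_def r_def[symmetric] by auto
qed

context
  fixes m11 m12 m21 j :: int
  assumes m: "m11 > m21" "m12 \<ge> m21" "m21 \<ge> 0" "m11 \<le> m12 + m21"
    and j: "max 0 (m11 - m12) \<le> j" "j \<le> m12 - m11 + 2 * m21"
begin

text \<open>The bound \<open>a \<ge> 0\<close> is implied here by
  \<open>a + c \<ge> m11 > m21 \<ge> c\<close>. So the diagonal is the nonempty interval from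
  \<open>q\<close> to \<open>min m21 j\<close>, and the first diagonal is a single point.\<close>

lemma inner_count_bounds:
  obtains q where "0 \<le> q" "q \<le> m21" "q \<le> j" "j = max 0 (m11 - m12) \<Longrightarrow> q = j"
    "\<And>h. inner_count m11 m12 m21 h j = max 0 (min (min m21 j) h - q + 1)"
proof -
  define r where "r = (j - (m12 - m11) + 1) div 2"
  then have r: "j - (m12 - m11) \<le> 2 * r" "2 * r \<le> j - (m12 - m11) + 1" by linarith+
  have "j - m12 \<le> r" using m j r by linarith
  then have "max (max 0 (j - m12)) r = max 0 r" using m j by linarith
  moreover have "max 0 r \<le> m21" "max 0 r \<le> j" using m j r by linarith+
  moreover have "max 0 r = j" if "j = max 0 (m11 - m12)" using that m r by linarith
  ultimately show thesis
    by (intro that[of "max 0 r"]) (auto simp: inner_count_def r_def[symmetric])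
qed

text \<open>Each strict inequality can remove only the top point: \<open>a = m12\<close> means
  \<open>c = j\<close>, which is on top if \<open>j \<le> m21\<close>, and \<open>c = m21\<close> is
  on top if \<open>m21 \<le> j\<close>.\<close>

lemma inner_count_strict:
  "inner_count m11 m12 m21 (j - 1) j = inner_count m11 m12 m21 j j - of_bool (j \<le> m21)"
  "inner_count m11 m12 m21 (m21 - 1) j = inner_count m11 m12 m21 j j - of_bool (m21 \<le> j)"
  "inner_count m11 m12 m21 (min (j - 1) (m21 - 1)) j = inner_count m11 m12 m21 j j - 1"
proof -
  obtain q where q: "0 \<le> q" "q \<le> m21" "q \<le> j"
    "\<And>h. inner_count m11 m12 m21 h j = max 0 (min (min m21 j) h - q + 1)"
    using inner_count_bounds by metis
  show "inner_count m11 m12 m21 (j - 1) j = inner_count m11 m12 m21 j j - of_bool (j \<le> m21)"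
    using q(2,3) unfolding q(4) by (cases "j \<le> m21") auto
  show "inner_count m11 m12 m21 (m21 - 1) j = inner_count m11 m12 m21 j j - of_bool (m21 \<le> j)"
    using q(2,3) unfolding q(4) by (cases "m21 \<le> j") auto
  show "inner_count m11 m12 m21 (min (j - 1) (m21 - 1)) j = inner_count m11 m12 m21 j j - 1"
    using q(2,3) unfolding q(4) by (cases "m21 \<le> j") auto
qed

lemma inner_count_first: "j = max 0 (m11 - m12) \<Longrightarrow> inner_count m11 m12 m21 j j = 1"
proof -
  assume "j = max 0 (m11 - m12)"
  moreover obtain q where "j = max 0 (m11 - m12) \<Longrightarrow> q = j" "q \<le> m21"
    "\<And>h. inner_count m11 m12 m21 h j = max 0 (min (min m21 j) h - q + 1)"
    using inner_count_bounds by metis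
  ultimately show ?thesis by simp
qed

end

section \<open>The central part and the two tails of the set of generators\<close>

context
  fixes m11 m12 m21 :: nat
begin

text \<open>The truncated box if \<open>m11 \<le> m12 + m21\<close>, and otherwise the segment of
  \<open>a + c = m11\<close> with \<open>a \<ge> m12\<close> and \<open>c \<ge> m21\<close>.\<close>

definition "central = {(a, c) \<in> gens m11 m12 m21. (a \<le> m12 \<or> m21 \<le> c) \<and> (c \<le> m21 \<or> m12 \<le> a)}"
definition "right_tail = {(a, c). a + c = m11 \<and> m12 < a \<and> c < m21}"
definition "left_tail = {(a, c). a + c = m11 \<and> a < m12 \<and> m21 < c}"

lemma gens_eq: "gens m11 m12 m21 = central \<union> right_tail \<union> left_tail"
proof (rule Set.set_eqI)
  fix z :: "nat \<times> nat"
  obtain a c where z: "z = (a, c)" by (cases z)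
  have "(a, c) \<in> gens m11 m12 m21" if "a + c = m11" using that by (simp add: gens_def)
  moreover have "a + c = m11" if "(a, c) \<in> gens m11 m12 m21" "m12 < a \<and> c < m21 \<or> a < m12 \<and> m21 < c"
    using that(2) by (cases rule: gens_cases[OF that(1)]) auto
  ultimately show "z \<in> gens m11 m12 m21 \<longleftrightarrow> z \<in> central \<union> right_tail \<union> left_tail"
    unfolding z central_def right_tail_def left_tail_def by (auto intro: leI)
qed

lemma parts_disjoint: "central \<inter> right_tail = {}" "(central \<union> right_tail) \<inter> left_tail = {}"
  unfolding central_def right_tail_def left_tail_def by auto

lemma degr_diff_eq:
  fixes x :: "int \<times> int"
  shows "degr m12 m21 z + y = x \<longleftrightarrow> degr m12 m21 z = x - y"
  by (auto simp: algebra_simps)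

lemma card_gens_split:
  "card {z \<in> gens m11 m12 m21. Q z} =
    card {z \<in> central. Q z} + card {z \<in> right_tail. Q z} + card {z \<in> left_tail. Q z}"
proof -
  have fin: "finite central" "finite right_tail" "finite left_tail"
    using finite_gens[of m11 m12 m21] unfolding gens_eq by auto
  let ?C = "{z \<in> central. Q z}" and ?R = "{z \<in> right_tail. Q z}" and ?L = "{z \<in> left_tail. Q z}"
  have "?C \<inter> ?R = {}" "(?C \<union> ?R) \<inter> ?L = {}"
    using parts_disjoint by blast+
  moreover have "finite ?C" "finite ?R" "finite ?L" using fin by simp_all
  ultimately have "card (?C \<union> ?R \<union> ?L) = card ?C + card ?R + card ?L"
    by (simp only: card_Un_disjoint finite_Un)
  moreover have "{z \<in> gens m11 m12 m21. Q z} = ?C \<union> ?R \<union> ?L"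
    unfolding gens_eq by blast
  ultimately show ?thesis by simp
qed

lemma card_right_tail:
  assumes "m21 < m11"
  shows "card {z \<in> right_tail. degr m12 m21 z = x} = of_bool (x \<in> D1 m11 m12 m21)"
proof -
  obtain i j where x: "x = (i, j)" by (cases x)
  \<comment> \<open>The difference of positive parts in \<open>D1\<close> is the minimum of
    \<open>m21\<close> and \<open>max 0 (m11 - m12)\<close>.\<close>
  have D1: "x \<in> D1 m11 m12 m21 \<longleftrightarrow> 0 \<le> j \<and> j < int m21 \<and> j < int m11 - int m12 \<and> i + 2 * j = int m11 + int m21"
    using assms by (auto simp: D1_def Let_def pos_part_def x)
  have "{z \<in> right_tail. degr m12 m21 z = x} = (if x \<in> D1 m11 m12 m21 then {(nat (int m11 - j), nat j)} else {})"
  proof (rule Set.set_eqI)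
    fix z :: "nat \<times> nat"
    obtain a c where z: "z = (a, c)" by (cases z)
    show "z \<in> {z \<in> right_tail. degr m12 m21 z = x} \<longleftrightarrow>
        z \<in> (if x \<in> D1 m11 m12 m21 then {(nat (int m11 - j), nat j)} else {})"
      unfolding D1 by (auto simp: z x right_tail_def degr_eq of_nat_diff)
  qed
  then show ?thesis by simp
qed

lemma card_left_tail:
  assumes "m21 < m11"
  shows "card {z \<in> left_tail. degr m12 m21 z = x} = of_bool (x \<in> D4 m11 m12 m21)"
proof -
  obtain i j where x: "x = (i, j)" by (cases x)
  \<comment> \<open>On the line \<open>2 * i + j = m11 + m12\<close> the bound with the absolute
    value says that \<open>i\<close> is below both \<open>m12\<close> and
    \<open>m11 - m21\<close>.\<close>
  have D4: "x \<in> D4 m11 m12 m21 \<longleftrightarrow> 0 \<le> i \<and> i < int m12 \<and> i < int m11 - int m21 \<and> 2 * i + j = int m11 + int m12"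
    using assms by (auto simp: D4_def Let_def x)
  have "{z \<in> left_tail. degr m12 m21 z = x} = (if x \<in> D4 m11 m12 m21 then {(nat i, nat (int m11 - i))} else {})"
  proof (rule Set.set_eqI)
    fix z :: "nat \<times> nat"
    obtain a c where z: "z = (a, c)" by (cases z)
    show "z \<in> {z \<in> left_tail. degr m12 m21 z = x} \<longleftrightarrow>
        z \<in> (if x \<in> D4 m11 m12 m21 then {(nat i, nat (int m11 - i))} else {})"
      unfolding D4 by (auto simp: z x left_tail_def degr_eq of_nat_diff)
  qed
  then show ?thesis by simp
qed

definition "central_count Q x = int (card {z \<in> central. Q z \<and> degr m12 m21 z = x})"

text \<open>On the right tail \<open>c < corner\<close> always holds and \<open>a < m12\<close>
  never, on the left tail the reverse. So each tail generator contributes one first syzygy and no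
  second one.\<close>

lemma numbers_gens:
  fixes x :: "int \<times> int"
  assumes "m21 < m11"
  shows "int (numbers m11 m12 m21 (gens m11 m12 m21) 0 x) =
      central_count (\<lambda>_. True) x + of_bool (x \<in> D1 m11 m12 m21) + of_bool (x \<in> D4 m11 m12 m21)"
    and "int (numbers m11 m12 m21 (gens m11 m12 m21) 1 x) =
      central_count (\<lambda>z. fst z < m12) (x - (1, 0)) + of_bool (x - (1, 0) \<in> D4 m11 m12 m21) +
      (central_count (\<lambda>z. snd z < corner m11 m12 m21) (x - (0, 1)) + of_bool (x - (0, 1) \<in> D1 m11 m12 m21))"
    and "int (numbers m11 m12 m21 (gens m11 m12 m21) 2 x) =
      central_count (\<lambda>z. fst z < m12 \<and> snd z < corner m11 m12 m21) (x - (1, 1))"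
proof -
  have right: "{z \<in> right_tail. fst z < m12 \<and> Q z} = {}"
    "{z \<in> right_tail. snd z < corner m11 m12 m21 \<and> Q z} = {z \<in> right_tail. Q z}" for Q
    by (auto simp: right_tail_def corner_def)
  have left: "{z \<in> left_tail. fst z < m12 \<and> Q z} = {z \<in> left_tail. Q z}"
    "{z \<in> left_tail. snd z < corner m11 m12 m21 \<and> Q z} = {}" for Q
    by (auto simp: left_tail_def corner_def)
  note [simp] = card_right_tail[OF assms] card_left_tail[OF assms]
  show "int (numbers m11 m12 m21 (gens m11 m12 m21) 0 x) =
      central_count (\<lambda>_. True) x + of_bool (x \<in> D1 m11 m12 m21) + of_bool (x \<in> D4 m11 m12 m21)"
    by (simp add: numbers_def card_gens_split central_count_def)
  show "int (numbers m11 m12 m21 (gens m11 m12 m21) 1 x) =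
      central_count (\<lambda>z. fst z < m12) (x - (1, 0)) + of_bool (x - (1, 0) \<in> D4 m11 m12 m21) +
      (central_count (\<lambda>z. snd z < corner m11 m12 m21) (x - (0, 1)) + of_bool (x - (0, 1) \<in> D1 m11 m12 m21))"
    unfolding numbers_def degr_diff_eq card_gens_split right left by (simp add: central_count_def)
  show "int (numbers m11 m12 m21 (gens m11 m12 m21) 2 x) =
      central_count (\<lambda>z. fst z < m12 \<and> snd z < corner m11 m12 m21) (x - (1, 1))"
    unfolding numbers_def degr_diff_eq card_gens_split conj_assoc right left by (simp add: central_count_def conj_assoc)
qed

text \<open>Along a fixed diagonal every condition in use becomes a cap on \<open>c\<close>; for
  instance \<open>a < m12\<close> reads \<open>c < j\<close>.\<close>

lemma central_count_inner:
  assumes le: "m11 \<le> m12 + m21"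
    and Q: "\<And>a c. a \<le> m12 \<Longrightarrow> c \<le> m21 \<Longrightarrow> j = int c - int a + int m12 \<Longrightarrow> Q (a, c) \<longleftrightarrow> int c \<le> h"
  shows "central_count Q (i, j) =
    (if i + j = int m12 + int m21 then inner_count m11 m12 m21 h j else 0)"
proof -
  have corner: "corner m11 m12 m21 = m21" using le by (simp add: corner_def)
  have central: "(a, c) \<in> central \<longleftrightarrow> m11 \<le> a + c \<and> a \<le> m12 \<and> c \<le> m21" for a c
    unfolding central_def gens_def corner using le by auto
  have "{z \<in> central. Q z \<and> degr m12 m21 z = (i, j)} =
    {(a, c). m11 \<le> a + c \<and> a \<le> m12 \<and> c \<le> m21 \<and> int c \<le> h \<and>
      i = int a - int c + int m21 \<and> j = int c - int a + int m12}" (is "?A = ?B")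
  proof (rule Set.set_eqI)
    fix z :: "nat \<times> nat"
    obtain a c where z: "z = (a, c)" by (cases z)
    show "z \<in> ?A \<longleftrightarrow> z \<in> ?B"
    proof (cases "m11 \<le> a + c \<and> a \<le> m12 \<and> c \<le> m21")
      case True
      then have "degr m12 m21 z = (i, j) \<longleftrightarrow> i = int a - int c + int m21 \<and> j = int c - int a + int m12"
        by (auto simp: z degr_eq of_nat_diff)
      then show ?thesis using True Q[of a c] by (auto simp: z central)
    qed (auto simp: z central)
  qed
  then show ?thesis
    unfolding central_count_def by (simp only: card_inner)
qed

lemma central_count_middle:
  assumes "m12 + m21 < m11"
  shows "central_count Q (i, j) =
    of_bool (i + j = int m11 \<and> int m12 \<le> i \<and> int m21 \<le> j \<and> Q (nat i, nat j))"
proof -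
  have central: "(a, c) \<in> central \<longleftrightarrow> a + c = m11 \<and> m12 \<le> a \<and> m21 \<le> c" for a c
    unfolding central_def gens_def corner_def using assms by auto
  have "{z \<in> central. Q z \<and> degr m12 m21 z = (i, j)} =
    (if i + j = int m11 \<and> int m12 \<le> i \<and> int m21 \<le> j \<and> Q (nat i, nat j) then {(nat i, nat j)} else {})"
    (is "?A = ?B")
  proof (rule Set.set_eqI)
    fix z :: "nat \<times> nat"
    obtain a c where z: "z = (a, c)" by (cases z)
    show "z \<in> ?A \<longleftrightarrow> z \<in> ?B"
      by (auto simp: z central degr_eq)
  qed
  then show ?thesis
    unfolding central_count_def by simp
qed

context
  assumes m21_le: "m21 \<le> m12" and m21_less: "m21 < m11"
begin

lemma D2_Un_D3_inner:
  assumes "m11 \<le> m12 + m21"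
  shows "(i, j) \<in> D2 m11 m12 m21 \<union> D3 m11 m12 m21 \<longleftrightarrow>
    i + j = int m12 + int m21 \<and> max 0 (int m11 - int m12) \<le> j \<and> j \<le> int m12 - int m11 + 2 * int m21"
  using assms m21_le m21_less by (auto simp: D2_def D3_def Let_def pos_part_def)

lemma D2_Un_D3_middle:
  assumes "m12 + m21 < m11"
  shows "(i, j) \<in> D2 m11 m12 m21 \<union> D3 m11 m12 m21 \<longleftrightarrow>
    i + j = int m11 \<and> int m12 \<le> i \<and> int m21 \<le> j"
  using assms m21_le m21_less by (auto simp: D2_def D3_def Let_def pos_part_def)

lemma central_count_eq:
  "central_count (\<lambda>_. True) x =
    (if x \<in> D2 m11 m12 m21 then phi2 (int m21 + (int m12 - int m11)) (int m12 - int m11) (snd x)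
     else if x \<in> D3 m11 m12 m21 then 1 + phi2 (int m21 + (int m12 - int m11)) (int m12 - int m11) (snd x)
     else 0)"
proof -
  obtain i j where x: "x = (i, j)" by (cases x)
  have D2: "j < int m21" if "x \<in> D2 m11 m12 m21" using that by (simp add: x D2_def Let_def)
  have D3: "int m21 \<le> j" if "x \<in> D3 m11 m12 m21" using that by (simp add: x D3_def Let_def)
  show ?thesis
  proof (cases "m11 \<le> m12 + m21")
    case True
    note E = D2_Un_D3_inner[OF True, of i j, folded x]
    have m: "int m11 > int m21" "int m12 \<ge> int m21" "int m21 \<ge> 0" "int m11 \<le> int m12 + int m21"
      using m21_le m21_less True by simp_all
    have N: "central_count (\<lambda>_. True) x = (if i + j = int m12 + int m21 then inner_count m11 m12 m21 j j else 0)"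
      unfolding x using True by (intro central_count_inner) auto
    consider "x \<in> D2 m11 m12 m21" | "x \<notin> D2 m11 m12 m21" "x \<in> D3 m11 m12 m21"
      | "x \<notin> D2 m11 m12 m21 \<union> D3 m11 m12 m21" by blast
    then show ?thesis
    proof cases
      case 1
      then have "inner_count m11 m12 m21 j j = phi2 (int m21 + (int m12 - int m11)) (int m12 - int m11) j"
        using E D2 by (intro inner_count_D2[OF m]) auto
      then show ?thesis using 1 E x unfolding N by simp
    next
      case 2
      then have "inner_count m11 m12 m21 j j = 1 + phi2 (int m21 + (int m12 - int m11)) (int m12 - int m11) j"
        using E D3 by (intro inner_count_D3[OF m]) auto
      then show ?thesis using 2 E x unfolding N by simp
    next
      case 3
      then have "i + j = int m12 + int m21 \<Longrightarrow> inner_count m11 m12 m21 j j = 0"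
        using E by (intro inner_count_eq_0[OF m]) blast
      then show ?thesis using 3 by (simp add: N)
    qed
  next
    case False
    then have II: "m12 + m21 < m11" by simp
    note E = D2_Un_D3_middle[OF II, of i j, folded x]
    have N: "central_count (\<lambda>_. True) x = of_bool (x \<in> D2 m11 m12 m21 \<union> D3 m11 m12 m21)"
      unfolding E unfolding x by (simp add: central_count_middle[OF II])
    \<comment> \<open>Here the two bounds on the second coordinate in \<open>D2\<close> coincide,
      and both indices of \<open>phi2\<close> are negative.\<close>
    have "x \<notin> D2 m11 m12 m21" using D2 E by fastforce
    moreover have "phi2 (int m21 + (int m12 - int m11)) (int m12 - int m11) j = 0" for j
      using II by (simp add: phi2_def phi_eq)
    ultimately show ?thesis by (simp add: N)
  qed
qed

text \<open>First syzygies combine \<open>x\<^sub>0\<close> applied in degree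
  \<open>(a - 1, b)\<close> with \<open>x\<^sub>2\<close> applied in degree
  \<open>(a, b - 1)\<close>; the two diagonals together lose exactly one top point. For second
  syzygies each diagonal loses its own top point.\<close>

lemma central_count_first_syzygies:
  "central_count (\<lambda>z. fst z < m12) (a - 1, b) + central_count (\<lambda>z. snd z < corner m11 m12 m21) (a, b - 1) =
    (if (a, b - 1) \<in> D2 m11 m12 m21 \<union> D3 m11 m12 m21
     then central_count (\<lambda>_. True) (a, b - 1) + central_count (\<lambda>_. True) (a - 1, b) - 1 else 0)"
  and central_count_second_syzygies:
  "central_count (\<lambda>z. fst z < m12 \<and> snd z < corner m11 m12 m21) x =
    (if x \<in> D2 m11 m12 m21 \<union> D3 m11 m12 m21 then central_count (\<lambda>_. True) x - 1 else 0)"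
proof -
  obtain i j where x: "x = (i, j)" by (cases x)
  consider (inner) "m11 \<le> m12 + m21" | (middle) "m12 + m21 < m11" by linarith
  then have "central_count (\<lambda>z. fst z < m12) (a - 1, b) + central_count (\<lambda>z. snd z < corner m11 m12 m21) (a, b - 1) =
      (if (a, b - 1) \<in> D2 m11 m12 m21 \<union> D3 m11 m12 m21
       then central_count (\<lambda>_. True) (a, b - 1) + central_count (\<lambda>_. True) (a - 1, b) - 1 else 0) \<and>
    central_count (\<lambda>z. fst z < m12 \<and> snd z < corner m11 m12 m21) x =
      (if x \<in> D2 m11 m12 m21 \<union> D3 m11 m12 m21 then central_count (\<lambda>_. True) x - 1 else 0)"
  proof cases
    case inner
    have m: "int m11 > int m21" "int m12 \<ge> int m21" "int m21 \<ge> 0" "int m11 \<le> int m12 + int m21"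
      using m21_le m21_less inner by simp_all
    have corner: "corner m11 m12 m21 = m21" using inner by (simp add: corner_def)
    let ?N = "\<lambda>h i j. if i + j = int m12 + int m21 then inner_count m11 m12 m21 h j else 0"
    have N: "central_count (\<lambda>_. True) (i, j) = ?N j i j"
      "central_count (\<lambda>z. fst z < m12) (i, j) = ?N (j - 1) i j"
      "central_count (\<lambda>z. snd z < corner m11 m12 m21) (i, j) = ?N (int m21 - 1) i j"
      "central_count (\<lambda>z. fst z < m12 \<and> snd z < corner m11 m12 m21) (i, j) =
        ?N (min (j - 1) (int m21 - 1)) i j" for i j
      unfolding corner by (rule central_count_inner[OF inner]; auto)+
    let ?e = "\<lambda>j. max 0 (int m11 - int m12) \<le> j \<and> j \<le> int m12 - int m11 + 2 * int m21"
    let ?I = "\<lambda>h j. inner_count m11 m12 m21 h j"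
    have out: "?I h j = 0" if "\<not> ?e j" for h j using inner_count_eq_0[OF m that] .
    have I: "?I (j - 1) j = ?I j j - of_bool (?e j \<and> j \<le> int m21)"
      "?I (int m21 - 1) j = ?I j j - of_bool (?e j \<and> int m21 \<le> j)"
      "?I (min (j - 1) (int m21 - 1)) j = ?I j j - of_bool (?e j)" for j
    proof -
      show "?I (j - 1) j = ?I j j - of_bool (?e j \<and> j \<le> int m21)"
        using inner_count_strict(1)[OF m, of j] out[of j] by (cases "?e j") auto
      show "?I (int m21 - 1) j = ?I j j - of_bool (?e j \<and> int m21 \<le> j)"
        using inner_count_strict(2)[OF m, of j] out[of j] by (cases "?e j") auto
      show "?I (min (j - 1) (int m21 - 1)) j = ?I j j - of_bool (?e j)"
        using inner_count_strict(3)[OF m, of j] out[of j] by (cases "?e j") auto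
    qed
    \<comment> \<open>The claimed condition looks only at \<open>(a, b - 1)\<close>. If that
      diagonal is empty, the one of \<open>b\<close> is empty as well or is the first, whose single
      point has \<open>a = m12\<close> and so yields no \<open>x\<^sub>0\<close> syzygy.\<close>
    have boundary: "?I b b = of_bool (?e b \<and> b \<le> int m21)" if "\<not> ?e (b - 1)"
    proof (cases "?e b")
      case True
      then have b: "b = max 0 (int m11 - int m12)" using that by linarith
      moreover have "b \<le> int m21" using b m by linarith
      ultimately show ?thesis
        using True inner_count_first[OF m, of b] by simp
    qed (use out in auto)
    \<comment> \<open>The lost top point is on diagonal \<open>b\<close> if
      \<open>b \<le> m21\<close>, and on diagonal \<open>b - 1\<close> otherwise.\<close>
    have indicators: "of_bool (?e b \<and> b \<le> int m21) + of_bool (?e (b - 1) \<and> int m21 \<le> b - 1) = (1 :: int)"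
      if "?e (b - 1)"
    proof (cases "b \<le> int m21")
      case True
      then have "?e b" using that m by linarith
      then show ?thesis using True by simp
    qed (use that in simp)
    have first: "?N (b - 1) (a - 1) b + ?N (int m21 - 1) a (b - 1) =
      (if a + (b - 1) = int m12 + int m21 \<and> ?e (b - 1) then ?N (b - 1) a (b - 1) + ?N b (a - 1) b - 1 else 0)"
    proof (cases "a + b - 1 = int m12 + int m21")
      case sum: True
      then have eq: "a + (b - 1) = int m12 + int m21" "a - 1 + b = int m12 + int m21" by simp_all
      show ?thesis
      proof (cases "?e (b - 1)")
        case True
        then show ?thesis using indicators[OF True] sum unfolding eq by (simp only: I refl if_True simp_thms)
      next
        case False
        then show ?thesis using boundary[OF False] out[OF False] sum
          unfolding eq by (simp only: I refl if_True if_False simp_thms)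
      qed
    next
      case False
      then have "a + (b - 1) \<noteq> int m12 + int m21" "a - 1 + b \<noteq> int m12 + int m21" by simp_all
      then show ?thesis using False by simp
    qed
    have second: "?N (min (j - 1) (int m21 - 1)) i j =
      (if i + j = int m12 + int m21 \<and> ?e j then ?N j i j - 1 else 0)"
      using I(3)[of j] out[of j] by (cases "?e j") simp_all
    show ?thesis
      unfolding N x D2_Un_D3_inner[OF inner] by (rule conjI[OF first second])
  next
    case middle
    \<comment> \<open>No central generator has \<open>a < m12\<close> in this case, and
      \<open>(m12, corner)\<close> is the only one without an \<open>x\<^sub>2\<close>
      syzygy.\<close>
    then have "corner m11 m12 m21 = m11 - m12" by (simp add: corner_def)
    then show ?thesis
      unfolding x D2_Un_D3_middle[OF middle] central_count_middle[OF middle]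
      using middle by auto
  qed
  then show "central_count (\<lambda>z. fst z < m12) (a - 1, b) + central_count (\<lambda>z. snd z < corner m11 m12 m21) (a, b - 1) =
      (if (a, b - 1) \<in> D2 m11 m12 m21 \<union> D3 m11 m12 m21
       then central_count (\<lambda>_. True) (a, b - 1) + central_count (\<lambda>_. True) (a - 1, b) - 1 else 0)"
    and "central_count (\<lambda>z. fst z < m12 \<and> snd z < corner m11 m12 m21) x =
      (if x \<in> D2 m11 m12 m21 \<union> D3 m11 m12 m21 then central_count (\<lambda>_. True) x - 1 else 0)"
    by blast+
qed

text \<open>The formula for the first syzygies also evaluates the generator count at the next degree
  on the antidiagonal, so that degree must avoid the tails even where it leaves \<open>D2\<close>
  and \<open>D3\<close>.\<close>

lemma D_disjoint:
  assumes E: "(i, j) \<in> D2 m11 m12 m21 \<union> D3 m11 m12 m21"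
  shows "(i, j) \<notin> D1 m11 m12 m21" "(i, j) \<notin> D4 m11 m12 m21"
    "(i - 1, j + 1) \<notin> D1 m11 m12 m21" "(i - 1, j + 1) \<notin> D4 m11 m12 m21"
proof -
  have "(i, j) \<notin> D1 m11 m12 m21 \<and> (i, j) \<notin> D4 m11 m12 m21 \<and>
    (i - 1, j + 1) \<notin> D1 m11 m12 m21 \<and> (i - 1, j + 1) \<notin> D4 m11 m12 m21"
  proof (cases "m11 \<le> m12 + m21")
    case True
    show ?thesis using E m21_less m21_le True unfolding D2_Un_D3_inner[OF True]
      by (auto simp: D1_def D4_def Let_def pos_part_def)
  next
    case False
    then have "m12 + m21 < m11" by simp
    from E[unfolded D2_Un_D3_middle[OF this]] this show ?thesis
      by (auto simp: D1_def D4_def Let_def pos_part_def)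
  qed
  then show "(i, j) \<notin> D1 m11 m12 m21" "(i, j) \<notin> D4 m11 m12 m21"
    "(i - 1, j + 1) \<notin> D1 m11 m12 m21" "(i - 1, j + 1) \<notin> D4 m11 m12 m21" by blast+
qed

text \<open>Makes the order of the case distinctions immaterial: the two tails never meet, neither
  in generator degrees nor in syzygy degrees.\<close>

lemma D1_D4_disjoint:
  "x \<in> D1 m11 m12 m21 \<Longrightarrow> x \<notin> D4 m11 m12 m21"
  "(a, b - 1) \<in> D1 m11 m12 m21 \<Longrightarrow> (a - 1, b) \<notin> D4 m11 m12 m21"
  using m21_less m21_le by (auto simp: D1_def D4_def Let_def pos_part_def)

end

end

theorem theorem4p5:
  fixes H1 H2 V1 V2 :: "'k::field_char_0 R4"
    and m11 m12 m21 :: nat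
    and B :: int
    and \<beta> :: "nat \<Rightarrow> int \<times> int \<Rightarrow> int"
    and a b :: int
  assumes "nonproportional_forms (1, 0) H1 H2"
    and "nonproportional_forms (0, 1) V1 V2"
    and "m12 \<ge> m21"
    and "m11 > m21"
  defines "B \<equiv> int m12 - int m11"
    and "\<beta> \<equiv> (\<lambda>u ij. int (betti (fat_points_ideal H1 H2 V1 V2 m11 m12 m21) u ij))"
  assumes "a \<ge> 0" and "b \<ge> 0"
  shows
    "\<beta> 0 (a, b) =
      (if (a, b) \<in> D1 m11 m12 m21 then 1
       else if (a, b) \<in> D2 m11 m12 m21 then phi2 (int m21 + B) B b
       else if (a, b) \<in> D3 m11 m12 m21 then 1 + phi2 (int m21 + B) B b
       else if (a, b) \<in> D4 m11 m12 m21 then 1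
       else 0) \<and>
     \<beta> 1 (a, b) =
      (if (a, b - 1) \<in> D1 m11 m12 m21 then 1
       else if (a, b - 1) \<in> D2 m11 m12 m21 \<union> D3 m11 m12 m21
         then \<beta> 0 (a, b - 1) + \<beta> 0 (a - 1, b) - 1
       else if (a - 1, b) \<in> D4 m11 m12 m21 then 1
       else 0) \<and>
     \<beta> 2 (a, b) =
      (if (a - 1, b - 1) \<in> D2 m11 m12 m21 \<union> D3 m11 m12 m21
         then \<beta> 0 (a - 1, b - 1) - 1
       else 0)"
proof -
  note m = assms(3,4)
  note disj = D_disjoint[OF m]
  let ?N = "central_count m11 m12 m21 (\<lambda>_. True)"
  let ?E = "D2 m11 m12 m21 \<union> D3 m11 m12 m21"
  have \<beta>: "\<beta> u x = int (numbers m11 m12 m21 (gens m11 m12 m21) u x)" for u x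
    unfolding \<beta>_def betti_fat_points_ideal[OF assms(1,2)] ..
  note num = numbers_gens[OF m(2), of m12]
  have \<beta>0: "\<beta> 0 x = ?N x + of_bool (x \<in> D1 m11 m12 m21) + of_bool (x \<in> D4 m11 m12 m21)" for x
    unfolding \<beta> by (rule num(1))
  have \<beta>0_E: "\<beta> 0 (i, j) = ?N (i, j)" if "(i, j) \<in> ?E" for i j
    unfolding \<beta>0 using disj(1,2)[OF that] by simp
  have \<beta>0_E': "\<beta> 0 (a - 1, b) = ?N (a - 1, b)" if "(a, b - 1) \<in> ?E"
    unfolding \<beta>0 using disj(3,4)[OF that] by simp
  have \<beta>1: "\<beta> 1 (a, b) = of_bool ((a - 1, b) \<in> D4 m11 m12 m21) + of_bool ((a, b - 1) \<in> D1 m11 m12 m21) +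
      (if (a, b - 1) \<in> ?E then ?N (a, b - 1) + ?N (a - 1, b) - 1 else 0)"
    unfolding \<beta> num(2) using central_count_first_syzygies[OF m, of a b] by simp
  have \<beta>2: "\<beta> 2 (a, b) = (if (a - 1, b - 1) \<in> ?E then ?N (a - 1, b - 1) - 1 else 0)"
    unfolding \<beta> num(3) using central_count_second_syzygies[OF m] by simp
  show ?thesis
  proof (intro conjI)
    show "\<beta> 0 (a, b) =
      (if (a, b) \<in> D1 m11 m12 m21 then 1
       else if (a, b) \<in> D2 m11 m12 m21 then phi2 (int m21 + B) B b
       else if (a, b) \<in> D3 m11 m12 m21 then 1 + phi2 (int m21 + B) B b
       else if (a, b) \<in> D4 m11 m12 m21 then 1
       else 0)"
      unfolding \<beta>0 central_count_eq[OF m] B_def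
      using disj(1,2)[of a b] D1_D4_disjoint(1)[OF m, of "(a, b)"] by auto
    show "\<beta> 1 (a, b) =
      (if (a, b - 1) \<in> D1 m11 m12 m21 then 1
       else if (a, b - 1) \<in> ?E then \<beta> 0 (a, b - 1) + \<beta> 0 (a - 1, b) - 1
       else if (a - 1, b) \<in> D4 m11 m12 m21 then 1 else 0)"
    proof (cases "(a, b - 1) \<in> ?E")
      case True
      then show ?thesis
        unfolding \<beta>1 using disj[OF True] \<beta>0_E[OF True] \<beta>0_E'[OF True] by simp
    next
      case False
      then show ?thesis
        unfolding \<beta>1 using D1_D4_disjoint(2)[OF m, of a b] by simp
    qed
    show "\<beta> 2 (a, b) = (if (a - 1, b - 1) \<in> ?E then \<beta> 0 (a - 1, b - 1) - 1 else 0)"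
      unfolding \<beta>2 using \<beta>0_E[of "a - 1" "b - 1"] by simp
  qed
qed

end
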